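(* Let $\Sigma$ be an open Riemann surface with the conformal metric $$ds^{2}=\prod_{i=1}^{n}(1+|g_{i}|^{2})^{m_{i}}\,|\omega|^{2},$$ where $G=(g_{1},\ldots,g_{n})\colon \Sigma\to(\overline{\mathbf{C}})^{n}$ is a holomorphic map, $\omega$ is a holomorphic $1$-form on $\Sigma$, and each $m_{i}$ $(i=1,\ldots,n)$ is a positive integer. Assume that $g_{i_{1}},\ldots,g_{i_{k}}$ $(1\leq i_{1}<\cdots<i_{k}\leq n)$ are nonconstant and the others are constant. If the metric $ds^{2}$ is complete and each $g_{i_{l}}$ $(l=1,\ldots,k)$ omits $q_{i_{l}}>2$ distinct values, then $$\sum_{l=1}^{k}\frac{m_{i_{l}}}{q_{i_{l}}-2}\geq 1.$$
   Context: $\overline{\mathbf{C}}=\mathbf{C}\cup\{\infty\}$ is the Riemann sphere and $(\overline{\mathbf{C}})^{n}$ is the product of $n$ copies of it. An open Riemann surface is a connected noncompact Riemann surface. Here $k\ge 1$. That $ds^2$ is a conformal metric means that the displayed expression defines a (smooth, everywhere nondegenerate) Riemannian metric on $\Sigma$ compatible with the complex structure; at poles of the $g_i$ it is understood by continuous extension. A map omits a value (the value is exceptional for it) if the value, in $\overline{\mathbf{C}}$, is never attained by the map. *)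

theory Defs
  imports "HOL-Complex_Analysis.Complex_Analysis"
begin

section \<open>Riemann surfaces\<close>

text \<open>
  A chart is a pair of its domain and its coordinate function; the value of the latter outside
  the domain is irrelevant.
\<close>

type_synonym 'a chart = "'a set \<times> ('a \<Rightarrow> complex)"

abbreviation chart_inv :: "'a chart \<Rightarrow> complex \<Rightarrow> 'a" where
  "chart_inv c \<equiv> inv_into (fst c) (snd c)"

definition is_chart :: "'a topology \<Rightarrow> 'a chart \<Rightarrow> bool" where
  "is_chart X c \<longleftrightarrow> openin X (fst c) \<and> open (snd c ` fst c) \<and>
     homeomorphic_map (subtopology X (fst c)) (top_of_set (snd c ` fst c)) (snd c)"

text \<open>
  Second countability is not required: by Rado's theorem it is automatic.
\<close>

locale riemann_surface =
  fixes X :: "'a topology" and \<A> :: "'a chart set"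
  assumes Hausdorff: "Hausdorff_space X"
    and connected: "connected_space X"
    and charts: "c \<in> \<A> \<Longrightarrow> is_chart X c"
    and cover: "(\<Union>c\<in>\<A>. fst c) = topspace X"
    and compatible: "c \<in> \<A> \<Longrightarrow> d \<in> \<A> \<Longrightarrow>
      (snd d \<circ> chart_inv c) holomorphic_on snd c ` (fst c \<inter> fst d)"

locale open_riemann_surface = riemann_surface +
  assumes noncompact: "\<not> compact_space X"

text \<open>The derivative at \<open>p\<close> of the coordinate of \<open>d\<close> with respect to that of \<open>c\<close>.\<close>

definition transition_deriv :: "'a chart \<Rightarrow> 'a chart \<Rightarrow> 'a \<Rightarrow> complex" where
  "transition_deriv c d p = deriv (snd d \<circ> chart_inv c) (snd c p)"

definition holomorphic_map ::
  "'a topology \<Rightarrow> 'a chart set \<Rightarrow> 'b topology \<Rightarrow> 'b chart set \<Rightarrow> ('a \<Rightarrow> 'b) \<Rightarrow> bool" where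
  "holomorphic_map X \<A> Y \<B> f \<longleftrightarrow> continuous_map X Y f \<and>
     (\<forall>c\<in>\<A>. \<forall>d\<in>\<B>. (snd d \<circ> f \<circ> chart_inv c) holomorphic_on snd c ` {p \<in> fst c. f p \<in> fst d})"

text \<open>
  A holomorphic 1-form is given by its coefficients: in the coordinate \<open>z\<close> of the chart \<open>c\<close> it
  is \<open>\<omega> c dz\<close>, and the coefficients on overlapping charts are related by the chain rule.
\<close>

definition holomorphic_1form ::
  "'a chart set \<Rightarrow> ('a chart \<Rightarrow> 'a \<Rightarrow> complex) \<Rightarrow> bool" where
  "holomorphic_1form \<A> \<omega> \<longleftrightarrow>
     (\<forall>c\<in>\<A>. (\<omega> c \<circ> chart_inv c) holomorphic_on snd c ` fst c) \<and>
     (\<forall>c\<in>\<A>. \<forall>d\<in>\<A>. \<forall>p \<in> fst c \<inter> fst d. \<omega> c p = \<omega> d p * transition_deriv c d p)"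


section \<open>The Riemann sphere\<close>

text \<open>\<open>None\<close> is the point at infinity.\<close>

definition riemann_sphere :: "complex option topology" where
  "riemann_sphere = Alexandroff_compactification euclidean"

definition finite_chart :: "complex option chart" where
  "finite_chart = (- {None}, the)"

definition infinity_chart :: "complex option chart" where
  "infinity_chart = (- {Some 0}, \<lambda>p. case p of None \<Rightarrow> 0 | Some z \<Rightarrow> inverse z)"

definition sphere_atlas :: "complex option chart set" where
  "sphere_atlas = {finite_chart, infinity_chart}"

lemma topspace_riemann_sphere [simp]: "topspace riemann_sphere = UNIV"
  by (auto simp: riemann_sphere_def) (metis not_Some_eq rangeI)

lemma open_Collect_inverse:
  assumes "open (W :: complex set)"
  shows "open {z. z \<noteq> 0 \<and> inverse z \<in> W}"
proof -
  have "open ((- {0}) \<inter> inverse -` W)"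
    by (rule continuous_open_preimage) (auto intro!: continuous_intros assms)
  then show ?thesis by (simp add: vimage_def Int_def)
qed

lemma is_chart_finite: "is_chart riemann_sphere finite_chart"
proof -
  have dom: "- {None} = range (Some :: complex \<Rightarrow> _)"
    by (auto simp: image_iff)
  have rng: "the ` (- {None}) = (UNIV :: complex set)"
    unfolding dom by (auto simp: image_image)
  have op: "openin riemann_sphere (- {None})"
    unfolding dom riemann_sphere_def by simp
  have emb: "embedding_map euclidean riemann_sphere (Some :: complex \<Rightarrow> _)"
    unfolding riemann_sphere_def by (rule embedding_map_Some)
  then obtain h where h: "homeomorphic_maps euclidean (subtopology riemann_sphere (range Some)) Some h"
    by (auto simp: embedding_map_def homeomorphic_map_maps)
  then have "homeomorphic_map (subtopology riemann_sphere (range Some)) euclidean h"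
    using homeomorphic_maps_map by blast
  moreover have "h x = the x" if "x \<in> range Some" for x
    using h that by (auto simp: homeomorphic_maps_def)
  ultimately have "homeomorphic_map (subtopology riemann_sphere (range Some)) euclidean (the :: _ \<Rightarrow> complex)"
    by (metis (no_types, lifting) homeomorphic_map_eq inf_top.left_neutral topspace_riemann_sphere topspace_subtopology)
  then show ?thesis
    using op unfolding is_chart_def finite_chart_def fst_conv snd_conv rng dom by simp
qed

lemma is_chart_infinity: "is_chart riemann_sphere infinity_chart"
proof -
  define f :: "complex option \<Rightarrow> complex" where
    "f = (\<lambda>p. case p of None \<Rightarrow> 0 | Some z \<Rightarrow> inverse z)"
  have inj: "inj_on f (- {Some 0})"
    by (auto simp: inj_on_def f_def split: option.splits)
  have rng: "f ` (- {Some 0}) = UNIV"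
  proof -
    have "w \<in> f ` (- {Some 0})" for w
      by (cases "w = 0") (auto simp: f_def image_iff intro: bexI[of _ "None"] bexI[of _ "Some (inverse w)"])
    then show ?thesis by auto
  qed
  have op: "openin riemann_sphere (- {Some 0})"
    unfolding riemann_sphere_def openin_Alexandroff_compactification
  proof (intro disjI2 exI[of _ "{0}"] conjI)
    show "- {Some 0} = insert None (Some ` (topspace euclidean - {0 :: complex}))"
      by (auto simp: image_iff)
  qed auto
  have cont: "openin riemann_sphere {p \<in> - {Some 0}. f p \<in> W}" if W: "open W" for W
  proof (cases "0 \<in> W")
    case False
    then have "{p \<in> - {Some 0}. f p \<in> W} = Some ` {z. z \<noteq> 0 \<and> inverse z \<in> W}"
      by (auto simp: f_def split: option.splits)
    then show ?thesis
      using open_Collect_inverse[OF W] by (simp add: riemann_sphere_def)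
  next
    case True
    define K where "K = - {z. z \<noteq> 0 \<and> inverse z \<in> W}"
    obtain e where e: "e > 0" "ball 0 e \<subseteq> W"
      using W True openE by blast
    have "K \<subseteq> cball 0 (1/e)"
    proof
      fix z assume z: "z \<in> K"
      show "z \<in> cball 0 (1/e)"
      proof (cases "z = 0")
        case False
        then have "inverse z \<notin> ball 0 e"
          using z e by (auto simp: K_def)
        then have "e \<le> inverse (norm z)"
          by (simp add: norm_inverse)
        then show ?thesis
          using False e by (simp add: field_simps)
      qed (use e in auto)
    qed
    moreover have "closed K"
      unfolding K_def using open_Collect_inverse[OF W] by (simp add: closed_Compl)
    ultimately have "compact K"
      using bounded_cball bounded_subset compact_eq_bounded_closed by blast
    moreover have "{p \<in> - {Some 0}. f p \<in> W} = insert None (Some ` (UNIV - K))"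
      using True by (fastforce simp: f_def K_def split: option.splits)
    ultimately show ?thesis
      unfolding riemann_sphere_def openin_Alexandroff_compactification
      using \<open>closed K\<close> by (intro disjI2 exI[of _ K]) auto
  qed
  have opmap: "open (f ` V)" if V: "openin riemann_sphere V" "V \<subseteq> - {Some 0}" for V
  proof -
    consider U where "open U" "V = Some ` U"
      | C where "compact C" "V = insert None (Some ` (UNIV - C))"
      using V(1) by (auto simp: riemann_sphere_def openin_Alexandroff_compactification)
    then show ?thesis
    proof cases
      case 1
      then have "f ` V = {w. w \<noteq> 0 \<and> inverse w \<in> U}"
        using V(2) by (auto simp: f_def image_iff intro!: bexI[of _ "inverse _"])
      then show ?thesis using open_Collect_inverse[OF 1(1)] by simp
    next
      case 2
      have 0: "0 \<in> C" using 2 V(2) by auto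
      obtain B where B: "B > 0" "C \<subseteq> ball 0 B"
        using 2(1) bounded_subset_ballD compact_imp_bounded by blast
      have "f ` V = {w. w \<noteq> 0 \<and> inverse w \<in> - C} \<union> ball 0 (1/B)"
      proof (intro equalityI subsetI)
        fix w assume "w \<in> f ` V"
        then show "w \<in> {w. w \<noteq> 0 \<and> inverse w \<in> - C} \<union> ball 0 (1/B)"
          using 2 0 B by (auto simp: f_def)
      next
        fix w assume w: "w \<in> {w. w \<noteq> 0 \<and> inverse w \<in> - C} \<union> ball 0 (1/B)"
        show "w \<in> f ` V"
        proof (cases "w = 0")
          case True
          then have "w = f None" by (simp add: f_def)
          then show ?thesis using 2 by blast
        next
          case False
          have "inverse w \<notin> C"
          proof
            assume "inverse w \<in> C"
            with w False have "norm w < 1/B" "inverse (norm w) < B"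
              using B by (auto simp: norm_inverse)
            then show False using False B by (simp add: field_simps)
          qed
          then have "Some (inverse w) \<in> V" using 2 by auto
          moreover have "w = f (Some (inverse w))" by (simp add: f_def)
          ultimately show ?thesis by blast
        qed
      qed
      moreover have "open (- C)" using 2(1) compact_imp_closed by blast
      ultimately show ?thesis
        using open_Collect_inverse[of "- C"] by (metis open_Un open_ball)
    qed
  qed
  have "homeomorphic_map (subtopology riemann_sphere (- {Some 0})) euclidean f"
  proof (rule bijective_open_imp_homeomorphic_map)
    have "openin (subtopology riemann_sphere (- {Some 0})) {p \<in> - {Some 0}. f p \<in> W}" if "open W" for W
      using cont[OF that] op by (auto simp: openin_open_subtopology)
    then show "continuous_map (subtopology riemann_sphere (- {Some 0})) euclidean f"
      by (simp add: continuous_map_def)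
    show "open_map (subtopology riemann_sphere (- {Some 0})) euclidean f"
      unfolding open_map_def using opmap op by (simp add: openin_open_subtopology)
  qed (use inj rng in auto)
  then show ?thesis
    using op rng unfolding is_chart_def infinity_chart_def f_def by simp
qed

lemma riemann_surface_riemann_sphere: "riemann_surface riemann_sphere sphere_atlas"
proof
  show "Hausdorff_space riemann_sphere"
    by (simp add: riemann_sphere_def Hausdorff_space_Alexandroff_compactification locally_compact_space_euclidean)
  have "connectedin riemann_sphere (range Some)"
    unfolding riemann_sphere_def
    by (rule connectedin_continuous_map_image[OF continuous_map_Some])
       (simp add: connected_UNIV)
  moreover have "\<not> compact_space (euclidean :: complex topology)"
    unfolding compact_space_def by (simp only: topspace_euclidean compactin_euclidean_iff not_compact_UNIV not_False_eq_True)
  then have "riemann_sphere closure_of (range Some) = topspace riemann_sphere"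
    using Alexandroff_compactification_dense[of "euclidean :: complex topology"]
    by (simp add: riemann_sphere_def)
  ultimately have "connectedin riemann_sphere (topspace riemann_sphere)"
    by (metis connectedin_closure_of)
  then show "connected_space riemann_sphere"
    by (simp only: connectedin_topspace)
  show "is_chart riemann_sphere c" if "c \<in> sphere_atlas" for c
    using that is_chart_finite is_chart_infinity by (auto simp: sphere_atlas_def)
  show "(\<Union>c\<in>sphere_atlas. fst c) = topspace riemann_sphere"
    by (auto simp: sphere_atlas_def finite_chart_def infinity_chart_def)
  fix c d assume cd: "c \<in> sphere_atlas" "d \<in> sphere_atlas"
  define D where "D = snd c ` (fst c \<inter> fst d)"
  have inj: "inj_on (snd c) (fst c)"
    using cd is_chart_finite is_chart_infinity
    by (auto simp: sphere_atlas_def is_chart_def homeomorphic_map_def openin_subset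
        intro: inj_on_subset)
  have inv: "(snd d \<circ> chart_inv c) (snd c p) = snd d p" if "p \<in> fst c" for p
    using inj that by simp
  show "(snd d \<circ> chart_inv c) holomorphic_on snd c ` (fst c \<inter> fst d)"
  proof (cases "c = d")
    case True
    have "(\<lambda>z. z) holomorphic_on snd c ` (fst c \<inter> fst d)" by (intro holomorphic_intros)
    then show ?thesis
      by (rule holomorphic_transform) (use inv True in auto)
  next
    case False
    have nz: "0 \<notin> snd c ` (fst c \<inter> fst d)"
      using cd False
      by (auto simp: sphere_atlas_def finite_chart_def infinity_chart_def split: option.splits)
    have "inverse holomorphic_on snd c ` (fst c \<inter> fst d)"
      by (intro holomorphic_on_inverse holomorphic_on_id[unfolded id_def]) (use nz in auto)
    then show ?thesis
    proof (rule holomorphic_transform)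
      fix z assume "z \<in> snd c ` (fst c \<inter> fst d)"
      then obtain p where p: "p \<in> fst c" "p \<in> fst d" "z = snd c p" by auto
      have "snd d p = inverse (snd c p)"
        using p(1,2) cd False
        by (auto simp: sphere_atlas_def finite_chart_def infinity_chart_def split: option.splits)
      then show "inverse z = (snd d \<circ> chart_inv c) z"
        using inv p by simp
    qed
  qed
qed

text \<open>
  A map into the product of \<open>n\<close> Riemann spheres is the family of its components; in the
  product charts, holomorphy of such a map means holomorphy of each component.
\<close>

definition holomorphic_map_to_spheres ::
  "'a topology \<Rightarrow> 'a chart set \<Rightarrow> nat \<Rightarrow> (nat \<Rightarrow> 'a \<Rightarrow> complex option) \<Rightarrow> bool" where
  "holomorphic_map_to_spheres X \<A> n g \<longleftrightarrow>
     (\<forall>i\<in>{1..n}. holomorphic_map X \<A> riemann_sphere sphere_atlas (g i))"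

text \<open>At least \<open>q\<close> values are omitted; the set \<open>E\<close> is finite when \<open>q > 0\<close>.\<close>

definition omits_values :: "'a topology \<Rightarrow> ('a \<Rightarrow> complex option) \<Rightarrow> nat \<Rightarrow> bool" where
  "omits_values X f q \<longleftrightarrow> (\<exists>E. card E = q \<and> f ` topspace X \<inter> E = {})"


section \<open>Conformal metrics\<close>

primrec Ck_on :: "nat \<Rightarrow> ('v::euclidean_space \<Rightarrow> real) \<Rightarrow> 'v set \<Rightarrow> bool" where
  "Ck_on 0 f S \<longleftrightarrow> continuous_on S f"
| "Ck_on (Suc k) f S \<longleftrightarrow> (\<forall>x\<in>S. f differentiable at x) \<and>
     (\<forall>v. Ck_on k (\<lambda>x. frechet_derivative f (at x) v) S)"

definition smooth_function_on :: "('v::euclidean_space \<Rightarrow> real) \<Rightarrow> 'v set \<Rightarrow> bool" where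
  "smooth_function_on f S \<longleftrightarrow> (\<forall>k. Ck_on k f S)"

text \<open>
  A Riemannian metric compatible with the complex structure is \<open>\<rho> c |dz|\<^sup>2\<close> in the coordinate
  \<open>z\<close> of the chart \<open>c\<close>, with \<open>\<rho> c\<close> smooth and positive.
\<close>

definition conformal_metric ::
  "'a chart set \<Rightarrow> ('a chart \<Rightarrow> 'a \<Rightarrow> real) \<Rightarrow> bool" where
  "conformal_metric \<A> \<rho> \<longleftrightarrow>
     (\<forall>c\<in>\<A>. smooth_function_on (\<rho> c \<circ> chart_inv c) (snd c ` fst c) \<and> (\<forall>p\<in>fst c. 0 < \<rho> c p)) \<and>
     (\<forall>c\<in>\<A>. \<forall>d\<in>\<A>. \<forall>p \<in> fst c \<inter> fst d. \<rho> c p = \<rho> d p * (cmod (transition_deriv c d p))\<^sup>2)"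

text \<open>
  The formula for the metric makes sense where all \<open>g i\<close> are finite. This set has to be dense
  (which only excludes that some \<open>g i\<close> is identically infinite), so that a conformal metric,
  being continuous, is determined by the formula, at poles by continuous extension.
\<close>

definition is_product_metric ::
  "'a topology \<Rightarrow> 'a chart set \<Rightarrow> nat \<Rightarrow> (nat \<Rightarrow> 'a \<Rightarrow> complex option) \<Rightarrow> (nat \<Rightarrow> nat) \<Rightarrow>
     ('a chart \<Rightarrow> 'a \<Rightarrow> complex) \<Rightarrow> ('a chart \<Rightarrow> 'a \<Rightarrow> real) \<Rightarrow> bool" where
  "is_product_metric X \<A> n g m \<omega> \<rho> \<longleftrightarrow>
     (let R = {p \<in> topspace X. \<forall>i\<in>{1..n}. g i p \<noteq> None} in
       X closure_of R = topspace X \<and>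
       (\<forall>c\<in>\<A>. \<forall>p \<in> fst c \<inter> R.
          \<rho> c p = (\<Prod>i=1..n. (1 + (cmod (the (g i p)))\<^sup>2) ^ m i) * (cmod (\<omega> c p))\<^sup>2))"


section \<open>Completeness\<close>

definition piecewise_C1_curve :: "'a topology \<Rightarrow> 'a chart set \<Rightarrow> (real \<Rightarrow> 'a) \<Rightarrow> bool" where
  "piecewise_C1_curve X \<A> \<gamma> \<longleftrightarrow> pathin X \<gamma> \<and>
     (\<exists>S. finite S \<and>
       (\<forall>c\<in>\<A>. (snd c \<circ> \<gamma>) C1_differentiable_on ({t \<in> {0..1}. \<gamma> t \<in> fst c} - S)))"

definition chart_at :: "'a chart set \<Rightarrow> 'a \<Rightarrow> 'a chart" where
  "chart_at \<A> p = (SOME c. c \<in> \<A> \<and> p \<in> fst c)"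

text \<open>
  For a conformal metric the integrand does not depend on the choice of the charts. The curves
  above may have unbounded derivative at the finitely many exceptional parameters; their length
  may then be infinite.
\<close>

definition curve_length ::
  "'a chart set \<Rightarrow> ('a chart \<Rightarrow> 'a \<Rightarrow> real) \<Rightarrow> (real \<Rightarrow> 'a) \<Rightarrow> ennreal" where
  "curve_length \<A> \<rho> \<gamma> =
     (\<integral>\<^sup>+t\<in>{0..1}. ennreal (let c = chart_at \<A> (\<gamma> t) in
        sqrt (\<rho> c (\<gamma> t)) * cmod (vector_derivative (snd c \<circ> \<gamma>) (at t))) \<partial>lborel)"

definition riemannian_dist ::
  "'a topology \<Rightarrow> 'a chart set \<Rightarrow> ('a chart \<Rightarrow> 'a \<Rightarrow> real) \<Rightarrow> 'a \<Rightarrow> 'a \<Rightarrow> ennreal" where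
  "riemannian_dist X \<A> \<rho> x y =
     (INF \<gamma>\<in>{\<gamma>. piecewise_C1_curve X \<A> \<gamma> \<and> \<gamma> 0 = x \<and> \<gamma> 1 = y}. curve_length \<A> \<rho> \<gamma>)"

text \<open>Every Cauchy sequence of the Riemannian distance converges.\<close>

definition complete_metric ::
  "'a topology \<Rightarrow> 'a chart set \<Rightarrow> ('a chart \<Rightarrow> 'a \<Rightarrow> real) \<Rightarrow> bool" where
  "complete_metric X \<A> \<rho> \<longleftrightarrow>
     (\<forall>\<sigma>::nat \<Rightarrow> 'a. range \<sigma> \<subseteq> topspace X \<and>
        (\<forall>\<epsilon>>0. \<exists>N. \<forall>j\<ge>N. \<forall>k\<ge>N. riemannian_dist X \<A> \<rho> (\<sigma> j) (\<sigma> k) < \<epsilon>) \<longrightarrow>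
        (\<exists>x\<in>topspace X. (\<lambda>j. riemannian_dist X \<A> \<rho> (\<sigma> j) x) \<longlonglongrightarrow> 0))"

end

theory Submission
  imports Defs
begin

text \<open>
  Suppose that the sum is less than \<open>1\<close>. Completeness is then contradicted by a curve of finite length without
  an end point on the surface \<open>\<Sigma>\<close>. It is found by Fujimoto's method of flat metrics.

  Move one omitted value of each nonconstant \<open>g\<^sub>i\<close> to infinity by a Moebius transformation. This gives
  holomorphic functions \<open>h\<^sub>i : \<Sigma> \<rightarrow> \<complex>\<close> that omit the \<open>q\<^sub>i - 1\<close> values of a set \<open>B\<^sub>i\<close>, and up to a constant factor
  \<open>ds\<^sup>2 \<le> \<kappa>\<^sup>2 \<Prod> (1 + |h\<^sub>i|)\<^bsup>2 m\<^sub>i\<^esup>\<close>, where \<open>\<kappa>\<close> is locally the modulus of a holomorphic function without zeros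
  (\<open>normalized_density_locally_modulus\<close>). Since the sum of the \<open>m\<^sub>i / (q\<^sub>i - 2)\<close> is less than \<open>1\<close>, there are exponents
  \<open>\<nu>\<^sub>i > m\<^sub>i / (q\<^sub>i - 2)\<close> whose sum \<open>\<nu>\<close> is less than \<open>1\<close> with \<open>\<nu>\<^sub>i \<ge> 1 - \<nu>\<close>, and then \<open>0 < \<eta>\<^sub>i < 1\<close> with
  \<open>m\<^sub>i = \<nu>\<^sub>i (q\<^sub>i - 2 - q\<^sub>i \<eta>\<^sub>i)\<close>. On the set where no \<open>h\<^sub>i'\<close> vanishes, consider the flat metric with density
  \<open>\<sigma> = \<kappa>\<^bsup>\<epsilon>\<^esup> \<Prod> (w\<^sub>i / |h\<^sub>i'|)\<^bsup>\<epsilon> \<nu>\<^sub>i\<^esup>\<close>, where \<open>w\<^sub>i\<close> is the product of the \<open>|h\<^sub>i - b|\<^bsup>1 - \<eta>\<^sub>i\<^esup>\<close> over \<open>b \<in> B\<^sub>i\<close> and \<open>\<epsilon> = 1 / (1 - \<nu>)\<close>.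

  Map a Euclidean disc of the largest possible radius \<open>R\<close> locally isometrically into this flat surface. In the
  coordinate of the disc \<open>\<sigma> = 1\<close>, which determines \<open>\<kappa>\<close>: it is the product of the \<open>(|h\<^sub>i'| / w\<^sub>i)\<^bsup>\<nu>\<^sub>i\<^esup>\<close>
  (\<open>density_in_flat_coordinate\<close>). Landau's theorem in the form of \<open>deriv_bound_disc_omitting_finite_set\<close> bounds
  \<open>|h\<^sub>i'| (1 + |h\<^sub>i|)\<^bsup>q\<^sub>i - 2 - q\<^sub>i \<eta>\<^sub>i\<^esup> / w\<^sub>i\<close> by a multiple of \<open>1 / (R - |w|)\<close>. Hence \<open>R\<close> is finite
  (\<open>no_entire_isometry\<close>), and \<open>ds \<le> C |dw| / (R - |w|)\<^bsup>\<nu>\<^esup>\<close>. As \<open>\<nu> < 1\<close>, every radius has finite length, and by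
  completeness its image converges to a point \<open>x\<close> of \<open>\<Sigma>\<close> (\<open>ray_converges\<close>).

  For at least one radius, this is impossible. If every image ended at a point of the flat surface, the disc could
  be enlarged (\<open>maximal_disc\<close>). If \<open>x\<close> is a zero of some \<open>h\<^sub>i'\<close>, then \<open>\<sigma>\<close> has a singularity of order at least
  \<open>\<epsilon> \<nu>\<^sub>i \<ge> 1\<close> at \<open>x\<close>, so that \<open>x\<close> is infinitely far away in the flat metric, whereas the radius has length \<open>R\<close>
  (\<open>ray_avoids_singular_point\<close>).
\<close>

section \<open>Holomorphic functions on a disc that omit values\<close>

text \<open>
  Schottky's theorem bounds \<open>F\<close> on a smaller disc, and the Cauchy inequality then bounds \<open>F' 0\<close>.
\<close>

lemma deriv_bound_omitting_0_1:
  obtains L :: real where "0 < L"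
    "\<And>F. F holomorphic_on ball 0 1 \<Longrightarrow> (\<And>z. z \<in> ball 0 1 \<Longrightarrow> F z \<noteq> 0 \<and> F z \<noteq> 1) \<Longrightarrow>
       cmod (F 0) \<le> 1 \<Longrightarrow> cmod (deriv F 0) \<le> L"
proof
  define M where "M = exp (pi * exp (pi * (2 + 2 * 1 + 12 * (1/2) / (1 - 1/2))))"
  show "0 < 4 * M" by (simp add: M_def)
  fix F :: "complex \<Rightarrow> complex"
  assume F: "F holomorphic_on ball 0 1" "\<And>z. z \<in> ball 0 1 \<Longrightarrow> F z \<noteq> 0 \<and> F z \<noteq> 1"
    and F0: "cmod (F 0) \<le> 1"
  define G where "G = (\<lambda>z. F (z / 2))"
  have G: "G holomorphic_on cball 0 1"
    unfolding G_def by (rule holomorphic_on_compose_gen[OF _ F(1), unfolded o_def])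
      (auto intro!: holomorphic_intros)
  have *: "cmod (G z) \<le> M" if "cmod z \<le> 1/2" for z
    unfolding M_def
  proof (rule Schottky[OF G])
    show "cmod (G 0) \<le> 1" using F0 by (simp add: G_def)
    show "\<not> (G z = 0 \<or> G z = 1)" if "z \<in> cball 0 1" for z
      using F(2)[of "z/2"] that by (auto simp: G_def)
  qed (use that in auto)
  have bd: "cmod (F z) \<le> M" if "cmod z \<le> 1/4" for z
    using * [of "2 * z"] that by (simp add: G_def norm_mult)
  have "cmod ((deriv ^^ 1) F 0) \<le> fact 1 * M / (1/4) ^ 1"
  proof (rule Cauchy_inequality)
    show "F holomorphic_on ball 0 (1/4)"
      using F(1) by (rule holomorphic_on_subset) auto
    show "continuous_on (cball 0 (1/4)) F"
      by (rule continuous_on_subset[OF holomorphic_on_imp_continuous_on[OF F(1)]]) auto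
  qed (use bd in auto)
  then show "cmod (deriv F 0) \<le> 4 * M" by (simp add: mult.commute)
qed

text \<open>
  An \<open>N\<close>-th root \<open>G\<close> of \<open>F\<close> omits \<open>0\<close> and \<open>1\<close> as well, so \<open>G' 0\<close> is bounded, and
  \<open>F' = N G\<^bsup>N - 1\<^esup> G'\<close> gains the factor \<open>|F|\<^bsup>1 - 1/N\<^esup>\<close>.
\<close>

lemma deriv_bound_omitting_0_1_powr:
  fixes \<eta> :: real
  assumes "0 < \<eta>"
  obtains L where "0 < L"
    "\<And>F. F holomorphic_on ball 0 1 \<Longrightarrow> (\<And>z. z \<in> ball 0 1 \<Longrightarrow> F z \<noteq> 0 \<and> F z \<noteq> 1) \<Longrightarrow>
       cmod (F 0) \<le> 1 \<Longrightarrow> cmod (deriv F 0) \<le> L * cmod (F 0) powr (1 - \<eta>)"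
proof -
  obtain L where L: "0 < L"
    "\<And>F. F holomorphic_on ball 0 1 \<Longrightarrow> (\<And>z. z \<in> ball 0 1 \<Longrightarrow> F z \<noteq> 0 \<and> F z \<noteq> 1) \<Longrightarrow>
       cmod (F 0) \<le> 1 \<Longrightarrow> cmod (deriv F 0) \<le> L"
    using deriv_bound_omitting_0_1 by metis
  obtain N :: nat where N: "N > 0" "1 / real N < \<eta>"
    using real_arch_inverse[of \<eta>] assms by (auto simp: inverse_eq_divide)
  show thesis
  proof
    show "0 < real N * L" using L N by simp
    fix F :: "complex \<Rightarrow> complex"
    assume F: "F holomorphic_on ball 0 1" "\<And>z. z \<in> ball 0 1 \<Longrightarrow> F z \<noteq> 0 \<and> F z \<noteq> 1"
      and F0: "cmod (F 0) \<le> 1"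
    obtain l where l: "l holomorphic_on ball 0 1" "\<And>z. z \<in> ball 0 1 \<Longrightarrow> F z = exp (l z)"
      by (rule contractible_imp_holomorphic_log[OF F(1)]) (use F(2) in \<open>auto simp: convex_imp_contractible\<close>)
    define G where "G = (\<lambda>z. exp (l z / of_nat N))"
    have G: "G holomorphic_on ball 0 1"
      unfolding G_def using l(1) by (auto intro!: holomorphic_intros simp: N)
    have GN: "G z ^ N = F z" if "z \<in> ball 0 1" for z
      using that N l(2) by (simp add: G_def flip: exp_of_nat_mult)
    have G01: "G z \<noteq> 0 \<and> G z \<noteq> 1" if "z \<in> ball 0 1" for z
      using F(2)[OF that] GN[OF that] N by (auto simp: power_0_left)
    have nGN: "cmod (G 0) ^ N = cmod (F 0)"
      using GN[of 0] by (simp flip: norm_power)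
    then have G0: "cmod (G 0) \<le> 1"
      using F0 N by (metis norm_ge_zero not_le one_less_power)
    have pos: "0 < cmod (F 0)" "0 < cmod (G 0)"
      using F(2)[of 0] G01[of 0] by auto
    have "cmod (deriv G 0) \<le> L" by (rule L(2)[OF G G01 G0])
    have "(G has_field_derivative deriv G 0) (at 0)"
      by (rule holomorphic_derivI[OF G]) auto
    then have "((\<lambda>z. G z ^ N) has_field_derivative of_nat N * (deriv G 0 * G 0 ^ (N - Suc 0))) (at 0)"
      by (rule DERIV_power)
    then have "(F has_field_derivative of_nat N * (deriv G 0 * G 0 ^ (N - Suc 0))) (at 0)"
      by (rule has_field_derivative_transform_within_open[where S = "ball 0 1"]) (use GN in auto)
    then have "deriv F 0 = of_nat N * (deriv G 0 * G 0 ^ (N - Suc 0))"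
      by (rule DERIV_imp_deriv)
    then have "cmod (deriv F 0) = real N * (cmod (deriv G 0) * cmod (G 0) ^ (N - Suc 0))"
      by (simp add: norm_mult norm_power)
    also have "\<dots> \<le> real N * (L * cmod (G 0) ^ (N - Suc 0))"
      using \<open>cmod (deriv G 0) \<le> L\<close> by (intro mult_left_mono mult_right_mono) auto
    also have "cmod (G 0) ^ (N - Suc 0) = cmod (F 0) powr (1 - 1 / real N)"
    proof -
      have "cmod (G 0) = cmod (F 0) powr (1 / real N)"
        using nGN[symmetric] pos N by (simp add: powr_powr flip: powr_realpow)
      moreover have "1 / real N * real (N - Suc 0) = 1 - 1 / real N"
        using N by (simp add: of_nat_diff field_simps)
      ultimately show ?thesis
        using pos by (simp add: powr_powr flip: powr_realpow)
    qed
    also have "cmod (F 0) powr (1 - 1 / real N) \<le> cmod (F 0) powr (1 - \<eta>)"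
      by (rule powr_mono') (use N F0 pos in auto)
    finally show "cmod (deriv F 0) \<le> real N * L * cmod (F 0) powr (1 - \<eta>)"
      using L N by (simp add: mult.assoc)
  qed
qed

text \<open>
  If \<open>h 0\<close> is nearer to \<open>b\<close> than \<open>b'\<close> is, the affine map with \<open>b \<mapsto> 0\<close> and \<open>b' \<mapsto> 1\<close> reduces this to the preceding
  lemma; otherwise a Moebius map with \<open>\<infinity> \<mapsto> 0\<close> and \<open>b' \<mapsto> 1\<close> does. The last factor is the price for a single
  formula that covers a neighbourhood of infinity.
\<close>

lemma deriv_bound_near_omitted_value:
  fixes \<eta> :: real and b b' :: complex
  assumes "0 < \<eta>" "b \<noteq> b'"
  obtains L where "0 < L"
    "\<And>h. h holomorphic_on ball 0 1 \<Longrightarrow> (\<And>z. z \<in> ball 0 1 \<Longrightarrow> h z \<noteq> b \<and> h z \<noteq> b') \<Longrightarrow>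
       cmod (deriv h 0) \<le> L * cmod (h 0 - b) powr (1 - \<eta>) * (1 + cmod (h 0)) powr (2 * \<eta>)"
proof -
  obtain L where L: "0 < L"
    "\<And>F. F holomorphic_on ball 0 1 \<Longrightarrow> (\<And>z. z \<in> ball 0 1 \<Longrightarrow> F z \<noteq> 0 \<and> F z \<noteq> 1) \<Longrightarrow>
       cmod (F 0) \<le> 1 \<Longrightarrow> cmod (deriv F 0) \<le> L * cmod (F 0) powr (1 - \<eta>)"
    using deriv_bound_omitting_0_1_powr[OF assms(1)] by metis
  define D where "D = cmod (b' - b)"
  have D: "D > 0" using assms by (simp add: D_def)
  \<comment> \<open>the sum of the constants that the two cases below require\<close>
  define K where "K = L * D powr \<eta> + L * D powr (-\<eta>) * (1 + cmod b) powr (2 * \<eta>)"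
  have K: "L * D powr \<eta> \<le> K" "L * D powr (-\<eta>) * (1 + cmod b) powr (2 * \<eta>) \<le> K"
    using L by (auto simp: K_def)
  show thesis
  proof
    show "K > 0" using K(1) L D by (smt (verit) mult_pos_pos powr_gt_zero)
    fix h :: "complex \<Rightarrow> complex"
    assume h: "h holomorphic_on ball 0 1" "\<And>z. z \<in> ball 0 1 \<Longrightarrow> h z \<noteq> b \<and> h z \<noteq> b'"
    have dh: "(h has_field_derivative deriv h 0) (at 0)"
      by (rule holomorphic_derivI[OF h(1)]) auto
    define x where "x = cmod (h 0 - b)"
    have x: "x > 0" using h(2)[of 0] by (simp add: x_def)
    have ge1: "1 \<le> (1 + cmod (h 0)) powr (2 * \<eta>)"
      using assms by (intro ge_one_powr_ge_zero) auto
    show "cmod (deriv h 0) \<le> K * cmod (h 0 - b) powr (1 - \<eta>) * (1 + cmod (h 0)) powr (2 * \<eta>)"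
    proof (cases "x \<le> D")
      case True
      define F where "F = (\<lambda>z. (h z - b) / (b' - b))"
      have "(F has_field_derivative deriv h 0 / (b' - b)) (at 0)"
        unfolding F_def by (rule DERIV_cdivide) (use DERIV_diff[OF dh DERIV_const[of b]] in simp)
      then have dF: "deriv F 0 = deriv h 0 / (b' - b)" by (rule DERIV_imp_deriv)
      have "cmod (deriv F 0) \<le> L * cmod (F 0) powr (1 - \<eta>)"
      proof (rule L(2))
        show "F holomorphic_on ball 0 1" unfolding F_def using assms h(1) by (auto intro!: holomorphic_intros)
        show "F z \<noteq> 0 \<and> F z \<noteq> 1" if "z \<in> ball 0 1" for z
          using h(2)[OF that] assms by (auto simp: F_def)
        show "cmod (F 0) \<le> 1" using True D by (simp add: F_def norm_divide x_def D_def)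
      qed
      then have "cmod (deriv h 0) / D \<le> L * (x / D) powr (1 - \<eta>)"
        unfolding dF by (simp add: F_def norm_divide x_def D_def)
      then have "cmod (deriv h 0) \<le> L * (x powr (1 - \<eta>) / D powr (1 - \<eta>)) * D"
        using D x by (simp add: powr_divide field_simps)
      also have "\<dots> = L * D powr \<eta> * x powr (1 - \<eta>)"
        using D by (simp add: powr_diff)
      also have "\<dots> \<le> K * x powr (1 - \<eta>)"
        using K by (intro mult_right_mono) auto
      also have "\<dots> \<le> K * x powr (1 - \<eta>) * (1 + cmod (h 0)) powr (2 * \<eta>)"
        using ge1 \<open>K > 0\<close> by (metis (no_types, lifting) less_imp_le mult_left_mono mult.right_neutral powr_ge_zero mult_nonneg_nonneg)
      finally show ?thesis by (simp add: x_def)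
    next
      case False
      define F where "F = (\<lambda>z. (b' - b) / (h z - b))"
      have "(F has_field_derivative - (deriv h 0 * (b' - b)) / (h 0 - b)\<^sup>2) (at 0)"
        unfolding F_def using h(2)[of 0] 
        by (auto intro!: derivative_eq_intros dh simp: power2_eq_square)
      then have dF: "deriv F 0 = - (deriv h 0 * (b' - b)) / (h 0 - b)\<^sup>2" by (rule DERIV_imp_deriv)
      have "cmod (deriv F 0) \<le> L * cmod (F 0) powr (1 - \<eta>)"
      proof (rule L(2))
        show "F holomorphic_on ball 0 1" unfolding F_def using h by (auto intro!: holomorphic_intros)
        show "F z \<noteq> 0 \<and> F z \<noteq> 1" if "z \<in> ball 0 1" for z
          using h(2)[OF that] assms by (auto simp: F_def)
        show "cmod (F 0) \<le> 1" using False D x by (simp add: F_def norm_divide x_def D_def)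
      qed
      then have "cmod (deriv h 0) * D / x\<^sup>2 \<le> L * (D / x) powr (1 - \<eta>)"
        unfolding dF by (simp add: F_def norm_divide norm_mult norm_power x_def D_def)
      then have "cmod (deriv h 0) * D \<le> L * (D powr (1 - \<eta>) / x powr (1 - \<eta>)) * x\<^sup>2"
        using D x by (simp add: powr_divide field_simps)
      also have "\<dots> = L * D powr (-\<eta>) * x powr (1 - \<eta>) * x powr (2 * \<eta>) * D"
        using D x by (simp add: powr_diff powr_minus field_simps power2_eq_square flip: powr_add)
      finally have "cmod (deriv h 0) \<le> L * D powr (-\<eta>) * x powr (1 - \<eta>) * x powr (2 * \<eta>)"
        using D by simp
      also have "\<dots> \<le> L * D powr (-\<eta>) * x powr (1 - \<eta>) * ((1 + cmod b) * (1 + cmod (h 0))) powr (2 * \<eta>)"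
      proof (rule mult_left_mono[OF powr_mono2])
        have "x \<le> cmod (h 0) + cmod b" unfolding x_def by (rule norm_triangle_ineq4)
        also have "\<dots> \<le> (1 + cmod b) * (1 + cmod (h 0))" by (simp add: algebra_simps)
        finally show "x \<le> (1 + cmod b) * (1 + cmod (h 0))" .
      qed (use x assms L in auto)
      finally have "cmod (deriv h 0) \<le> (L * D powr (-\<eta>) * (1 + cmod b) powr (2 * \<eta>)) * x powr (1 - \<eta>) * (1 + cmod (h 0)) powr (2 * \<eta>)"
        by (simp add: powr_mult mult_ac)
      also have "\<dots> \<le> K * x powr (1 - \<eta>) * (1 + cmod (h 0)) powr (2 * \<eta>)"
        using K by (intro mult_right_mono) auto
      finally show ?thesis by (simp add: x_def)
    qed
  qed
qed

text \<open>
  In the scale \<open>1 + |w|\<close>, a point \<open>w\<close> cannot be close to two values, and for large \<open>w\<close> not even to one.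
\<close>

lemma at_most_one_value_near:
  fixes B :: "complex set"
  assumes "finite B"
  obtains c :: real where "0 < c" "c \<le> 1" "\<And>w b b'. b \<in> B \<Longrightarrow> b' \<in> B \<Longrightarrow> b \<noteq> b' \<Longrightarrow>
    c * (1 + cmod w) \<le> cmod (w - b) \<or> c * (1 + cmod w) \<le> cmod (w - b')"
proof -
  obtain M where M: "\<And>b. b \<in> B \<Longrightarrow> cmod b \<le> M" "M \<ge> 0"
    using finite_imp_bounded[OF assms] unfolding bounded_pos by (meson less_imp_le)
  obtain s where s: "s > 0" "\<And>b b'. b \<in> B \<Longrightarrow> b' \<in> B \<Longrightarrow> b \<noteq> b' \<Longrightarrow> s \<le> dist b b'"
  proof -
    define P where "P = insert 1 ((\<lambda>p. dist (fst p) (snd p)) ` {p \<in> B \<times> B. fst p \<noteq> snd p})"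
    have fin: "finite P" unfolding P_def using assms by simp
    have "Min P > 0" using fin by (subst Min_gr_iff) (auto simp: P_def)
    moreover have "Min P \<le> dist b b'" if "b \<in> B" "b' \<in> B" "b \<noteq> b'" for b b'
      using fin that by (intro Min_le) (force simp: P_def)+
    ultimately show ?thesis using that by blast
  qed
  define c where "c = min (1/2) (s / (2 * (2 + 2 * M)))"
  have c_le: "c \<le> 1/2" "c \<le> s / (2 * (2 + 2 * M))"
    unfolding c_def by (rule min.cobounded1, rule min.cobounded2)
  show thesis
  proof
    show "c > 0" using s M by (simp add: c_def)
    show "c \<le> 1" using c_le by simp
    fix w b b' assume b: "b \<in> B" "b' \<in> B" "b \<noteq> b'"
    show "c * (1 + cmod w) \<le> cmod (w - b) \<or> c * (1 + cmod w) \<le> cmod (w - b')"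
    proof (rule ccontr)
      assume "\<not> ?thesis"
      then have lt: "cmod (w - b) < c * (1 + cmod w)" "cmod (w - b') < c * (1 + cmod w)" by auto
      have "c * (1 + cmod w) \<le> 1/2 * (1 + cmod w)" using c_le by (intro mult_right_mono) auto
      moreover have "cmod w - cmod b \<le> cmod (w - b)" by (rule norm_triangle_ineq2)
      ultimately have "1 + cmod w \<le> 2 + 2 * M" using lt(1) M(1)[OF b(1)] by simp
      then have "c * (1 + cmod w) \<le> s / (2 * (2 + 2 * M)) * (2 + 2 * M)"
        using s M c_le by (intro mult_mono) auto
      also have "\<dots> = s / 2" using M by (simp add: field_simps)
      finally have "dist w b < s / 2" "dist w b' < s / 2" using lt by (auto simp: dist_norm)
      then have "dist b b' < s" using dist_triangle_half_r by blast
      then show False using s(2)[OF b] by simp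
    qed
  qed
qed

text \<open>
  The bound for the value of \<open>B\<close> that is nearest to \<open>h 0\<close> implies the one with the whole product, because the
  distances to all other values are comparable with \<open>1 + |h 0|\<close>. With \<open>q = card B + 1\<close>, counting infinity as
  omitted, the exponent on the left is \<open>q - 2 - q \<eta>\<close>.
\<close>

lemma deriv_bound_omitting_finite_set:
  fixes \<eta> :: real and B :: "complex set"
  assumes "0 < \<eta>" "\<eta> < 1" "finite B" "2 \<le> card B"
  obtains L where "0 < L"
    "\<And>h. h holomorphic_on ball 0 1 \<Longrightarrow> h ` ball 0 1 \<inter> B = {} \<Longrightarrow>
       cmod (deriv h 0) * (1 + cmod (h 0)) powr (real (card B) - 1 - (real (card B) + 1) * \<eta>)
         \<le> L * (\<Prod>b\<in>B. cmod (h 0 - b) powr (1 - \<eta>))"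
proof -
  obtain c where c: "0 < c" "c \<le> 1" "\<And>w b b'. b \<in> B \<Longrightarrow> b' \<in> B \<Longrightarrow> b \<noteq> b' \<Longrightarrow>
    c * (1 + cmod w) \<le> cmod (w - b) \<or> c * (1 + cmod w) \<le> cmod (w - b')"
    using at_most_one_value_near[OF assms(3)] by metis
  have "\<forall>b\<in>B. \<exists>L>0. \<forall>h. h holomorphic_on ball 0 1 \<longrightarrow> h ` ball 0 1 \<inter> B = {} \<longrightarrow>
       cmod (deriv h 0) \<le> L * cmod (h 0 - b) powr (1 - \<eta>) * (1 + cmod (h 0)) powr (2 * \<eta>)"
  proof
    fix b assume b: "b \<in> B"
    obtain b' where b': "b' \<in> B" "b \<noteq> b'"
    proof -
      have "B \<noteq> {b}" using assms by auto
      then show ?thesis using that b by blast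
    qed
    obtain L where "0 < L"
      "\<And>h. h holomorphic_on ball 0 1 \<Longrightarrow> (\<And>z. z \<in> ball 0 1 \<Longrightarrow> h z \<noteq> b \<and> h z \<noteq> b') \<Longrightarrow>
       cmod (deriv h 0) \<le> L * cmod (h 0 - b) powr (1 - \<eta>) * (1 + cmod (h 0)) powr (2 * \<eta>)"
      using deriv_bound_near_omitted_value[OF assms(1) b'(2)] by metis
    then show "\<exists>L>0. \<forall>h. h holomorphic_on ball 0 1 \<longrightarrow> h ` ball 0 1 \<inter> B = {} \<longrightarrow>
       cmod (deriv h 0) \<le> L * cmod (h 0 - b) powr (1 - \<eta>) * (1 + cmod (h 0)) powr (2 * \<eta>)"
      using b b' by (intro exI[of _ L]) blast
  qed
  then obtain l where l: "\<And>b. b \<in> B \<Longrightarrow> l b > 0"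
    "\<And>b h. b \<in> B \<Longrightarrow> h holomorphic_on ball 0 1 \<Longrightarrow> h ` ball 0 1 \<inter> B = {} \<Longrightarrow>
       cmod (deriv h 0) \<le> l b * cmod (h 0 - b) powr (1 - \<eta>) * (1 + cmod (h 0)) powr (2 * \<eta>)"
    by metis
  have ne: "B \<noteq> {}" using assms by auto
  define N where "N = card B"
  define C where "C = c powr ((real N - 1) * (1 - \<eta>))"
  have C: "C > 0" using c by (simp add: C_def)
  define M where "M = (\<Sum>b\<in>B. l b)"
  have M: "M > 0" using l ne assms by (auto simp: M_def intro!: sum_pos)
  have lM: "l b \<le> M" if "b \<in> B" for b
    unfolding M_def using that l assms by (intro member_le_sum) (auto intro: less_imp_le)
  show thesis
  proof
    show "M / C > 0" using M C by simp
    fix h :: "complex \<Rightarrow> complex"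
    assume h: "h holomorphic_on ball 0 1" "h ` ball 0 1 \<inter> B = {}"
    define w where "w = h 0"
    define y where "y = 1 + cmod w"
    have y: "y > 0" by (auto simp: y_def add_pos_nonneg)
    have wB: "w \<notin> B" using h(2) by (force simp: w_def)
    \<comment> \<open>\<open>b\<close> is the value close to \<open>w\<close>, if there is one, and arbitrary otherwise\<close>
    obtain b where b: "b \<in> B" "\<And>b'. b' \<in> B \<Longrightarrow> b' \<noteq> b \<Longrightarrow> c * y \<le> cmod (w - b')"
    proof (cases "\<exists>b\<in>B. cmod (w - b) < c * y")
      case True
      then obtain b where "b \<in> B" "cmod (w - b) < c * y" by blast
      then show ?thesis using that[of b] c(3)[of b _ w] by (force simp: y_def)
    next
      case False
      then show ?thesis using that ne by (meson ex_in_conv not_less)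
    qed
    have pos: "cmod (w - b') > 0" if "b' \<in> B" for b' using wB that by auto
    have "(c * y) powr ((1 - \<eta>) * (real N - 1)) = (\<Prod>b'\<in>B - {b}. (c * y) powr (1 - \<eta>))"
      using b(1) c y assms by (simp add: N_def powr_powr of_nat_diff card_gt_0_iff Suc_leI ne flip: powr_realpow)
    also have "\<dots> \<le> (\<Prod>b'\<in>B - {b}. cmod (w - b') powr (1 - \<eta>))"
      using b(2) c y assms by (intro prod_mono conjI powr_mono2) auto
    finally have *: "C * y powr ((1 - \<eta>) * (real N - 1)) \<le> (\<Prod>b'\<in>B - {b}. cmod (w - b') powr (1 - \<eta>))"
      using c y by (simp add: powr_mult C_def mult.commute)
    have "cmod (deriv h 0) * y powr (real N - 1 - (real N + 1) * \<eta>)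
       \<le> M * cmod (w - b) powr (1 - \<eta>) * y powr (2 * \<eta>) * y powr (real N - 1 - (real N + 1) * \<eta>)"
    proof (rule mult_right_mono)
      have "cmod (deriv h 0) \<le> l b * (cmod (w - b) powr (1 - \<eta>) * y powr (2 * \<eta>))"
        using l(2)[OF b(1) h] by (simp add: w_def y_def mult.assoc)
      also have "\<dots> \<le> M * (cmod (w - b) powr (1 - \<eta>) * y powr (2 * \<eta>))"
        using lM[OF b(1)] by (intro mult_right_mono) auto
      finally show "cmod (deriv h 0) \<le> M * cmod (w - b) powr (1 - \<eta>) * y powr (2 * \<eta>)"
        by (simp add: mult.assoc)
    qed auto
    also have "\<dots> = M / C * (cmod (w - b) powr (1 - \<eta>) * (C * y powr ((1 - \<eta>) * (real N - 1))))"
    proof -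
      have "2 * \<eta> + (real N - 1 - (real N + 1) * \<eta>) = (1 - \<eta>) * (real N - 1)"
        by (simp add: algebra_simps)
      then have "y powr (2 * \<eta>) * y powr (real N - 1 - (real N + 1) * \<eta>) = y powr ((1 - \<eta>) * (real N - 1))"
        by (metis powr_add)
      then show ?thesis using C by (simp add: mult.assoc)
    qed
    also have "\<dots> \<le> M / C * (cmod (w - b) powr (1 - \<eta>) * (\<Prod>b'\<in>B - {b}. cmod (w - b') powr (1 - \<eta>)))"
      using * M C by (intro mult_left_mono) auto
    also have "cmod (w - b) powr (1 - \<eta>) * (\<Prod>b'\<in>B - {b}. cmod (w - b') powr (1 - \<eta>))
        = (\<Prod>b\<in>B. cmod (w - b) powr (1 - \<eta>))"
      using b(1) assms by (simp add: prod.remove[of B b])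
    finally show "cmod (deriv h 0) * (1 + cmod (h 0)) powr (real (card B) - 1 - (real (card B) + 1) * \<eta>)
         \<le> M / C * (\<Prod>b\<in>B. cmod (h 0 - b) powr (1 - \<eta>))"
      by (simp add: w_def y_def N_def)
  qed
qed

lemma deriv_bound_disc_omitting_finite_set:
  fixes \<eta> :: real and B :: "complex set"
  assumes "0 < \<eta>" "\<eta> < 1" "finite B" "2 \<le> card B"
  obtains L where "0 < L"
    "\<And>h z r. 0 < r \<Longrightarrow> h holomorphic_on ball z r \<Longrightarrow> h ` ball z r \<inter> B = {} \<Longrightarrow>
       r * cmod (deriv h z) * (1 + cmod (h z)) powr (real (card B) - 1 - (real (card B) + 1) * \<eta>)
         \<le> L * (\<Prod>b\<in>B. cmod (h z - b) powr (1 - \<eta>))"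
proof -
  obtain L where L: "0 < L"
    "\<And>h. h holomorphic_on ball 0 1 \<Longrightarrow> h ` ball 0 1 \<inter> B = {} \<Longrightarrow>
       cmod (deriv h 0) * (1 + cmod (h 0)) powr (real (card B) - 1 - (real (card B) + 1) * \<eta>)
         \<le> L * (\<Prod>b\<in>B. cmod (h 0 - b) powr (1 - \<eta>))"
    using deriv_bound_omitting_finite_set[OF assms] by metis
  show thesis
  proof
    fix h :: "complex \<Rightarrow> complex" and z r
    assume r: "0 < r" and h: "h holomorphic_on ball z r" "h ` ball z r \<inter> B = {}"
    define H where "H = (\<lambda>\<zeta>. h (z + of_real r * \<zeta>))"
    have in_ball: "z + of_real r * \<zeta> \<in> ball z r" if "\<zeta> \<in> ball 0 1" for \<zeta>
      using that r by (simp add: dist_norm norm_mult)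
    have "H holomorphic_on ball 0 1"
      unfolding H_def by (rule holomorphic_on_compose_gen[OF _ h(1), unfolded o_def])
        (use in_ball in \<open>auto intro!: holomorphic_intros\<close>)
    moreover have "H ` ball 0 1 \<inter> B = {}"
      using h(2) in_ball unfolding H_def by blast
    ultimately have "cmod (deriv H 0) * (1 + cmod (H 0)) powr (real (card B) - 1 - (real (card B) + 1) * \<eta>)
         \<le> L * (\<Prod>b\<in>B. cmod (H 0 - b) powr (1 - \<eta>))" by (rule L(2))
    moreover have "deriv H 0 = of_real r * deriv h z"
    proof -
      have "(h has_field_derivative deriv h z) (at (z + of_real r * 0))"
        using holomorphic_derivI[OF h(1)] r by simp
      then have "(H has_field_derivative deriv h z * of_real r) (at 0)"
        unfolding H_def by (rule DERIV_chain2) (auto intro!: derivative_eq_intros)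
      then show ?thesis by (simp add: DERIV_imp_deriv mult.commute)
    qed
    ultimately show "r * cmod (deriv h z) * (1 + cmod (h z)) powr (real (card B) - 1 - (real (card B) + 1) * \<eta>)
         \<le> L * (\<Prod>b\<in>B. cmod (h z - b) powr (1 - \<eta>))"
      using r by (simp add: H_def norm_mult)
  qed (rule L(1))
qed

section \<open>Charts\<close>

lemma chart_inj: "is_chart X c \<Longrightarrow> inj_on (snd c) (fst c)"
  by (auto simp: is_chart_def homeomorphic_map_def openin_subset Int_absorb1)

lemma chart_open_preimage:
  assumes "is_chart X c" "open W"
  shows "openin X {p \<in> fst c. snd c p \<in> W}"
proof -
  have "continuous_map (subtopology X (fst c)) (top_of_set (snd c ` fst c)) (snd c)"
    using assms by (auto simp: is_chart_def homeomorphic_imp_continuous_map)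
  then have "continuous_map (subtopology X (fst c)) euclidean (snd c)"
    using continuous_map_in_subtopology by blast
  then have "openin (subtopology X (fst c)) {p \<in> topspace (subtopology X (fst c)). snd c p \<in> W}"
    using assms(2) openin_continuous_map_preimage open_openin by blast
  moreover have "openin X (fst c)" using assms by (simp add: is_chart_def)
  ultimately show ?thesis
    by (simp add: openin_open_subtopology openin_subset Int_absorb1)
qed

lemma chart_open_image:
  assumes "is_chart X c" "openin X V" "V \<subseteq> fst c"
  shows "open (snd c ` V)"
proof -
  have "open_map (subtopology X (fst c)) (top_of_set (snd c ` fst c)) (snd c)"
    using assms by (auto simp: is_chart_def homeomorphic_imp_open_map)
  moreover have "openin (subtopology X (fst c)) V"
    using assms by (auto simp: is_chart_def openin_open_subtopology)
  ultimately have "openin (top_of_set (snd c ` fst c)) (snd c ` V)"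
    by (auto simp: open_map_def)
  then show ?thesis
    using assms(1) by (simp add: is_chart_def openin_open_eq)
qed

lemma chart_inv_continuous:
  assumes "is_chart X c"
  shows "continuous_map (top_of_set (snd c ` fst c)) X (chart_inv c)"
proof -
  have sub: "fst c \<subseteq> topspace X" using assms by (simp add: is_chart_def openin_subset)
  have "chart_inv c ` (snd c ` fst c) \<subseteq> topspace X"
    using chart_inj[OF assms] sub by auto
  moreover have "openin (top_of_set (snd c ` fst c)) {z \<in> snd c ` fst c. chart_inv c z \<in> V}"
    if "openin X V" for V
  proof -
    have "{z \<in> snd c ` fst c. chart_inv c z \<in> V} = snd c ` (V \<inter> fst c)"
      using chart_inj[OF assms] by auto
    moreover have "open (snd c ` (V \<inter> fst c))"
      using that assms by (intro chart_open_image[OF assms]) (auto simp: is_chart_def)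
    ultimately show ?thesis using assms by (auto simp: is_chart_def openin_open_eq)
  qed
  ultimately show ?thesis by (auto simp: continuous_map_def)
qed

lemma chart_inv_chart: "is_chart X c \<Longrightarrow> p \<in> fst c \<Longrightarrow> chart_inv c (snd c p) = p"
  by (simp add: chart_inj)

lemma chart_ball:
  assumes "is_chart X c" "p \<in> fst c" "openin X V" "p \<in> V"
  obtains r where "0 < r" "ball (snd c p) r \<subseteq> snd c ` (fst c \<inter> V)"
proof -
  have "open (snd c ` (fst c \<inter> V))"
    using assms by (intro chart_open_image) (auto simp: is_chart_def)
  moreover have "snd c p \<in> snd c ` (fst c \<inter> V)" using assms by auto
  ultimately show ?thesis using that open_contains_ball by metis
qed

text \<open>
  Maps on open sets of the plane are glued below; this form of continuity refers only to open sets of the plane.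
\<close>

lemma continuous_map_open_iff:
  assumes "open U"
  shows "continuous_map (top_of_set U) X f \<longleftrightarrow>
    f ` U \<subseteq> topspace X \<and> (\<forall>V. openin X V \<longrightarrow> open {z \<in> U. f z \<in> V})"
  using assms by (auto simp: continuous_map_def openin_open_eq)

section \<open>Maximal isometric discs in flat surfaces\<close>

text \<open>
  A flat structure on the part \<open>S\<close> of a Hausdorff space: its coordinate changes are locally orientation
  preserving Euclidean motions.
\<close>

locale flat_surface =
  fixes X :: "'a topology" and S :: "'a set" and \<F> :: "'a chart set"
  assumes Hausdorff: "Hausdorff_space X"
    and charts: "d \<in> \<F> \<Longrightarrow> is_chart X d"
    and cover: "(\<Union>d\<in>\<F>. fst d) = S"
    and transition: "d \<in> \<F> \<Longrightarrow> e \<in> \<F> \<Longrightarrow> p \<in> fst d \<Longrightarrow> p \<in> fst e \<Longrightarrow>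
      \<exists>\<alpha> \<beta> V. cmod \<alpha> = 1 \<and> openin X V \<and> p \<in> V \<and> (\<forall>y\<in>V. snd e y = \<alpha> * snd d y + \<beta>)"
begin

text \<open>
  All charts around \<open>\<Phi> z\<close> are quantified over, so that any of them can be used; \<open>local_isometryI\<close> shows that one chart
  at each point suffices.
\<close>

definition local_isometry :: "complex set \<Rightarrow> (complex \<Rightarrow> 'a) \<Rightarrow> bool" where
  "local_isometry U \<Phi> \<longleftrightarrow> continuous_map (top_of_set U) X \<Phi> \<and> \<Phi> ` U \<subseteq> S \<and>
     (\<forall>z\<in>U. \<forall>d\<in>\<F>. \<Phi> z \<in> fst d \<longrightarrow>
        (\<exists>\<alpha> \<beta>. cmod \<alpha> = 1 \<and> (\<forall>\<^sub>F w in nhds z. snd d (\<Phi> w) = \<alpha> * w + \<beta>)))"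

lemma local_isometry_affine:
  assumes "local_isometry U \<Phi>" "z \<in> U" "d \<in> \<F>" "\<Phi> z \<in> fst d"
  obtains \<alpha> \<beta> where "cmod \<alpha> = 1" "\<forall>\<^sub>F w in nhds z. snd d (\<Phi> w) = \<alpha> * w + \<beta>"
  using assms unfolding local_isometry_def by metis

lemma local_isometry_eventually_in:
  assumes "local_isometry U \<Phi>" "open U" "z \<in> U" "openin X V" "\<Phi> z \<in> V"
  shows "\<forall>\<^sub>F w in nhds z. w \<in> U \<and> \<Phi> w \<in> V"
proof -
  have "open {w \<in> U. \<Phi> w \<in> V}"
    using assms by (auto simp: local_isometry_def continuous_map_open_iff)
  then show ?thesis using assms by (auto simp: eventually_nhds)
qed

lemma local_isometry_transition:
  assumes \<Phi>: "continuous_map (top_of_set U) X \<Phi>" "open U" "z \<in> U"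
    and d: "d \<in> \<F>" "\<Phi> z \<in> fst d" "cmod \<alpha> = 1" "\<forall>\<^sub>F w in nhds z. snd d (\<Phi> w) = \<alpha> * w + \<beta>"
    and e: "e \<in> \<F>" "\<Phi> z \<in> fst e"
  shows "\<exists>\<alpha> \<beta>. cmod \<alpha> = 1 \<and> (\<forall>\<^sub>F w in nhds z. snd e (\<Phi> w) = \<alpha> * w + \<beta>)"
proof -
  obtain \<alpha>' \<beta>' V where V: "cmod \<alpha>' = 1" "openin X V" "\<Phi> z \<in> V"
      "\<And>y. y \<in> V \<Longrightarrow> snd e y = \<alpha>' * snd d y + \<beta>'"
    using transition[OF d(1) e(1) d(2) e(2)] by blast
  have "open {w \<in> U. \<Phi> w \<in> V}"
    using \<Phi> V by (auto simp: continuous_map_open_iff)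
  then have "\<forall>\<^sub>F w in nhds z. w \<in> U \<and> \<Phi> w \<in> V"
    using \<Phi> V by (auto simp: eventually_nhds)
  then have "\<forall>\<^sub>F w in nhds z. snd e (\<Phi> w) = (\<alpha>' * \<alpha>) * w + (\<alpha>' * \<beta> + \<beta>')"
    using d(4) by eventually_elim (simp add: V algebra_simps)
  then show ?thesis
    using V(1) d(3) by (intro exI[of _ "\<alpha>' * \<alpha>"] exI[of _ "\<alpha>' * \<beta> + \<beta>'"]) (simp add: norm_mult)
qed

lemma local_isometryI:
  assumes "continuous_map (top_of_set U) X \<Phi>" "open U"
    and "\<And>z. z \<in> U \<Longrightarrow> \<exists>d\<in>\<F>. \<Phi> z \<in> fst d \<and>
        (\<exists>\<alpha> \<beta>. cmod \<alpha> = 1 \<and> (\<forall>\<^sub>F w in nhds z. snd d (\<Phi> w) = \<alpha> * w + \<beta>))"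
  shows "local_isometry U \<Phi>"
  unfolding local_isometry_def
proof (intro conjI ballI impI)
  show "\<Phi> ` U \<subseteq> S" using assms(3) cover by fast
  fix z e assume z: "z \<in> U" and e: "e \<in> \<F>" "\<Phi> z \<in> fst e"
  obtain d \<alpha> \<beta> where "d \<in> \<F>" "\<Phi> z \<in> fst d" "cmod \<alpha> = 1"
      "\<forall>\<^sub>F w in nhds z. snd d (\<Phi> w) = \<alpha> * w + \<beta>"
    using assms(3)[OF z] by blast
  from local_isometry_transition[OF assms(1,2) z this e]
  show "\<exists>\<alpha> \<beta>. cmod \<alpha> = 1 \<and> (\<forall>\<^sub>F w in nhds z. snd e (\<Phi> w) = \<alpha> * w + \<beta>)" .
qed (rule assms(1))

lemma local_isometry_locally:
  assumes "open U"
    and loc: "\<And>z. z \<in> U \<Longrightarrow> \<exists>V \<Psi>. open V \<and> z \<in> V \<and> V \<subseteq> U \<and> local_isometry V \<Psi> \<and> (\<forall>w\<in>V. \<Phi> w = \<Psi> w)"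
  shows "local_isometry U \<Phi>"
proof (rule local_isometryI[OF _ \<open>open U\<close>])
  show "continuous_map (top_of_set U) X \<Phi>"
    unfolding continuous_map_open_iff[OF \<open>open U\<close>]
  proof (intro conjI allI impI)
    show "\<Phi> ` U \<subseteq> topspace X"
    proof
      fix p assume "p \<in> \<Phi> ` U"
      then obtain z where z: "z \<in> U" "p = \<Phi> z" by auto
      obtain V \<Psi> where "open V" "z \<in> V" "local_isometry V \<Psi>" "\<Phi> z = \<Psi> z"
        using loc[OF z(1)] by blast
      then show "p \<in> topspace X" using z
        by (auto simp: local_isometry_def continuous_map_def)
    qed
    fix W assume W: "openin X W"
    show "open {z \<in> U. \<Phi> z \<in> W}"
      unfolding open_subopen[of "{z \<in> U. \<Phi> z \<in> W}"]
    proof (intro ballI)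
      fix z assume "z \<in> {z \<in> U. \<Phi> z \<in> W}"
      then have z: "z \<in> U" "\<Phi> z \<in> W" by auto
      obtain V \<Psi> where V: "open V" "z \<in> V" "V \<subseteq> U" "local_isometry V \<Psi>" "\<And>w. w \<in> V \<Longrightarrow> \<Phi> w = \<Psi> w"
        using loc[OF z(1)] by blast
      have "open {w \<in> V. \<Psi> w \<in> W}"
        using V W by (auto simp: local_isometry_def continuous_map_open_iff)
      then show "\<exists>T. open T \<and> z \<in> T \<and> T \<subseteq> {z \<in> U. \<Phi> z \<in> W}"
        using V z by (intro exI[of _ "{w \<in> V. \<Psi> w \<in> W}"]) auto
    qed
  qed
  fix z assume z: "z \<in> U"
  obtain V \<Psi> where V: "open V" "z \<in> V" "V \<subseteq> U" "local_isometry V \<Psi>" "\<And>w. w \<in> V \<Longrightarrow> \<Phi> w = \<Psi> w"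
    using loc[OF z] by blast
  have "\<Psi> z \<in> S" using V by (auto simp: local_isometry_def)
  then obtain d where d: "d \<in> \<F>" "\<Psi> z \<in> fst d" using cover by auto
  then obtain \<alpha> \<beta> where ab: "cmod \<alpha> = 1" "\<forall>\<^sub>F w in nhds z. snd d (\<Psi> w) = \<alpha> * w + \<beta>"
    using local_isometry_affine[OF V(4,2)] by metis
  have "\<forall>\<^sub>F w in nhds z. w \<in> V" using V by (simp add: eventually_nhds_in_open)
  then have "\<forall>\<^sub>F w in nhds z. snd d (\<Phi> w) = \<alpha> * w + \<beta>"
    using ab(2) by eventually_elim (simp add: V)
  then show "\<exists>d\<in>\<F>. \<Phi> z \<in> fst d \<and>
        (\<exists>\<alpha> \<beta>. cmod \<alpha> = 1 \<and> (\<forall>\<^sub>F w in nhds z. snd d (\<Phi> w) = \<alpha> * w + \<beta>))"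
    using d ab(1) V by auto
qed

lemma local_isometry_subset:
  assumes "local_isometry U \<Phi>" "open V" "V \<subseteq> U"
  shows "local_isometry V \<Phi>"
proof -
  have "continuous_map (top_of_set V) X \<Phi>"
    using assms(1)[unfolded local_isometry_def, THEN conjunct1] assms(3)
    by (rule continuous_map_from_subtopology_mono)
  moreover have "\<Phi> ` V \<subseteq> S"
    using assms(1,3) by (auto simp: local_isometry_def)
  moreover have "\<exists>\<alpha> \<beta>. cmod \<alpha> = 1 \<and> (\<forall>\<^sub>F w in nhds z. snd d (\<Phi> w) = \<alpha> * w + \<beta>)"
    if "z \<in> V" "d \<in> \<F>" "\<Phi> z \<in> fst d" for z d
    using local_isometry_affine[OF assms(1) subsetD[OF assms(3) that(1)] that(2,3)] by metis
  ultimately show ?thesis by (simp add: local_isometry_def)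
qed

lemma local_isometry_chart_inv:
  assumes d: "d \<in> \<F>" and r: "ball q r \<subseteq> snd d ` fst d" and \<alpha>: "cmod \<alpha> = 1"
  shows "local_isometry (ball z0 r) (\<lambda>z. chart_inv d (q + \<alpha> * (z - z0)))"
proof (rule local_isometryI)
  let ?A = "\<lambda>z. q + \<alpha> * (z - z0)"
  have A: "?A z \<in> snd d ` fst d" if "z \<in> ball z0 r" for z
  proof -
    have "dist q (?A z) = dist z0 z" using \<alpha> by (simp add: dist_norm norm_mult norm_minus_commute)
    then show ?thesis using that r by (metis mem_ball subsetD)
  qed
  have "continuous_map (top_of_set (ball z0 r)) (top_of_set (snd d ` fst d)) ?A"
    unfolding continuous_map_in_subtopology using A
    by (auto intro!: continuous_intros simp: image_subset_iff)
  from continuous_map_compose[OF this chart_inv_continuous[OF charts[OF d]]]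
  show "continuous_map (top_of_set (ball z0 r)) X (\<lambda>z. chart_inv d (?A z))"
    by (simp add: o_def)
  fix z assume z: "z \<in> ball z0 r"
  have ev: "\<forall>\<^sub>F w in nhds z. w \<in> ball z0 r" using z by (intro eventually_nhds_in_open) auto
  have "\<forall>\<^sub>F w in nhds z. snd d (chart_inv d (?A w)) = \<alpha> * w + (q - \<alpha> * z0)"
    using ev
  proof eventually_elim
    case (elim w)
    have "snd d (chart_inv d (?A w)) = ?A w" by (rule f_inv_into_f[OF A[OF elim]])
    then show ?case by (simp add: algebra_simps)
  qed
  moreover have "chart_inv d (?A z) \<in> fst d" using A[OF z] by (rule inv_into_into)
  ultimately show "\<exists>e\<in>\<F>. chart_inv d (?A z) \<in> fst e \<and>
        (\<exists>\<alpha> \<beta>. cmod \<alpha> = 1 \<and> (\<forall>\<^sub>F w in nhds z. snd e (chart_inv d (?A w)) = \<alpha> * w + \<beta>))"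
    using d \<alpha> by blast
qed simp

text \<open>
  An affine function is determined by its values on any open set. So the set of points where the germs agree is
  open and closed; the Hausdorff property enters at limit points.
\<close>

lemma local_isometry_unique:
  assumes \<Phi>: "local_isometry U \<Phi>" and \<Psi>: "local_isometry U \<Psi>" and U: "open U" "connected U"
    and z0: "z0 \<in> U" "\<forall>\<^sub>F w in nhds z0. \<Phi> w = \<Psi> w"
    and z: "z \<in> U"
  shows "\<Phi> z = \<Psi> z"
proof -
  define A where "A = {z \<in> U. \<forall>\<^sub>F w in nhds z. \<Phi> w = \<Psi> w}"
  have openA: "open A"
    unfolding open_subopen[of A]
  proof
    fix z assume "z \<in> A"
    then have "z \<in> U" by (simp add: A_def)
    have "\<forall>\<^sub>F w in nhds z. \<forall>\<^sub>F v in nhds w. \<Phi> v = \<Psi> v"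
      using \<open>z \<in> A\<close> by (simp add: A_def eventually_eventually)
    moreover have "\<forall>\<^sub>F w in nhds z. w \<in> U" using U(1) \<open>z \<in> U\<close> by (rule eventually_nhds_in_open)
    ultimately have "\<forall>\<^sub>F w in nhds z. w \<in> A"
      by eventually_elim (simp add: A_def)
    then show "\<exists>T. open T \<and> z \<in> T \<and> T \<subseteq> A" by (auto simp: eventually_nhds)
  qed
  have openB: "open (U - A)"
    unfolding open_subopen[of "U - A"]
  proof
    fix z assume "z \<in> U - A"
    then have z: "z \<in> U" "z \<notin> A" by auto
    have top: "\<Phi> z \<in> topspace X" "\<Psi> z \<in> topspace X"
      using \<Phi> \<Psi> z by (auto simp: local_isometry_def continuous_map_def)
    have "\<forall>\<^sub>F w in nhds z. w \<in> U - A"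
    proof (cases "\<Phi> z = \<Psi> z")
      case False
      then obtain V W where VW: "openin X V" "openin X W" "\<Phi> z \<in> V" "\<Psi> z \<in> W" "disjnt V W"
        using Hausdorff top unfolding Hausdorff_space_def by metis
      have "\<forall>\<^sub>F w in nhds z. w \<in> U \<and> \<Phi> w \<in> V" "\<forall>\<^sub>F w in nhds z. w \<in> U \<and> \<Psi> w \<in> W"
        using local_isometry_eventually_in \<Phi> \<Psi> U z VW by blast+
      then show ?thesis
      proof eventually_elim
        case (elim w)
        then have "\<Phi> w \<noteq> \<Psi> w" using VW(5) by (auto simp: disjnt_iff)
        then show ?case using elim by (auto simp: A_def dest: eventually_nhds_x_imp_x)
      qed
    next
      case True
      have "\<Phi> z \<in> S" using \<Phi> z by (auto simp: local_isometry_def)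
      then obtain d where d: "d \<in> \<F>" "\<Phi> z \<in> fst d" using cover by auto
      have od: "openin X (fst d)" using charts[OF d(1)] by (simp add: is_chart_def)
      obtain \<alpha> \<beta> where ab: "\<forall>\<^sub>F w in nhds z. snd d (\<Phi> w) = \<alpha> * w + \<beta>"
        using local_isometry_affine[OF \<Phi> z(1) d] by metis
      obtain \<alpha>' \<beta>' where ab': "\<forall>\<^sub>F w in nhds z. snd d (\<Psi> w) = \<alpha>' * w + \<beta>'"
        using local_isometry_affine[OF \<Psi> z(1) d(1)] d(2) True by metis
      have "\<forall>\<^sub>F w in nhds z. w \<in> U \<and> \<Phi> w \<in> fst d" "\<forall>\<^sub>F w in nhds z. w \<in> U \<and> \<Psi> w \<in> fst d"
        using local_isometry_eventually_in \<Phi> \<Psi> U z d od True by metis+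
      then have "\<forall>\<^sub>F w in nhds z. w \<in> U \<and> \<Phi> w \<in> fst d \<and> \<Psi> w \<in> fst d \<and>
          snd d (\<Phi> w) = \<alpha> * w + \<beta> \<and> snd d (\<Psi> w) = \<alpha>' * w + \<beta>'"
        using ab ab' by eventually_elim auto
      then obtain T where T: "open T" "z \<in> T" "\<And>w. w \<in> T \<Longrightarrow> w \<in> U \<and> \<Phi> w \<in> fst d \<and> \<Psi> w \<in> fst d \<and>
          snd d (\<Phi> w) = \<alpha> * w + \<beta> \<and> snd d (\<Psi> w) = \<alpha>' * w + \<beta>'"
        by (auto simp: eventually_nhds)
      have "w \<notin> A" if w: "w \<in> T" for w
      proof
        assume "w \<in> A"
        then have "\<forall>\<^sub>F v in nhds w. \<Phi> v = \<Psi> v" by (simp add: A_def)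
        moreover have "\<forall>\<^sub>F v in nhds w. v \<in> T" using T(1) w by (rule eventually_nhds_in_open)
        ultimately have "\<forall>\<^sub>F v in nhds w. \<alpha> * v + \<beta> = \<alpha>' * v + \<beta>'"
          by eventually_elim (metis T(3))
        then obtain e where e: "e > 0" "\<And>v. dist v w < e \<Longrightarrow> \<alpha> * v + \<beta> = \<alpha>' * v + \<beta>'"
          by (auto simp: eventually_nhds_metric)
        have "\<alpha> * (w + of_real (e/2)) + \<beta> = \<alpha>' * (w + of_real (e/2)) + \<beta>'" 
          using e(1) by (intro e(2)) (simp add: dist_norm)
        moreover have "\<alpha> * w + \<beta> = \<alpha>' * w + \<beta>'" using e by simp
        ultimately have "(\<alpha> - \<alpha>') * of_real (e/2) = 0" by algebra
        then have eq: "\<alpha> = \<alpha>'" using e(1) by simp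
        have "\<alpha> * w + \<beta> = \<alpha>' * w + \<beta>'" using e by simp
        with eq have "\<beta> = \<beta>'" by simp
        have "\<Phi> v = \<Psi> v" if "v \<in> T" for v
          using T(3)[OF that] eq \<open>\<beta> = \<beta>'\<close> chart_inj[OF charts[OF d(1)]] by (metis inj_onD)
        then have "\<forall>\<^sub>F v in nhds z. \<Phi> v = \<Psi> v" using T(1,2) by (auto simp: eventually_nhds)
        then show False using z by (simp add: A_def)
      qed
      then show ?thesis using T by (auto simp: eventually_nhds)
    qed
    then show "\<exists>T. open T \<and> z \<in> T \<and> T \<subseteq> U - A" by (auto simp: eventually_nhds)
  qed
  have "U \<subseteq> A"
    using connectedD[OF U(2) openA openB] z0 by (auto simp: A_def)
  then show ?thesis using z by (auto simp: A_def dest: eventually_nhds_x_imp_x)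
qed

text \<open>
  A chart at \<open>x\<close> contains discs of a fixed radius around the points \<open>\<Phi> (z j)\<close> with large \<open>j\<close>. The inverse chart,
  started at such a point, is an isometry on a disc that contains \<open>a\<close> as soon as \<open>z j\<close> is close to \<open>a\<close>.
\<close>

lemma local_isometry_extend_at:
  assumes \<Phi>: "local_isometry (ball 0 R) \<Phi>"
    and z: "range z \<subseteq> ball 0 R" "z \<longlonglongrightarrow> a"
    and x: "limitin X (\<Phi> \<circ> z) x sequentially" "x \<in> S"
  shows "\<exists>\<epsilon>>0. \<exists>\<Psi>. local_isometry (ball a \<epsilon>) \<Psi> \<and> (\<forall>w \<in> ball 0 R \<inter> ball a \<epsilon>. \<Psi> w = \<Phi> w)"
proof -
  obtain d where d: "d \<in> \<F>" "x \<in> fst d" using x cover by auto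
  note ch = charts[OF d(1)]
  have od: "openin X (fst d)" using ch by (simp add: is_chart_def)
  obtain s where s: "0 < s" "ball (snd d x) s \<subseteq> snd d ` (fst d \<inter> fst d)"
    using chart_ball[OF ch d(2) od d(2)] by blast
  define r where "r = s / 2"
  have r: "r > 0" using s by (simp add: r_def)
  define V where "V = {y \<in> fst d. snd d y \<in> ball (snd d x) r}"
  have "openin X V" unfolding V_def by (rule chart_open_preimage[OF ch]) simp
  moreover have "x \<in> V" using d r by (simp add: V_def)
  ultimately have "\<forall>\<^sub>F j in sequentially. (\<Phi> \<circ> z) j \<in> V"
    using x(1) by (simp add: limitin_def)
  moreover have "\<forall>\<^sub>F j in sequentially. dist (z j) a < r"
    using z(2) r by (rule tendstoD)
  ultimately have "\<forall>\<^sub>F j in sequentially. \<Phi> (z j) \<in> V \<and> dist (z j) a < r"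
    by eventually_elim simp
  then obtain j where j: "\<Phi> (z j) \<in> V" "dist (z j) a < r"
    using eventually_happens'[OF sequentially_bot] by blast
  define b where "b = z j"
  have b: "b \<in> ball 0 R" "\<Phi> b \<in> fst d" "dist (snd d x) (snd d (\<Phi> b)) < r" "dist b a < r"
    using subsetD[OF z(1) rangeI[of z j]] j by (auto simp: b_def V_def)
  obtain \<alpha> \<beta> where ab: "cmod \<alpha> = 1" "\<forall>\<^sub>F w in nhds b. snd d (\<Phi> w) = \<alpha> * w + \<beta>"
    using local_isometry_affine[OF \<Phi> b(1) d(1) b(2)] by metis
  define q where "q = snd d (\<Phi> b)"
  have q: "q = \<alpha> * b + \<beta>" unfolding q_def using ab(2) by (rule eventually_nhds_x_imp_x)
  define \<Psi> where "\<Psi> = (\<lambda>w. chart_inv d (q + \<alpha> * (w - b)))"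
  have "ball q r \<subseteq> snd d ` fst d"
  proof
    fix y assume "y \<in> ball q r"
    then have "dist (snd d x) y < s"
      using b(3) dist_triangle[of "snd d x" y q] by (simp add: q_def r_def)
    then show "y \<in> snd d ` fst d" using s(2) by auto
  qed
  then have \<Psi>: "local_isometry (ball b r) \<Psi>"
    unfolding \<Psi>_def by (rule local_isometry_chart_inv[OF d(1) _ ab(1)])
  have "\<forall>\<^sub>F w in nhds b. w \<in> ball 0 R \<and> \<Phi> w \<in> fst d"
    by (rule local_isometry_eventually_in[OF \<Phi> _ b(1) od b(2)]) simp
  then have ev: "\<forall>\<^sub>F w in nhds b. \<Phi> w = \<Psi> w"
    using ab(2)
  proof eventually_elim
    case (elim w)
    then have "\<Phi> w = chart_inv d (\<alpha> * w + \<beta>)"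
      using chart_inv_chart[OF ch] by metis
    then show ?case by (simp add: \<Psi>_def q algebra_simps)
  qed
  have agree: "\<Psi> w = \<Phi> w" if "w \<in> ball 0 R \<inter> ball b r" for w
  proof (rule local_isometry_unique[symmetric])
    show "local_isometry (ball 0 R \<inter> ball b r) \<Phi>" "local_isometry (ball 0 R \<inter> ball b r) \<Psi>"
      using \<Phi> \<Psi> by (auto intro: local_isometry_subset)
    show "connected (ball 0 R \<inter> ball b r)" by (intro convex_connected convex_Int convex_ball)
    show "b \<in> ball 0 R \<inter> ball b r" using b r by simp
  qed (use ev that in auto)
  define \<epsilon> where "\<epsilon> = r - dist b a"
  have sub: "ball a \<epsilon> \<subseteq> ball b r"
  proof
    fix y assume "y \<in> ball a \<epsilon>"
    then show "y \<in> ball b r" using dist_triangle[of b y a] by (simp add: \<epsilon>_def)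
  qed
  show ?thesis
    using b agree sub local_isometry_subset[OF \<Psi> open_ball sub]
    by (intro exI[of _ \<epsilon>] conjI exI[of _ \<Psi>]) (auto simp: \<epsilon>_def)
qed

text \<open>
  By compactness of the circle all local extensions live on discs of one radius \<open>\<delta>\<close>. They agree where they meet, so
  that they define a map on the disc of radius \<open>R + \<delta>\<close>: a point outside the original disc uses the extension at
  its radial projection to the circle.
\<close>

lemma local_isometry_extend_disc:
  assumes R: "R > 0" and \<Phi>: "local_isometry (ball 0 R) \<Phi>"
    and ext: "\<And>a. cmod a = R \<Longrightarrow>
      \<exists>\<epsilon>>0. \<exists>\<Psi>. local_isometry (ball a \<epsilon>) \<Psi> \<and> (\<forall>w \<in> ball 0 R \<inter> ball a \<epsilon>. \<Psi> w = \<Phi> w)"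
  shows "\<exists>R'>R. \<exists>\<Phi>'. local_isometry (ball 0 R') \<Phi>' \<and> (\<forall>w\<in>ball 0 R. \<Phi>' w = \<Phi> w)"
proof -
  obtain \<epsilon> where \<epsilon>: "\<And>a. cmod a = R \<Longrightarrow> \<epsilon> a > 0"
    "\<And>a. cmod a = R \<Longrightarrow> \<exists>\<Psi>. local_isometry (ball a (\<epsilon> a)) \<Psi> \<and> (\<forall>w \<in> ball 0 R \<inter> ball a (\<epsilon> a). \<Psi> w = \<Phi> w)"
    using ext by metis
  obtain \<delta> where \<delta>: "\<delta> > 0" "\<And>a. a \<in> sphere 0 R \<Longrightarrow> \<exists>G \<in> (\<lambda>a. ball a (\<epsilon> a)) ` sphere 0 R. ball a \<delta> \<subseteq> G"
  proof -
    have "sphere 0 R \<subseteq> \<Union> ((\<lambda>a. ball a (\<epsilon> a)) ` sphere 0 R)"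
      using \<epsilon>(1) by (fastforce simp: dist_norm)
    from Heine_Borel_lemma[OF compact_sphere this] show ?thesis using that by auto
  qed
  have "\<exists>\<Psi>. local_isometry (ball a \<delta>) \<Psi> \<and> (\<forall>w \<in> ball 0 R \<inter> ball a \<delta>. \<Psi> w = \<Phi> w)" if a: "cmod a = R" for a
  proof -
    obtain a' where a': "cmod a' = R" "ball a \<delta> \<subseteq> ball a' (\<epsilon> a')"
      using \<delta>(2)[of a] a by (auto simp: dist_norm)
    obtain \<Psi> where "local_isometry (ball a' (\<epsilon> a')) \<Psi>" "\<forall>w \<in> ball 0 R \<inter> ball a' (\<epsilon> a'). \<Psi> w = \<Phi> w"
      using \<epsilon>(2)[OF a'(1)] by blast
    then show ?thesis using a'(2) local_isometry_subset by (meson IntD1 IntD2 IntI open_ball subsetD)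
  qed
  then obtain \<Psi> where \<Psi>: "\<And>a. cmod a = R \<Longrightarrow> local_isometry (ball a \<delta>) (\<Psi> a)"
    "\<And>a w. cmod a = R \<Longrightarrow> w \<in> ball 0 R \<Longrightarrow> w \<in> ball a \<delta> \<Longrightarrow> \<Psi> a w = \<Phi> w"
    by (metis IntI)
  \<comment> \<open>Two of the discs that meet also meet inside the disc of radius \<open>R\<close>, where both maps are \<open>\<Phi>\<close>.\<close>
  have agree: "\<Psi> a w = \<Psi> b w"
    if ab: "cmod a = R" "cmod b = R" and w: "w \<in> ball a \<delta>" "w \<in> ball b \<delta>" for a b w
  proof (cases "a = b")
    case False
    define c where "c = (a + b) / 2"
    have "dist a b < 2 * \<delta>" using w dist_triangle[of a b w] by (simp add: dist_commute)
    moreover have "dist a c = dist a b / 2" "dist b c = dist a b / 2"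
      using dist_midpoint[of a b] by (simp_all add: c_def midpoint_def scaleR_conv_of_real dist_commute field_simps)
    ultimately have c: "c \<in> ball a \<delta>" "c \<in> ball b \<delta>" by auto
    have "(cmod (a + b))\<^sup>2 + (cmod (a - b))\<^sup>2 = 2 * (cmod a)\<^sup>2 + 2 * (cmod b)\<^sup>2"
      unfolding cmod_power2 by (simp add: power2_eq_square algebra_simps)
    moreover have "(cmod (a - b))\<^sup>2 > 0" using False by simp
    moreover have "(2 * R)\<^sup>2 = 4 * R\<^sup>2" by (simp add: power_mult_distrib)
    ultimately have "(cmod (a + b))\<^sup>2 < (2 * R)\<^sup>2" unfolding ab by linarith
    then have "cmod (a + b) < 2 * R" by (rule power2_less_imp_less) (use R in simp)
    then have c0: "c \<in> ball 0 R" by (simp add: c_def norm_divide)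
    have "\<forall>\<^sub>F v in nhds c. v \<in> ball 0 R \<inter> (ball a \<delta> \<inter> ball b \<delta>)"
      using c c0 by (intro eventually_nhds_in_open) auto
    then have ev: "\<forall>\<^sub>F v in nhds c. \<Psi> a v = \<Psi> b v"
      by eventually_elim (use \<Psi>(2) ab in simp)
    show ?thesis
    proof (rule local_isometry_unique)
      show "local_isometry (ball a \<delta> \<inter> ball b \<delta>) (\<Psi> a)" "local_isometry (ball a \<delta> \<inter> ball b \<delta>) (\<Psi> b)"
        using \<Psi>(1) ab by (auto intro: local_isometry_subset)
      show "connected (ball a \<delta> \<inter> ball b \<delta>)" by (intro convex_connected convex_Int convex_ball)
      show "c \<in> ball a \<delta> \<inter> ball b \<delta>" using c by simp
    qed (use ev w in auto)
  qed simp
  define \<pi> :: "complex \<Rightarrow> complex" where "\<pi> = (\<lambda>z. of_real (R / cmod z) * z)"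
  define \<Phi>' where "\<Phi>' = (\<lambda>z. if cmod z < R then \<Phi> z else \<Psi> (\<pi> z) z)"
  have \<pi>: "cmod (\<pi> z) = R" "z \<in> ball (\<pi> z) \<delta>" if "cmod z < R + \<delta>" "\<not> cmod z < R" for z
  proof -
    have pos: "cmod z > 0" using that R by linarith
    then show "cmod (\<pi> z) = R" using R by (simp add: \<pi>_def norm_mult norm_divide)
    have "\<pi> z - z = of_real (R / cmod z - 1) * z" by (simp add: \<pi>_def algebra_simps)
    then have "cmod (\<pi> z - z) = \<bar>R / cmod z - 1\<bar> * cmod z"
      by (simp only: norm_mult norm_of_real)
    also have "\<dots> = \<bar>(R / cmod z - 1) * cmod z\<bar>" using pos by (simp add: abs_mult)
    also have "(R / cmod z - 1) * cmod z = R - cmod z" using pos by (simp add: field_simps)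
    finally have "cmod (\<pi> z - z) < \<delta>" using that by simp
    then show "z \<in> ball (\<pi> z) \<delta>" by (simp add: dist_norm)
  qed
  have "local_isometry (ball 0 (R + \<delta>)) \<Phi>'"
  proof (rule local_isometry_locally)
    fix z :: complex assume "z \<in> ball 0 (R + \<delta>)"
    then have z: "cmod z < R + \<delta>" by simp
    show "\<exists>V \<Psi>. open V \<and> z \<in> V \<and> V \<subseteq> ball 0 (R + \<delta>) \<and> local_isometry V \<Psi> \<and> (\<forall>w\<in>V. \<Phi>' w = \<Psi> w)"
    proof (cases "cmod z < R")
      case True
      then show ?thesis using \<Phi> \<delta>(1)
        by (intro exI[of _ "ball 0 R"] exI[of _ \<Phi>]) (auto simp: \<Phi>'_def)
    next
      case False
      note p = \<pi>[OF z False]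
      have "\<Phi>' w = \<Psi> (\<pi> z) w" if "w \<in> ball (\<pi> z) \<delta> \<inter> ball 0 (R + \<delta>)" for w
      proof (cases "cmod w < R")
        case True
        then show ?thesis using \<Psi>(2)[OF p(1), of w] that by (simp add: \<Phi>'_def)
      next
        case w: False
        have "cmod w < R + \<delta>" using that by simp
        then show ?thesis using agree[OF p(1) \<pi>(1)[OF _ w] _ \<pi>(2)[OF _ w]] that w by (simp add: \<Phi>'_def)
      qed
      moreover have "local_isometry (ball (\<pi> z) \<delta> \<inter> ball 0 (R + \<delta>)) (\<Psi> (\<pi> z))"
        by (rule local_isometry_subset[OF \<Psi>(1)[OF p(1)]]) auto
      ultimately show ?thesis
        using p(2) z by (intro exI[of _ "ball (\<pi> z) \<delta> \<inter> ball 0 (R + \<delta>)"] exI[of _ "\<Psi> (\<pi> z)"]) auto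
    qed
  qed simp
  then show ?thesis using \<delta>(1) by (intro exI[of _ "R + \<delta>"] conjI exI[of _ \<Phi>']) (auto simp: \<Phi>'_def)
qed

text \<open>
  The supremum of the radii of discs with a given germ at \<open>0\<close> is attained, as these discs agree with each other
  where they overlap. If it is finite, the preceding lemma shows that some boundary point admits no extension.
\<close>

theorem maximal_disc:
  assumes p: "p \<in> S"
  shows "(\<exists>\<Phi>. local_isometry UNIV \<Phi>) \<or>
    (\<exists>R>0. \<exists>\<Phi> a. local_isometry (ball 0 R) \<Phi> \<and> cmod a = R \<and>
       (\<forall>z x. range z \<subseteq> ball 0 R \<longrightarrow> z \<longlonglongrightarrow> a \<longrightarrow> limitin X (\<Phi> \<circ> z) x sequentially \<longrightarrow> x \<notin> S))"
proof -
  obtain d where d: "d \<in> \<F>" "p \<in> fst d" using p cover by auto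
  \<comment> \<open>the prescribed germ at \<open>0\<close>\<close>
  define G where "G = (\<lambda>\<Phi>. \<forall>\<^sub>F w in nhds 0. \<Phi> w = chart_inv d (snd d p + 1 * (w - 0)))"
  define P where "P = {r. r > 0 \<and> (\<exists>\<Phi>. local_isometry (ball 0 r) \<Phi> \<and> G \<Phi>)}"
  obtain F where F: "\<And>r. r \<in> P \<Longrightarrow> local_isometry (ball 0 r) (F r)" "\<And>r. r \<in> P \<Longrightarrow> G (F r)"
  proof -
    have "\<forall>r\<in>P. \<exists>\<Phi>. local_isometry (ball 0 r) \<Phi> \<and> G \<Phi>" unfolding P_def by blast
    from bchoice[OF this] show ?thesis using that by blast
  qed
  have "openin X (fst d)" using charts[OF d(1)] by (simp add: is_chart_def)
  then obtain r0 where r0: "r0 > 0" "ball (snd d p) r0 \<subseteq> snd d ` fst d"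
    using chart_ball[OF charts[OF d(1)] d(2)] d(2) by (metis inf.idem)
  have "r0 \<in> P"
    using local_isometry_chart_inv[OF d(1) r0(2), of 1 0] r0(1) unfolding P_def G_def by auto
  have agree: "F r w = F s w" if rs: "r \<in> P" "s \<in> P" and w: "cmod w < r" "cmod w < s" for r s w
  proof (rule local_isometry_unique)
    show "local_isometry (ball 0 (min r s)) (F r)" "local_isometry (ball 0 (min r s)) (F s)"
      using F(1)[OF rs(1)] F(1)[OF rs(2)] by (auto intro: local_isometry_subset)
    show "\<forall>\<^sub>F w in nhds 0. F r w = F s w"
      using F(2)[OF rs(1)] F(2)[OF rs(2)] unfolding G_def by eventually_elim simp
    show "0 \<in> ball 0 (min r s)" using rs by (auto simp: P_def)
  qed (use w in auto)
  define \<Phi> where "\<Phi> = (\<lambda>z. F (SOME r. r \<in> P \<and> cmod z < r) z)"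
  have \<Phi>: "\<Phi> z = F r z" if "r \<in> P" "cmod z < r" for z r
  proof -
    have "(SOME r. r \<in> P \<and> cmod z < r) \<in> P \<and> cmod z < (SOME r. r \<in> P \<and> cmod z < r)"
      using that by (intro someI[of "\<lambda>r. r \<in> P \<and> cmod z < r"]) simp
    then show ?thesis unfolding \<Phi>_def using agree that by blast
  qed
  have \<Phi>_iso: "local_isometry (\<Union>r\<in>P. ball 0 r) \<Phi>"
  proof (rule local_isometry_locally)
    fix z :: complex assume "z \<in> (\<Union>r\<in>P. ball 0 r)"
    then obtain r where "r \<in> P" "z \<in> ball 0 r" by auto
    then show "\<exists>V \<Psi>. open V \<and> z \<in> V \<and> V \<subseteq> (\<Union>r\<in>P. ball 0 r) \<and> local_isometry V \<Psi> \<and> (\<forall>w\<in>V. \<Phi> w = \<Psi> w)"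
      using F(1) \<Phi> by (intro exI[of _ "ball 0 r"] exI[of _ "F r"]) auto
  qed auto
  have \<Phi>_G: "G \<Phi>"
  proof -
    have "\<forall>\<^sub>F w in nhds 0. w \<in> ball 0 r0" using r0(1) by (intro eventually_nhds_in_open) auto
    then show ?thesis
      using F(2)[OF \<open>r0 \<in> P\<close>] unfolding G_def by eventually_elim (simp add: \<Phi>[OF \<open>r0 \<in> P\<close>])
  qed
  show ?thesis
  proof (cases "bdd_above P")
    case False
    have "(\<Union>r\<in>P. ball 0 r) = (UNIV :: complex set)"
    proof (intro equalityI subsetI)
      fix z :: complex
      obtain r where "r \<in> P" "cmod z < r" using False unfolding bdd_above_def by (meson not_le)
      then show "z \<in> (\<Union>r\<in>P. ball 0 r)" by auto
    qed auto
    then show ?thesis using \<Phi>_iso by auto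
  next
    case True
    define R where "R = Sup P"
    have le: "r \<le> R" if "r \<in> P" for r unfolding R_def using that True by (rule cSup_upper)
    have R: "R > 0" using le[OF \<open>r0 \<in> P\<close>] r0 by simp
    have "(\<Union>r\<in>P. ball 0 r) = (ball 0 R :: complex set)"
    proof (intro equalityI subsetI)
      fix z :: complex assume "z \<in> ball 0 R"
      then obtain r where "r \<in> P" "cmod z < r"
        using less_cSup_iff[of P "cmod z"] True \<open>r0 \<in> P\<close> unfolding R_def by auto
      then show "z \<in> (\<Union>r\<in>P. ball 0 r)" by auto
    qed (use le in force)
    then have iso: "local_isometry (ball 0 R) \<Phi>" using \<Phi>_iso by simp
    have "\<exists>a. cmod a = R \<and> (\<forall>z x. range z \<subseteq> ball 0 R \<longrightarrow> z \<longlonglongrightarrow> a \<longrightarrow>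
        limitin X (\<Phi> \<circ> z) x sequentially \<longrightarrow> x \<notin> S)"
    proof (rule ccontr)
      assume contra: "\<not> ?thesis"
      have "\<exists>R'>R. \<exists>\<Phi>'. local_isometry (ball 0 R') \<Phi>' \<and> (\<forall>w\<in>ball 0 R. \<Phi>' w = \<Phi> w)"
      proof (rule local_isometry_extend_disc[OF R iso])
        fix a :: complex assume "cmod a = R"
        then obtain z x where "range z \<subseteq> ball 0 R" "z \<longlonglongrightarrow> a" "limitin X (\<Phi> \<circ> z) x sequentially" "x \<in> S"
          using contra by blast
        then show "\<exists>\<epsilon>>0. \<exists>\<Psi>. local_isometry (ball a \<epsilon>) \<Psi> \<and> (\<forall>w \<in> ball 0 R \<inter> ball a \<epsilon>. \<Psi> w = \<Phi> w)"
          by (rule local_isometry_extend_at[OF iso])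
      qed
      then obtain R' \<Phi>' where R': "R' > R" "local_isometry (ball 0 R') \<Phi>'" "\<And>w. w \<in> ball 0 R \<Longrightarrow> \<Phi>' w = \<Phi> w"
        by blast
      have "\<forall>\<^sub>F w in nhds 0. w \<in> ball 0 R" using R by (intro eventually_nhds_in_open) auto
      then have "G \<Phi>'" using \<Phi>_G unfolding G_def by eventually_elim (simp add: R'(3))
      then have "R' \<in> P" using R R' unfolding P_def by auto
      then show False using le R'(1) by fastforce
    qed
    then show ?thesis using R iso by blast
  qed
qed

end

section \<open>Length and distance of a conformal metric\<close>

text \<open>
  A curve that ends in the open coordinate disc and starts outside it has a last moment on the boundary circle;
  the closed disc is closed in \<open>X\<close> because it is compact and \<open>X\<close> is Hausdorff.
\<close>

lemma last_exit_from_chart_disc: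
  fixes \<gamma> :: "real \<Rightarrow> 'a"
  assumes X: "Hausdorff_space X" and c: "is_chart X c" and \<rho>: "cball z0 \<rho> \<subseteq> snd c ` fst c"
    and \<gamma>: "continuous_map (top_of_set {a..b}) X \<gamma>" and ab: "a \<le> b"
    and start: "\<gamma> a \<in> fst c \<Longrightarrow> \<rho> \<le> cmod (snd c (\<gamma> a) - z0)"
    and finish: "\<gamma> b \<in> fst c" "cmod (snd c (\<gamma> b) - z0) < \<rho>"
  obtains t where "a \<le> t" "t \<le> b" "cmod (snd c (\<gamma> t) - z0) = \<rho>"
    "\<And>s. t \<le> s \<Longrightarrow> s \<le> b \<Longrightarrow> \<gamma> s \<in> fst c \<and> cmod (snd c (\<gamma> s) - z0) \<le> \<rho>"
proof -
  define N where "N = {p \<in> fst c. snd c p \<in> ball z0 \<rho>}"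
  define K where "K = {p \<in> fst c. snd c p \<in> cball z0 \<rho>}"
  have "openin X N" unfolding N_def by (rule chart_open_preimage[OF c]) simp
  then have "closedin X (topspace X - N)" by blast
  moreover have "closedin X K"
  proof -
    have "compactin (top_of_set (snd c ` fst c)) (cball z0 \<rho>)"
      using \<rho> by (simp add: compactin_subtopology)
    then have "compactin X (chart_inv c ` cball z0 \<rho>)"
      using chart_inv_continuous[OF c] by (rule image_compactin)
    moreover have "chart_inv c ` cball z0 \<rho> = K"
    proof (intro equalityI subsetI)
      fix p assume "p \<in> chart_inv c ` cball z0 \<rho>"
      then obtain z where "z \<in> cball z0 \<rho>" "p = chart_inv c z" by blast
      then show "p \<in> K" using \<rho> inv_into_into[of z "snd c" "fst c"] f_inv_into_f[of z "snd c" "fst c"]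
        by (auto simp: K_def)
    next
      fix p assume "p \<in> K"
      then show "p \<in> chart_inv c ` cball z0 \<rho>"
        unfolding K_def using chart_inv_chart[OF c] by force
    qed
    ultimately show ?thesis using X compactin_imp_closedin by fastforce
  qed
  moreover have closed_pre: "closed {s \<in> {a..b}. \<gamma> s \<in> C}" if "closedin X C" for C
  proof -
    have "closedin (top_of_set {a..b}) {s \<in> topspace (top_of_set {a..b}). \<gamma> s \<in> C}"
      using \<gamma> that by (rule closedin_continuous_map_preimage)
    then show ?thesis by (simp add: closedin_closed_eq)
  qed
  ultimately have cl: "closed {s \<in> {a..b}. \<gamma> s \<in> topspace X - N}" "closed {s \<in> {a..b}. \<gamma> s \<in> K}"
    by blast+
  have top: "\<gamma> s \<in> topspace X" if "s \<in> {a..b}" for s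
    using \<gamma> that by (auto simp: continuous_map_def)
  define A where "A = {s \<in> {a..b}. \<gamma> s \<in> topspace X - N}"
  have "a \<in> A" using start top[of a] ab by (auto simp: A_def N_def dist_norm norm_minus_commute)
  have bdd: "bdd_above A" by (auto simp: A_def)
  define t where "t = Sup A"
  have "t \<in> A" unfolding t_def using cl(1) \<open>a \<in> A\<close> bdd by (intro closed_contains_Sup) (auto simp: A_def)
  have after: "\<gamma> s \<in> N" if "t < s" "s \<le> b" for s
  proof (rule ccontr)
    assume "\<gamma> s \<notin> N"
    then have "s \<in> A" using that top[of s] \<open>t \<in> A\<close> by (auto simp: A_def)
    then show False using cSup_upper[OF _ bdd] that by (fastforce simp: t_def)
  qed
  have "t < b"
  proof (rule ccontr)
    assume "\<not> t < b"
    then have "\<gamma> b \<notin> N" using \<open>t \<in> A\<close> by (auto simp: A_def dest: le_less_trans)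
    then show False using finish by (auto simp: N_def dist_norm norm_minus_commute)
  qed
  have "t \<in> closure {t<..b}" using \<open>t < b\<close> by simp
  moreover have "{t<..b} \<subseteq> {s \<in> {a..b}. \<gamma> s \<in> K}"
    using after \<open>t \<in> A\<close> by (fastforce simp: A_def N_def K_def)
  ultimately have "\<gamma> t \<in> K" using closure_minimal[OF _ cl(2)] by blast
  have "\<gamma> t \<notin> N" using \<open>t \<in> A\<close> by (simp add: A_def)
  show thesis
  proof
    show "a \<le> t" "t \<le> b" using \<open>t \<in> A\<close> by (auto simp: A_def)
    show "cmod (snd c (\<gamma> t) - z0) = \<rho>"
      using \<open>\<gamma> t \<in> K\<close> \<open>\<gamma> t \<notin> N\<close> by (auto simp: K_def N_def dist_norm norm_minus_commute)
    fix s assume s: "t \<le> s" "s \<le> b"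
    then have "\<gamma> s \<in> K" using after[of s] \<open>\<gamma> t \<in> K\<close> by (cases "s = t") (auto simp: K_def N_def)
    then show "\<gamma> s \<in> fst c \<and> cmod (snd c (\<gamma> s) - z0) \<le> \<rho>"
      by (simp add: K_def dist_norm norm_minus_commute)
  qed
qed

text \<open>
  The derivative need not be bounded near the exceptional points. If the integral is infinite, the claim is trivial;
  otherwise the derivative is absolutely integrable, and its Lebesgue integral is the gauge integral given by the
  fundamental theorem of calculus.
\<close>

lemma norm_diff_le_nn_integral_derivative:
  fixes f :: "real \<Rightarrow> complex"
  assumes ab: "a \<le> b" and S: "finite S" and f: "continuous_on {a..b} f"
    and D: "\<And>x. x \<in> {a..b} - S \<Longrightarrow> (f has_vector_derivative D x) (at x)" "continuous_on ({a..b} - S) D"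
  shows "ennreal (cmod (f b - f a)) \<le> (\<integral>\<^sup>+x. ennreal (cmod (D x)) * indicator ({a..b} - S) x \<partial>lborel)"
proof -
  define g where "g = (\<lambda>x. indicator ({a..b} - S) x *\<^sub>R D x)"
  have meas: "g \<in> borel_measurable borel"
    unfolding g_def using S D(2)
    by (intro borel_measurable_continuous_on_indicator sets.Diff borel_closed[OF closed_atLeastAtMost]
        borel_closed[OF finite_imp_closed]) auto
  have nn: "(\<integral>\<^sup>+x. ennreal (cmod (g x)) \<partial>lborel) = (\<integral>\<^sup>+x. ennreal (cmod (D x)) * indicator ({a..b} - S) x \<partial>lborel)"
    by (intro nn_integral_cong) (auto simp: g_def indicator_def)
  show ?thesis
  proof (cases "(\<integral>\<^sup>+x. ennreal (cmod (g x)) \<partial>lborel) = \<infinity>")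
    case False
    then have int: "integrable lborel g"
      using meas by (intro integrableI_bounded) (auto simp: top.not_eq_extremum)
    have "(D has_integral f b - f a) {a..b}"
      by (rule fundamental_theorem_of_calculus_strong[OF S ab D(1) f])
    then have "(g has_integral f b - f a) {a..b}"
      by (rule has_integral_spike_finite[OF S, rotated]) (auto simp: g_def)
    then have "(g has_integral f b - f a) UNIV"
      by (rule has_integral_on_superset) (auto simp: g_def)
    moreover have "(g has_integral integral\<^sup>L lborel g) UNIV"
      using int by (rule has_integral_integral_lborel)
    ultimately have "f b - f a = integral\<^sup>L lborel g" by (rule has_integral_unique)
    then have "cmod (f b - f a) \<le> (LINT x|lborel. cmod (g x))" by simp
    then have "ennreal (cmod (f b - f a)) \<le> ennreal (LINT x|lborel. cmod (g x))" by (rule ennreal_leI)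
    also have "\<dots> = (\<integral>\<^sup>+x. ennreal (cmod (g x)) \<partial>lborel)"
      using int by (intro nn_integral_eq_integral[symmetric]) auto
    finally show ?thesis by (simp add: nn)
  qed (simp add: nn)
qed

context riemann_surface
begin

lemma chart_at: "p \<in> topspace X \<Longrightarrow> chart_at \<A> p \<in> \<A> \<and> p \<in> fst (chart_at \<A> p)"
  unfolding chart_at_def by (rule someI_ex) (use cover in blast)

lemma transition_has_derivative:
  assumes "c \<in> \<A>" "d \<in> \<A>" "p \<in> fst c" "p \<in> fst d"
  shows "(snd d \<circ> chart_inv c has_field_derivative transition_deriv c d p) (at (snd c p))"
proof -
  have "open (snd c ` (fst c \<inter> fst d))"
    using charts[OF assms(1)] charts[OF assms(2)] by (intro chart_open_image) (auto simp: is_chart_def)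
  then show ?thesis
    unfolding transition_deriv_def using holomorphic_derivI[OF compatible[OF assms(1,2)]] assms by blast
qed

lemma speed_independent_of_chart:
  assumes cd: "c \<in> \<A>" "d \<in> \<A>" "\<gamma> s \<in> fst c" "\<gamma> s \<in> fst d"
    and ds2: "conformal_metric \<A> ds2" and ev: "\<forall>\<^sub>F w in nhds s. \<gamma> w \<in> fst c"
    and D: "(snd c \<circ> \<gamma> has_vector_derivative D) (at s)"
  shows "sqrt (ds2 d (\<gamma> s)) * cmod (vector_derivative (snd d \<circ> \<gamma>) (at s)) = sqrt (ds2 c (\<gamma> s)) * cmod D"
proof -
  have "(snd d \<circ> chart_inv c has_field_derivative transition_deriv c d (\<gamma> s)) (at ((snd c \<circ> \<gamma>) s))"
    using transition_has_derivative[OF cd] by simp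
  from field_vector_diff_chain_at[OF D this]
  have "((snd d \<circ> chart_inv c) \<circ> (snd c \<circ> \<gamma>) has_vector_derivative D * transition_deriv c d (\<gamma> s)) (at s)" .
  moreover have "\<forall>\<^sub>F w in nhds s. ((snd d \<circ> chart_inv c) \<circ> (snd c \<circ> \<gamma>)) w = (snd d \<circ> \<gamma>) w"
    using ev by eventually_elim (simp add: chart_inv_chart[OF charts[OF cd(1)]])
  ultimately have "(snd d \<circ> \<gamma> has_vector_derivative D * transition_deriv c d (\<gamma> s)) (at s)"
    by (subst (asm) has_vector_derivative_cong_ev) (auto dest: eventually_nhds_x_imp_x)
  then have "vector_derivative (snd d \<circ> \<gamma>) (at s) = D * transition_deriv c d (\<gamma> s)"
    by (rule vector_derivative_at)
  moreover have "sqrt (ds2 c (\<gamma> s)) = sqrt (ds2 d (\<gamma> s)) * cmod (transition_deriv c d (\<gamma> s))"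
  proof -
    have "ds2 c (\<gamma> s) = ds2 d (\<gamma> s) * (cmod (transition_deriv c d (\<gamma> s)))\<^sup>2"
      using ds2 cd unfolding conformal_metric_def by blast
    then show ?thesis by (simp add: real_sqrt_mult)
  qed
  ultimately show ?thesis by (simp add: norm_mult)
qed

lemma curve_length_lower_bound:
  assumes ds2: "conformal_metric \<A> ds2" and \<gamma>: "piecewise_C1_curve X \<A> \<gamma>"
    and c: "c \<in> \<A>" and t: "0 \<le> t" "t \<le> 1" and \<kappa>: "\<kappa> > 0"
    and inc: "\<And>s. t \<le> s \<Longrightarrow> s \<le> 1 \<Longrightarrow> \<gamma> s \<in> fst c \<and> \<kappa> \<le> sqrt (ds2 c (\<gamma> s))"
  shows "ennreal (\<kappa> * cmod (snd c (\<gamma> 1) - snd c (\<gamma> t))) \<le> curve_length \<A> ds2 \<gamma>"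
proof -
  note ch = charts[OF c]
  have path: "continuous_map (top_of_set {0..1}) X \<gamma>"
    using \<gamma> by (simp add: piecewise_C1_curve_def pathin_def)
  obtain S where S: "finite S" "\<And>c. c \<in> \<A> \<Longrightarrow> (snd c \<circ> \<gamma>) C1_differentiable_on ({t \<in> {0..1}. \<gamma> t \<in> fst c} - S)"
    using \<gamma> by (auto simp: piecewise_C1_curve_def)
  obtain D where D: "\<And>s. s \<in> {t \<in> {0..1}. \<gamma> t \<in> fst c} - S \<Longrightarrow> (snd c \<circ> \<gamma> has_vector_derivative D s) (at s)"
    "continuous_on ({t \<in> {0..1}. \<gamma> t \<in> fst c} - S) D"
    using S(2)[OF c] unfolding C1_differentiable_on_def by blast
  define S' where "S' = insert 0 (insert 1 S)"
  have sub: "{t..1} - S' \<subseteq> {t \<in> {0..1}. \<gamma> t \<in> fst c} - S"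
  proof
    fix s assume "s \<in> {t..1} - S'"
    then show "s \<in> {t \<in> {0..1}. \<gamma> t \<in> fst c} - S" using inc[of s] t(1) by (auto simp: S'_def)
  qed
  have cont: "continuous_on {t..1} (snd c \<circ> \<gamma>)"
  proof -
    have "continuous_map (top_of_set {t..1}) X \<gamma>"
      by (rule continuous_map_from_subtopology_mono[OF path]) (use t in auto)
    then have "continuous_map (top_of_set {t..1}) (subtopology X (fst c)) \<gamma>"
      unfolding continuous_map_in_subtopology using inc by simp
    moreover have "continuous_map (subtopology X (fst c)) (top_of_set (snd c ` fst c)) (snd c)"
      using ch by (auto simp: is_chart_def homeomorphic_imp_continuous_map)
    ultimately have "continuous_map (top_of_set {t..1}) (top_of_set (snd c ` fst c)) (snd c \<circ> \<gamma>)"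
      by (rule continuous_map_compose)
    then show ?thesis by (simp add: continuous_map_in_subtopology)
  qed
  have "ennreal (cmod ((snd c \<circ> \<gamma>) 1 - (snd c \<circ> \<gamma>) t))
      \<le> (\<integral>\<^sup>+s. ennreal (cmod (D s)) * indicator ({t..1} - S') s \<partial>lborel)"
    using D(1) sub continuous_on_subset[OF D(2) sub] S(1)
    by (intro norm_diff_le_nn_integral_derivative[OF t(2) _ cont]) (auto simp: S'_def)
  then have "ennreal \<kappa> * ennreal (cmod ((snd c \<circ> \<gamma>) 1 - (snd c \<circ> \<gamma>) t))
      \<le> ennreal \<kappa> * (\<integral>\<^sup>+s. ennreal (cmod (D s)) * indicator ({t..1} - S') s \<partial>lborel)"
    by (rule mult_left_mono) simp
  also have "\<dots> = (\<integral>\<^sup>+s. ennreal \<kappa> * (ennreal (cmod (D s)) * indicator ({t..1} - S') s) \<partial>lborel)"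
  proof (rule nn_integral_cmult[symmetric])
    define g where "g = (\<lambda>s. indicator ({t..1} - S') s *\<^sub>R D s)"
    have "g \<in> borel_measurable borel"
      unfolding g_def using S(1) continuous_on_subset[OF D(2) sub]
      by (intro borel_measurable_continuous_on_indicator sets.Diff borel_closed[OF closed_atLeastAtMost]
        borel_closed[OF finite_imp_closed]) (auto simp: S'_def)
    then have "(\<lambda>s. ennreal (cmod (g s))) \<in> borel_measurable lborel" by simp
    also have "(\<lambda>s. ennreal (cmod (g s))) = (\<lambda>s. ennreal (cmod (D s)) * indicator ({t..1} - S') s)"
      by (auto simp: g_def indicator_def)
    finally show "(\<lambda>s. ennreal (cmod (D s)) * indicator ({t..1} - S') s) \<in> borel_measurable lborel" .
  qed
  also have "\<dots> \<le> curve_length \<A> ds2 \<gamma>"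
    unfolding curve_length_def Let_def
  proof (rule nn_integral_mono)
    fix s :: real
    show "ennreal \<kappa> * (ennreal (cmod (D s)) * indicator ({t..1} - S') s)
       \<le> ennreal (sqrt (ds2 (chart_at \<A> (\<gamma> s)) (\<gamma> s)) *
            cmod (vector_derivative (snd (chart_at \<A> (\<gamma> s)) \<circ> \<gamma>) (at s))) * indicator {0..1} s"
    proof (cases "s \<in> {t..1} - S'")
      case True
      then have s: "0 < s" "s < 1" "t \<le> s" using t by (auto simp: S'_def)
      have sc: "\<gamma> s \<in> fst c" "\<kappa> \<le> sqrt (ds2 c (\<gamma> s))" using inc[of s] s by auto
      have "openin (top_of_set {0..1}) {w \<in> topspace (top_of_set {0..1}). \<gamma> w \<in> fst c}"
        using path ch by (intro openin_continuous_map_preimage) (auto simp: is_chart_def)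
      then obtain T where T: "open T" "{w \<in> {0..1}. \<gamma> w \<in> fst c} = {0..1} \<inter> T"
        by (auto simp: openin_open)
      have "s \<in> {0..1} \<inter> T" unfolding T(2)[symmetric] using s sc by simp
      then have "s \<in> T \<inter> {0<..<1}" using s by simp
      then have "\<forall>\<^sub>F w in nhds s. w \<in> T \<inter> {0<..<1}"
        using T(1) by (intro eventually_nhds_in_open) auto
      then have ev: "\<forall>\<^sub>F w in nhds s. \<gamma> w \<in> fst c"
      proof eventually_elim
        case (elim w)
        then have "w \<in> {0..1} \<inter> T" by auto
        then show ?case unfolding T(2)[symmetric] by simp
      qed
      have "\<gamma> s \<in> topspace X" using path s by (auto simp: continuous_map_def)
      then have ca: "chart_at \<A> (\<gamma> s) \<in> \<A>" "\<gamma> s \<in> fst (chart_at \<A> (\<gamma> s))" using chart_at by auto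
      have "(snd c \<circ> \<gamma> has_vector_derivative D s) (at s)" using D(1) True sub by blast
      note speed_independent_of_chart[OF c ca(1) sc(1) ca(2) ds2 ev this]
      moreover have "ennreal (\<kappa> * cmod (D s)) \<le> ennreal (sqrt (ds2 c (\<gamma> s)) * cmod (D s))"
        using sc(2) by (intro ennreal_leI mult_right_mono) auto
      moreover have "ennreal (\<kappa> * cmod (D s)) = ennreal \<kappa> * ennreal (cmod (D s))"
        using \<kappa> by (intro ennreal_mult) auto
      moreover have "s \<in> {0..1}" using s by simp
      ultimately show ?thesis using True by (simp only: indicator_simps mult_1_right)
    qed simp
  qed
  finally have le: "ennreal \<kappa> * ennreal (cmod (snd c (\<gamma> 1) - snd c (\<gamma> t))) \<le> curve_length \<A> ds2 \<gamma>"
    unfolding o_apply .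
  have "ennreal (\<kappa> * cmod (snd c (\<gamma> 1) - snd c (\<gamma> t))) = ennreal \<kappa> * ennreal (cmod (snd c (\<gamma> 1) - snd c (\<gamma> t)))"
    using \<kappa> by (intro ennreal_mult) auto
  also note le
  finally show ?thesis .
qed

text \<open>
  The metric is bounded below on a closed coordinate disc around \<open>x\<close>, so a curve that reaches \<open>x\<close> from outside is at
  least as long as its part after the last entry into this disc. Thus convergence in the Riemannian distance implies
  convergence in the topology of \<open>X\<close>.
\<close>

lemma riemannian_dist_small_imp_in:
  assumes ds2: "conformal_metric \<A> ds2" and V: "openin X V" and x: "x \<in> V"
  obtains \<delta> where "\<delta> > 0" "\<And>y. riemannian_dist X \<A> ds2 y x < ennreal \<delta> \<Longrightarrow> y \<in> V"
proof -
  have "x \<in> topspace X" using V x openin_subset by blast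
  then obtain c where c: "c \<in> \<A>" "x \<in> fst c" using cover by blast
  note ch = charts[OF c(1)]
  obtain r where r: "r > 0" "ball (snd c x) r \<subseteq> snd c ` (fst c \<inter> V)"
    using chart_ball[OF ch c(2) V x] by blast
  define \<rho> where "\<rho> = r / 2"
  have \<rho>: "\<rho> > 0" "cball (snd c x) \<rho> \<subseteq> snd c ` (fst c \<inter> V)"
    using r by (auto simp: \<rho>_def subset_iff)
  have "Ck_on 0 (ds2 c \<circ> chart_inv c) (snd c ` fst c)"
    using ds2 c(1) unfolding conformal_metric_def smooth_function_on_def by blast
  then have "continuous_on (cball (snd c x) \<rho>) (ds2 c \<circ> chart_inv c)"
    using \<rho>(2) by (auto intro: continuous_on_subset)
  then obtain z where z: "z \<in> cball (snd c x) \<rho>"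
    "\<And>w. w \<in> cball (snd c x) \<rho> \<Longrightarrow> (ds2 c \<circ> chart_inv c) z \<le> (ds2 c \<circ> chart_inv c) w"
    using continuous_attains_inf[of "cball (snd c x) \<rho>"] \<rho>(1) by fastforce
  define \<kappa> where "\<kappa> = sqrt (ds2 c (chart_inv c z))"
  have "chart_inv c z \<in> fst c" using z(1) \<rho>(2) by (intro inv_into_into) auto
  then have "0 < ds2 c (chart_inv c z)" using ds2 c(1) unfolding conformal_metric_def by blast
  then have \<kappa>: "\<kappa> > 0" by (simp add: \<kappa>_def)
  show thesis
  proof
    show "\<kappa> * \<rho> > 0" using \<kappa> \<rho> by simp
    fix y assume "riemannian_dist X \<A> ds2 y x < ennreal (\<kappa> * \<rho>)"
    then obtain \<gamma> where \<gamma>: "piecewise_C1_curve X \<A> \<gamma>" "\<gamma> 0 = y" "\<gamma> 1 = x" "curve_length \<A> ds2 \<gamma> < ennreal (\<kappa> * \<rho>)"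
      unfolding riemannian_dist_def INF_less_iff by auto
    show "y \<in> V"
    proof (rule ccontr)
      assume "y \<notin> V"
      have path: "continuous_map (top_of_set {0..1}) X \<gamma>"
        using \<gamma> by (simp add: piecewise_C1_curve_def pathin_def)
      have far: "\<rho> \<le> cmod (snd c (\<gamma> 0) - snd c x)" if "\<gamma> 0 \<in> fst c"
      proof (rule ccontr)
        assume "\<not> ?thesis"
        then have "snd c y \<in> snd c ` (fst c \<inter> V)"
          using \<rho>(2) \<gamma>(2) by (auto simp: subset_iff dist_norm norm_minus_commute)
        then have "y \<in> V" using chart_inj[OF ch] that \<gamma>(2) by (auto dest: inj_onD)
        then show False using \<open>y \<notin> V\<close> by simp
      qed
      have sub: "cball (snd c x) \<rho> \<subseteq> snd c ` fst c" using \<rho>(2) by blast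
      obtain t where t: "0 \<le> t" "t \<le> 1" "cmod (snd c (\<gamma> t) - snd c x) = \<rho>"
        "\<And>s. t \<le> s \<Longrightarrow> s \<le> 1 \<Longrightarrow> \<gamma> s \<in> fst c \<and> cmod (snd c (\<gamma> s) - snd c x) \<le> \<rho>"
        by (rule last_exit_from_chart_disc[OF Hausdorff ch sub path _ far])
          (use \<gamma>(3) c(2) \<rho>(1) in auto)
      have "ennreal (\<kappa> * cmod (snd c (\<gamma> 1) - snd c (\<gamma> t))) \<le> curve_length \<A> ds2 \<gamma>"
      proof (rule curve_length_lower_bound[OF ds2 \<gamma>(1) c(1) t(1,2) \<kappa>])
        fix s assume s: "t \<le> s" "s \<le> 1"
        then have "\<gamma> s \<in> fst c" "snd c (\<gamma> s) \<in> cball (snd c x) \<rho>"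
          using t(4) by (auto simp: dist_norm norm_minus_commute)
        then show "\<gamma> s \<in> fst c \<and> \<kappa> \<le> sqrt (ds2 c (\<gamma> s))"
          using z(2)[of "snd c (\<gamma> s)"] chart_inv_chart[OF ch] by (simp add: \<kappa>_def)
      qed
      also have "cmod (snd c (\<gamma> 1) - snd c (\<gamma> t)) = \<rho>" using t(3) \<gamma>(3) by (simp add: norm_minus_commute)
      finally show False using \<gamma>(4) by simp
    qed
  qed
qed

end

section \<open>Flat conformal metrics on a Riemann surface\<close>

text \<open>
  A holomorphic function of constant modulus, here the derivative, is constant by the maximum principle.
\<close>

lemma holomorphic_unimodular_deriv_affine:
  assumes f: "f holomorphic_on ball a r" and r: "r > 0" and d: "\<And>z. z \<in> ball a r \<Longrightarrow> cmod (deriv f z) = 1"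
  obtains \<alpha> \<beta> where "cmod \<alpha> = 1" "\<And>z. z \<in> ball a r \<Longrightarrow> f z = \<alpha> * z + \<beta>"
proof -
  have "deriv f constant_on ball a r"
    by (rule maximum_modulus_principle[where U = "ball a r" and \<xi> = a])
      (use f r d in \<open>auto intro: holomorphic_deriv\<close>)
  then obtain \<alpha> where \<alpha>: "\<And>z. z \<in> ball a r \<Longrightarrow> deriv f z = \<alpha>"
    by (auto simp: constant_on_def)
  have "\<exists>\<beta>. \<forall>z\<in>ball a r. f z - \<alpha> * z = \<beta>"
  proof (rule has_field_derivative_zero_constant)
    fix z assume z: "z \<in> ball a r"
    then have "(f has_field_derivative \<alpha>) (at z)"
      using holomorphic_derivI[OF f _ z] \<alpha>[OF z] by simp
    then have "((\<lambda>z. f z - \<alpha> * z) has_field_derivative \<alpha> - \<alpha>) (at z)"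
      by (intro DERIV_diff DERIV_cmult_Id)
    then show "((\<lambda>z. f z - \<alpha> * z) has_field_derivative 0) (at z within ball a r)"
      by (simp add: has_field_derivative_at_within)
  qed auto
  then obtain \<beta> where "\<And>z. z \<in> ball a r \<Longrightarrow> f z - \<alpha> * z = \<beta>" by blast
  then show thesis
    using that[of \<alpha> \<beta>] \<alpha>[of a] d[of a] r by (auto simp: algebra_simps)
qed

lemma is_chart_restrict_compose:
  assumes c: "is_chart X c" and N: "openin X N" "N \<subseteq> fst c"
    and F: "F holomorphic_on snd c ` N" "inj_on F (snd c ` N)"
  shows "is_chart X (N, F \<circ> snd c)"
proof -
  have op: "open (snd c ` V)" if "openin X V" "V \<subseteq> N" for V
    using chart_open_image[OF c that(1)] that(2) N by auto
  have opF: "open (F ` W)" if "open W" "W \<subseteq> snd c ` N" for W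
    using that F by (intro open_mapping_thm3) (auto intro: holomorphic_on_subset inj_on_subset)
  have img: "open ((F \<circ> snd c) ` V)" if "openin X V" "V \<subseteq> N" for V
    using opF[OF op[OF that]] that(2) by (auto simp: image_comp image_mono)
  have top: "topspace (subtopology X N) = N"
    using N by (simp add: openin_subset Int_absorb1)
  have "homeomorphic_map (subtopology X N) (top_of_set ((F \<circ> snd c) ` N)) (F \<circ> snd c)"
  proof (rule bijective_open_imp_homeomorphic_map)
    show "continuous_map (subtopology X N) (top_of_set ((F \<circ> snd c) ` N)) (F \<circ> snd c)"
      unfolding continuous_map_in_subtopology top
    proof
      have "openin (subtopology X N) {p \<in> N. (F \<circ> snd c) p \<in> W}" if W: "open W" for W
      proof -
        have "open (snd c ` N \<inter> F -` W)"
          using F(1) op[OF N(1) order.refl] W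
          by (intro continuous_open_preimage holomorphic_on_imp_continuous_on)
        from chart_open_preimage[OF c this]
        have "openin X ({p \<in> fst c. snd c p \<in> snd c ` N \<inter> F -` W} \<inter> N)" using N by (intro openin_Int)
        moreover have "{p \<in> fst c. snd c p \<in> snd c ` N \<inter> F -` W} \<inter> N = {p \<in> N. (F \<circ> snd c) p \<in> W}"
          using N by auto
        ultimately show ?thesis using N by (simp add: openin_open_subtopology)
      qed
      then show "continuous_map (subtopology X N) euclidean (F \<circ> snd c)"
        by (simp add: continuous_map_def top del: topspace_subtopology)
    qed simp
    show "open_map (subtopology X N) (top_of_set ((F \<circ> snd c) ` N)) (F \<circ> snd c)"
      unfolding open_map_def
      using img N by (auto simp: openin_open_subtopology openin_open_eq image_mono)
    show "inj_on (F \<circ> snd c) (topspace (subtopology X N))"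
      unfolding top using F(2) chart_inj[OF c] N by (intro comp_inj_on) (auto intro: inj_on_subset)
  qed (use top in auto)
  then show ?thesis using N img[of N] by (simp add: is_chart_def)
qed

text \<open>
  A conformal metric \<open>\<sigma> |dz|\<close> is flat when \<open>\<sigma>\<close> is locally the modulus of a holomorphic function without zeros; \<open>log \<sigma>\<close>
  is then harmonic.
\<close>

locale flat_conformal_structure = riemann_surface X \<A>
  for X :: "'a topology" and \<A> :: "'a chart set" +
  fixes S :: "'a set" and \<sigma> :: "'a chart \<Rightarrow> 'a \<Rightarrow> real"
  assumes open_S: "openin X S"
    and transform: "c \<in> \<A> \<Longrightarrow> d \<in> \<A> \<Longrightarrow> p \<in> fst c \<Longrightarrow> p \<in> fst d \<Longrightarrow> p \<in> S \<Longrightarrow>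
      \<sigma> c p = \<sigma> d p * cmod (transition_deriv c d p)"
    and flat: "c \<in> \<A> \<Longrightarrow> p \<in> fst c \<Longrightarrow> p \<in> S \<Longrightarrow>
      \<exists>r>0. \<exists>u. ball (snd c p) r \<subseteq> snd c ` (fst c \<inter> S) \<and> u holomorphic_on ball (snd c p) r \<and>
        (\<forall>z\<in>ball (snd c p) r. u z \<noteq> 0 \<and> cmod (u z) = \<sigma> c (chart_inv c z))"
begin

text \<open>
  A primitive \<open>F\<close> of a holomorphic function with modulus \<open>\<sigma>\<close> is a coordinate in which the metric becomes Euclidean.
\<close>

definition flat_atlas :: "'a chart set" where
  "flat_atlas = {d. \<exists>c\<in>\<A>. \<exists>N F. d = (N, F \<circ> snd c) \<and> openin X N \<and> N \<subseteq> fst c \<inter> S \<and>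
     F holomorphic_on snd c ` N \<and> inj_on F (snd c ` N) \<and>
     (\<forall>z\<in>snd c ` N. cmod (deriv F z) = \<sigma> c (chart_inv c z))}"

lemma flat_atlas_at:
  assumes c: "c \<in> \<A>" and p: "p \<in> fst c" "p \<in> S"
  obtains N F where "p \<in> N" "(N, F \<circ> snd c) \<in> flat_atlas" "N \<subseteq> fst c" "openin X N" 
    "F holomorphic_on snd c ` N" "inj_on F (snd c ` N)"
    "\<And>z. z \<in> snd c ` N \<Longrightarrow> cmod (deriv F z) = \<sigma> c (chart_inv c z)"
proof -
  note ch = charts[OF c]
  obtain r u where r: "r > 0" "ball (snd c p) r \<subseteq> snd c ` (fst c \<inter> S)" and u: "u holomorphic_on ball (snd c p) r"
    "\<And>z. z \<in> ball (snd c p) r \<Longrightarrow> u z \<noteq> 0 \<and> cmod (u z) = \<sigma> c (chart_inv c z)"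
    using flat[OF c p] by metis
  obtain F where F: "\<And>z. z \<in> ball (snd c p) r \<Longrightarrow> (F has_field_derivative u z) (at z)"
    using holomorphic_convex_primitive'[OF convex_ball open_ball u(1)] by (metis at_within_open open_ball)
  then have dF: "deriv F z = u z" if "z \<in> ball (snd c p) r" for z
    using that by (metis DERIV_imp_deriv)
  have hF: "F holomorphic_on ball (snd c p) r"
    using F unfolding holomorphic_on_open[OF open_ball] by blast
  obtain s where s: "s > 0" "ball (snd c p) s \<subseteq> ball (snd c p) r" "inj_on F (ball (snd c p) s)"
  proof (rule has_complex_derivative_locally_injective[OF hF])
    show "deriv F (snd c p) \<noteq> 0" using dF[of "snd c p"] u(2)[of "snd c p"] r by simp
  qed (use r in auto)
  define N where "N = {q \<in> fst c. snd c q \<in> ball (snd c p) s}"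
  have NS: "N \<subseteq> S"
  proof
    fix q assume q: "q \<in> N"
    then have "snd c q \<in> snd c ` (fst c \<inter> S)" using s r unfolding N_def by blast
    then obtain q' where "q' \<in> fst c" "q' \<in> S" "snd c q = snd c q'" by auto
    then show "q \<in> S" using chart_inj[OF ch] q by (auto simp: N_def dest: inj_onD)
  qed
  have img: "snd c ` N = ball (snd c p) s"
  proof (intro equalityI subsetI)
    fix z assume z: "z \<in> ball (snd c p) s"
    then obtain q where "q \<in> fst c" "z = snd c q" using s(2) r(2) by blast
    then show "z \<in> snd c ` N" using z by (auto simp: N_def)
  qed (auto simp: N_def)
  have oN: "openin X N" unfolding N_def by (rule chart_open_preimage[OF ch]) simp
  have F': "F holomorphic_on snd c ` N" "inj_on F (snd c ` N)"
    unfolding img using hF s by (auto intro: holomorphic_on_subset)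
  have F'': "cmod (deriv F z) = \<sigma> c (chart_inv c z)" if "z \<in> snd c ` N" for z
  proof -
    have "z \<in> ball (snd c p) r" using that s(2) unfolding img by blast
    then show ?thesis using dF u(2) by simp
  qed
  have "(N, F \<circ> snd c) \<in> flat_atlas"
    unfolding flat_atlas_def using c oN NS F' F'' by (auto simp: N_def intro!: bexI[of _ c] exI[of _ N] exI[of _ F])
  moreover have "p \<in> N" using p s by (simp add: N_def)
  moreover have "N \<subseteq> fst c" by (auto simp: N_def)
  ultimately show thesis using F' F'' oN by (intro that[of N F])
qed

sublocale flat_surface X S flat_atlas
proof
  show "Hausdorff_space X" by (rule Hausdorff)
  show "is_chart X d" if d: "d \<in> flat_atlas" for d
  proof -
    obtain c N F where "c \<in> \<A>" "d = (N, F \<circ> snd c)" "openin X N" "N \<subseteq> fst c \<inter> S"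
      "F holomorphic_on snd c ` N" "inj_on F (snd c ` N)"
      using d unfolding flat_atlas_def by blast
    then show ?thesis using is_chart_restrict_compose[OF charts] by auto
  qed
  show "(\<Union>d\<in>flat_atlas. fst d) = S"
  proof (intro equalityI subsetI)
    fix p assume p: "p \<in> S"
    then have "p \<in> topspace X" using open_S openin_subset by blast
    then obtain c where "c \<in> \<A>" "p \<in> fst c" using cover by (metis UN_iff)
    then obtain N F where "p \<in> N" "(N, F \<circ> snd c) \<in> flat_atlas"
      using flat_atlas_at p by metis
    then show "p \<in> (\<Union>d\<in>flat_atlas. fst d)" by force
  qed (auto simp: flat_atlas_def)
  fix d e p assume d: "d \<in> flat_atlas" and e: "e \<in> flat_atlas" and p: "p \<in> fst d" "p \<in> fst e"
  obtain c N F where c: "c \<in> \<A>" "d = (N, F \<circ> snd c)" "openin X N" "N \<subseteq> fst c" "N \<subseteq> S"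
      "F holomorphic_on snd c ` N" "inj_on F (snd c ` N)"
      "\<And>z. z \<in> snd c ` N \<Longrightarrow> cmod (deriv F z) = \<sigma> c (chart_inv c z)"
    using d unfolding flat_atlas_def by blast
  obtain c' N' F' where c': "c' \<in> \<A>" "e = (N', F' \<circ> snd c')" "openin X N'" "N' \<subseteq> fst c'" "N' \<subseteq> S"
      "F' holomorphic_on snd c' ` N'" "inj_on F' (snd c' ` N')"
      "\<And>z. z \<in> snd c' ` N' \<Longrightarrow> cmod (deriv F' z) = \<sigma> c' (chart_inv c' z)"
    using e unfolding flat_atlas_def by blast
  note ch = charts[OF c(1)] and ch' = charts[OF c'(1)]
  have oN: "open (snd c ` N)" by (rule chart_open_image[OF ch c(3,4)])
  have oN': "open (snd c' ` N')" by (rule chart_open_image[OF ch' c'(3,4)])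
  define O' where "O' = snd c ` (N \<inter> N')"
  have oO: "open O'" unfolding O'_def using c c' by (intro chart_open_image[OF ch]) auto
  have O_sub: "O' \<subseteq> snd c ` N" by (auto simp: O'_def)
  obtain G where G: "G holomorphic_on F ` snd c ` N" "\<And>z. z \<in> snd c ` N \<Longrightarrow> deriv F z * deriv G (F z) = 1"
      "\<And>z. z \<in> snd c ` N \<Longrightarrow> G (F z) = z"
    using holomorphic_has_inverse[OF c(6) oN c(7)] by metis
  have oFN: "open (F ` snd c ` N)"
    by (rule open_mapping_thm3[OF c(6) oN c(7)])
  have oFO: "open (F ` O')"
    using open_mapping_thm3[OF holomorphic_on_subset[OF c(6) O_sub] oO inj_on_subset[OF c(7) O_sub]] .
  define t where "t = snd c' \<circ> chart_inv c"
  define T where "T = (\<lambda>\<zeta>. F' (t (G \<zeta>)))"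
  have der: "(T has_field_derivative deriv F' (snd c' y) * (transition_deriv c c' y * deriv G (F (snd c y)))) (at (F (snd c y)))"
    if y: "y \<in> N" "y \<in> N'" for y
  proof -
    have yz: "snd c y \<in> snd c ` N" "snd c' y \<in> snd c' ` N'" using y by auto
    have Gd: "(G has_field_derivative deriv G (F (snd c y))) (at (F (snd c y)))"
      using holomorphic_derivI[OF G(1) oFN] yz by blast
    have inv: "chart_inv c (snd c y) = y" using chart_inv_chart[OF ch] c y by blast
    have "open (snd c ` (fst c \<inter> fst c'))"
      using ch ch' by (intro chart_open_image[OF ch]) (auto simp: is_chart_def)
    moreover have "snd c y \<in> snd c ` (fst c \<inter> fst c')" using y c c' by auto
    ultimately have "(t has_field_derivative transition_deriv c c' y) (at (snd c y))"
      unfolding t_def transition_deriv_def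
      using holomorphic_derivI[OF compatible[OF c(1) c'(1)]] by blast
    then have td: "(t has_field_derivative transition_deriv c c' y) (at (G (F (snd c y))))"
      using G(3)[OF yz(1)] by simp
    have "(F' has_field_derivative deriv F' (snd c' y)) (at (snd c' y))"
      using holomorphic_derivI[OF c'(6) oN' yz(2)] .
    then have "(F' has_field_derivative deriv F' (snd c' y)) (at (t (G (F (snd c y)))))"
      using G(3)[OF yz(1)] inv by (simp add: t_def)
    from DERIV_chain2[OF this DERIV_chain2[OF td Gd]] show ?thesis by (simp add: T_def)
  qed
  have T_eq: "T (F (snd c y)) = F' (snd c' y)" if "y \<in> N" for y
    using that G(3)[of "snd c y"] chart_inv_chart[OF ch, of y] c by (auto simp: T_def t_def)
  have modulus: "cmod (deriv T (F (snd c y))) = 1" if y: "y \<in> N" "y \<in> N'" for y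
  proof -
    have in_c: "y \<in> fst c" "y \<in> fst c'" "y \<in> S" using y c c' by auto
    have "cmod (deriv F' (snd c' y)) = \<sigma> c' y"
      using c'(8)[of "snd c' y"] y chart_inv_chart[OF ch' in_c(2)] by auto
    moreover have "cmod (deriv F (snd c y)) = \<sigma> c y"
      using c(8)[of "snd c y"] y chart_inv_chart[OF ch in_c(1)] by auto
    moreover have "cmod (deriv F (snd c y)) * cmod (deriv G (F (snd c y))) = 1"
      using G(2)[of "snd c y"] y by (metis imageI norm_mult norm_one)
    ultimately show ?thesis
      using DERIV_imp_deriv[OF der[OF y]] transform[OF c(1) c'(1) in_c] by (simp add: norm_mult mult.assoc)
  qed
  have "F (snd c p) \<in> F ` O'" using p c(2) c'(2) by (auto simp: O'_def)
  then obtain r where r: "r > 0" "ball (F (snd c p)) r \<subseteq> F ` O'"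
    using oFO open_contains_ball by blast
  have rep: "\<exists>y. y \<in> N \<and> y \<in> N' \<and> z = F (snd c y)" if "z \<in> ball (F (snd c p)) r" for z
    using that r(2) unfolding O'_def by blast
  have "T holomorphic_on ball (F (snd c p)) r"
    unfolding holomorphic_on_open[OF open_ball] using der rep by metis
  moreover have "cmod (deriv T z) = 1" if "z \<in> ball (F (snd c p)) r" for z
    using modulus rep[OF that] by blast
  ultimately obtain \<alpha> \<beta> where ab: "cmod \<alpha> = 1" "\<And>z. z \<in> ball (F (snd c p)) r \<Longrightarrow> T z = \<alpha> * z + \<beta>"
    using holomorphic_unimodular_deriv_affine[OF _ r(1)] by metis
  define V where "V = {y \<in> N. (F \<circ> snd c) y \<in> ball (F (snd c p)) r}"
  have "is_chart X d" using is_chart_restrict_compose[OF ch c(3,4,6,7)] c(2) by simp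
  then have "openin X V" unfolding V_def
    using chart_open_preimage[of X d "ball (F (snd c p)) r"] c(2) by simp
  moreover have "p \<in> V" using p c(2) r by (simp add: V_def)
  moreover have "snd e y = \<alpha> * snd d y + \<beta>" if "y \<in> V" for y
    using ab(2)[of "F (snd c y)"] T_eq[of y] that c(2) c'(2) by (simp add: V_def)
  ultimately show "\<exists>\<alpha> \<beta> V. cmod \<alpha> = 1 \<and> openin X V \<and> p \<in> V \<and> (\<forall>y\<in>V. snd e y = \<alpha> * snd d y + \<beta>)"
    using ab(1) by blast
qed

text \<open>
  Local isometries are holomorphic and pull the metric \<open>\<sigma> |dz|\<close> back to \<open>|dw|\<close>.
\<close>

lemma local_isometry_deriv:
  assumes \<Phi>: "local_isometry U \<Phi>" "open U" and z: "z \<in> U" and c: "c \<in> \<A>" "\<Phi> z \<in> fst c"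
  shows "(snd c \<circ> \<Phi> has_field_derivative deriv (snd c \<circ> \<Phi>) z) (at z)"
    and "cmod (deriv (snd c \<circ> \<Phi>) z) * \<sigma> c (\<Phi> z) = 1"
proof -
  have "\<Phi> z \<in> S" using \<Phi> z by (auto simp: local_isometry_def)
  then obtain N F where N: "\<Phi> z \<in> N" "(N, F \<circ> snd c) \<in> flat_atlas" "N \<subseteq> fst c" "openin X N" 
    "F holomorphic_on snd c ` N" "inj_on F (snd c ` N)"
    "\<And>z. z \<in> snd c ` N \<Longrightarrow> cmod (deriv F z) = \<sigma> c (chart_inv c z)"
    using flat_atlas_at[OF c] by metis
  note ch = riemann_surface.charts[OF riemann_surface_axioms c(1)]
  have oN: "open (snd c ` N)" by (rule chart_open_image[OF ch N(4,3)])
  obtain G where G: "G holomorphic_on F ` snd c ` N" "\<And>z. z \<in> snd c ` N \<Longrightarrow> deriv F z * deriv G (F z) = 1"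
      "\<And>z. z \<in> snd c ` N \<Longrightarrow> G (F z) = z"
    using holomorphic_has_inverse[OF N(5) oN N(6)] by metis
  obtain \<alpha> \<beta> where ab: "cmod \<alpha> = 1" "\<forall>\<^sub>F w in nhds z. snd (N, F \<circ> snd c) (\<Phi> w) = \<alpha> * w + \<beta>"
    using local_isometry_affine[OF \<Phi>(1) z N(2)] N(1) by auto
  have zN: "snd c (\<Phi> z) \<in> snd c ` N" using N(1) by blast
  have eqz: "F (snd c (\<Phi> z)) = \<alpha> * z + \<beta>"
    using eventually_nhds_x_imp_x[OF ab(2)] by simp
  have ev: "\<forall>\<^sub>F w in nhds z. w \<in> U \<and> \<Phi> w \<in> N"
    by (rule local_isometry_eventually_in[OF \<Phi> z N(4,1)])
  have ev': "\<forall>\<^sub>F w in nhds z. (snd c \<circ> \<Phi>) w = G (\<alpha> * w + \<beta>)"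
    using ev ab(2)
  proof eventually_elim
    case (elim w)
    then have "G (F (snd c (\<Phi> w))) = snd c (\<Phi> w)" by (intro G(3)) blast
    then show ?case using elim by simp
  qed
  have oFN: "open (F ` snd c ` N)"
    by (rule open_mapping_thm3[OF N(5) oN N(6)])
  have "(G has_field_derivative deriv G (F (snd c (\<Phi> z)))) (at (\<alpha> * z + \<beta>))"
    using holomorphic_derivI[OF G(1) oFN, of "F (snd c (\<Phi> z))"] zN unfolding eqz by (metis eqz imageI)
  then have "((\<lambda>w. G (\<alpha> * w + \<beta>)) has_field_derivative deriv G (F (snd c (\<Phi> z))) * \<alpha>) (at z)"
    by (rule DERIV_chain2) (auto intro!: derivative_eq_intros)
  then have D: "(snd c \<circ> \<Phi> has_field_derivative deriv G (F (snd c (\<Phi> z))) * \<alpha>) (at z)"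
    using DERIV_cong_ev[OF refl ev' refl] by blast
  then have dz: "deriv (snd c \<circ> \<Phi>) z = deriv G (F (snd c (\<Phi> z))) * \<alpha>" by (rule DERIV_imp_deriv)
  show "(snd c \<circ> \<Phi> has_field_derivative deriv (snd c \<circ> \<Phi>) z) (at z)"
    using D dz by simp
  have "cmod (deriv F (snd c (\<Phi> z))) = \<sigma> c (\<Phi> z)"
    using N(7)[OF zN] chart_inv_chart[OF ch c(2)] by simp
  moreover have "cmod (deriv F (snd c (\<Phi> z))) * cmod (deriv G (F (snd c (\<Phi> z)))) = 1"
    using G(2)[OF zN] by (metis norm_mult norm_one)
  ultimately show "cmod (deriv (snd c \<circ> \<Phi>) z) * \<sigma> c (\<Phi> z) = 1"
    using ab(1) dz by (simp add: norm_mult mult.commute)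
qed

lemma local_isometry_holomorphic:
  assumes "local_isometry U \<Phi>" "open U" "c \<in> \<A>"
  shows "open {z \<in> U. \<Phi> z \<in> fst c}" "(snd c \<circ> \<Phi>) holomorphic_on {z \<in> U. \<Phi> z \<in> fst c}"
proof -
  have "openin X (fst c)"
    using riemann_surface.charts[OF riemann_surface_axioms assms(3)] by (simp add: is_chart_def)
  then show "open {z \<in> U. \<Phi> z \<in> fst c}"
    using assms by (auto simp: local_isometry_def continuous_map_open_iff)
  then show "(snd c \<circ> \<Phi>) holomorphic_on {z \<in> U. \<Phi> z \<in> fst c}"
    using local_isometry_deriv(1)[OF assms(1,2) _ assms(3)] by (auto simp: holomorphic_on_open)
qed

lemma ray_derivative:
  fixes l :: "real \<Rightarrow> complex"
  assumes \<Phi>: "local_isometry U \<Phi>" "open U" and z: "l \<tau> \<in> U" and l: "(l has_vector_derivative v) (at \<tau>)"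
    and c: "c \<in> \<A>" "\<Phi> (l \<tau>) \<in> fst c"
  shows "(snd c \<circ> (\<lambda>\<tau>. \<Phi> (l \<tau>)) has_vector_derivative v * deriv (snd c \<circ> \<Phi>) (l \<tau>)) (at \<tau>)"
  using field_vector_diff_chain_at[OF l local_isometry_deriv(1)[OF \<Phi> z c]] by (simp add: o_def)

text \<open>
  The segment between two points of a radius has finite length because \<open>(R - r)\<^bsup>-\<nu>\<^esup>\<close> is integrable up to \<open>r = R\<close>.
\<close>

lemma riemannian_dist_along_ray:
  assumes \<Phi>: "local_isometry (ball 0 R) \<Phi>" and R: "R > 0" and a: "cmod a = R"
    and \<nu>: "0 \<le> \<nu>" "\<nu> < 1" and C: "C > 0"
    and bound: "\<And>w c. w \<in> ball 0 R \<Longrightarrow> c \<in> \<A> \<Longrightarrow> \<Phi> w \<in> fst c \<Longrightarrow>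
      sqrt (ds2 c (\<Phi> w)) * cmod (deriv (snd c \<circ> \<Phi>) w) \<le> C / (R - cmod w) powr \<nu>"
    and st: "0 \<le> s" "s < 1" "0 \<le> t" "t < 1"
  shows "riemannian_dist X \<A> ds2 (\<Phi> (of_real s * a)) (\<Phi> (of_real t * a))
    \<le> ennreal (C * R powr (1 - \<nu>) / (1 - \<nu>) * \<bar>(1 - s) powr (1 - \<nu>) - (1 - t) powr (1 - \<nu>)\<bar>)"
proof -
  define u where "u = (\<lambda>\<tau>. s + \<tau> * (t - s))"
  define l where "l = (\<lambda>\<tau>. of_real (u \<tau>) * a)"
  define \<gamma> where "\<gamma> = (\<lambda>\<tau>. \<Phi> (l \<tau>))"
  have u01: "0 \<le> u \<tau>" "u \<tau> < 1" if "\<tau> \<in> {0..1}" for \<tau>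
  proof -
    have "u \<tau> = (1 - \<tau>) * s + \<tau> * t" by (simp add: u_def algebra_simps)
    moreover have "0 \<le> (1 - \<tau>) * s" "0 \<le> \<tau> * t" using that st by auto
    moreover have "(1 - \<tau>) * s + \<tau> * t \<le> (1 - \<tau>) * max s t + \<tau> * max s t"
      using that by (intro add_mono mult_left_mono) auto
    then have "(1 - \<tau>) * s + \<tau> * t \<le> max s t" by (simp add: algebra_simps)
    ultimately show "0 \<le> u \<tau>" "u \<tau> < 1" using st by auto
  qed
  have norml: "cmod (l \<tau>) = u \<tau> * R" if "\<tau> \<in> {0..1}" for \<tau>
    using u01[OF that] a by (simp add: l_def norm_mult)
  have l_in: "l \<tau> \<in> ball 0 R" if "\<tau> \<in> {0..1}" for \<tau>
    using norml[OF that] u01[OF that] R by simp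
  have dl: "(l has_vector_derivative of_real (t - s) * a) (at \<tau>)" for \<tau>
    unfolding l_def u_def by (auto intro!: derivative_eq_intros simp: has_vector_derivative_def scaleR_conv_of_real algebra_simps)
  have dg: "(snd c \<circ> \<gamma> has_vector_derivative of_real (t - s) * a * deriv (snd c \<circ> \<Phi>) (l \<tau>)) (at \<tau>)"
    if "\<tau> \<in> {0..1}" "c \<in> \<A>" "\<gamma> \<tau> \<in> fst c" for c \<tau>
    using ray_derivative[OF \<Phi> open_ball l_in[OF that(1)] dl that(2)] that(3) by (simp add: \<gamma>_def)
  have cl: "continuous_on A l" for A unfolding l_def u_def by (intro continuous_intros)
  have "piecewise_C1_curve X \<A> \<gamma>"
    unfolding piecewise_C1_curve_def
  proof (intro conjI exI[of _ "{}"] ballI)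
    have "continuous_map (top_of_set {0..1}) (top_of_set (ball 0 R)) l"
      using cl l_in by (auto simp: continuous_map_in_subtopology)
    moreover have "continuous_map (top_of_set (ball 0 R)) X \<Phi>"
      using \<Phi> unfolding local_isometry_def by blast
    ultimately show "pathin X \<gamma>"
      unfolding pathin_def \<gamma>_def using continuous_map_compose[unfolded o_def] by blast
    fix c assume c: "c \<in> \<A>"
    define W where "W = {z \<in> ball 0 R. \<Phi> z \<in> fst c}"
    have "(deriv (snd c \<circ> \<Phi>)) holomorphic_on W"
      unfolding W_def using local_isometry_holomorphic[OF \<Phi> open_ball c] by (intro holomorphic_deriv)
    then have "continuous_on W (deriv (snd c \<circ> \<Phi>))" by (rule holomorphic_on_imp_continuous_on)
    then have "continuous_on {\<tau> \<in> {0..1}. \<gamma> \<tau> \<in> fst c} (\<lambda>\<tau>. deriv (snd c \<circ> \<Phi>) (l \<tau>))"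
      by (rule continuous_on_compose2[OF _ cl]) (use l_in in \<open>auto simp: W_def \<gamma>_def\<close>)
    then show "(snd c \<circ> \<gamma>) C1_differentiable_on ({\<tau> \<in> {0..1}. \<gamma> \<tau> \<in> fst c} - {})"
      unfolding C1_differentiable_on_def using dg c
      by (intro exI[of _ "\<lambda>\<tau>. of_real (t - s) * a * deriv (snd c \<circ> \<Phi>) (l \<tau>)"]) (auto intro!: continuous_intros)
  qed simp
  moreover have "\<gamma> 0 = \<Phi> (of_real s * a)" "\<gamma> 1 = \<Phi> (of_real t * a)"
    by (auto simp: \<gamma>_def l_def u_def)
  ultimately have "riemannian_dist X \<A> ds2 (\<Phi> (of_real s * a)) (\<Phi> (of_real t * a)) \<le> curve_length \<A> ds2 \<gamma>"
    unfolding riemannian_dist_def by (intro INF_lower) auto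
  also have "\<dots> \<le> (\<integral>\<^sup>+\<tau>. ennreal (C * R powr (1 - \<nu>) * \<bar>t - s\<bar> * (1 - u \<tau>) powr (-\<nu>)) * indicator {0..1} \<tau> \<partial>lborel)"
    unfolding curve_length_def Let_def
  proof (rule nn_integral_mono)
    fix \<tau> :: real
    show "ennreal (sqrt (ds2 (chart_at \<A> (\<gamma> \<tau>)) (\<gamma> \<tau>)) *
            cmod (vector_derivative (snd (chart_at \<A> (\<gamma> \<tau>)) \<circ> \<gamma>) (at \<tau>))) * indicator {0..1} \<tau>
        \<le> ennreal (C * R powr (1 - \<nu>) * \<bar>t - s\<bar> * (1 - u \<tau>) powr (-\<nu>)) * indicator {0..1} \<tau>"
    proof (cases "\<tau> \<in> {0..1}")
      case True
      have "\<gamma> \<tau> \<in> S" using \<Phi> l_in[OF True] by (auto simp: local_isometry_def \<gamma>_def)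
      then have "\<gamma> \<tau> \<in> topspace X" using open_S openin_subset by blast
      then obtain c where c: "c = chart_at \<A> (\<gamma> \<tau>)" "c \<in> \<A>" "\<gamma> \<tau> \<in> fst c" using chart_at by blast
      have "sqrt (ds2 c (\<gamma> \<tau>)) * cmod (vector_derivative (snd c \<circ> \<gamma>) (at \<tau>))
          = \<bar>t - s\<bar> * R * (sqrt (ds2 c (\<Phi> (l \<tau>))) * cmod (deriv (snd c \<circ> \<Phi>) (l \<tau>)))"
        using vector_derivative_at[OF dg[OF True c(2,3)]] a
        by (simp add: norm_mult \<gamma>_def norm_of_real flip: of_real_diff)
      also have "\<dots> \<le> \<bar>t - s\<bar> * R * (C / (R - cmod (l \<tau>)) powr \<nu>)"
        using bound[OF l_in[OF True] c(2)] c(3) R by (intro mult_left_mono) (auto simp: \<gamma>_def)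
      also have "R - cmod (l \<tau>) = R * (1 - u \<tau>)" using norml[OF True] by (simp add: algebra_simps)
      also have "\<bar>t - s\<bar> * R * (C / (R * (1 - u \<tau>)) powr \<nu>) = C * R powr (1 - \<nu>) * \<bar>t - s\<bar> * (1 - u \<tau>) powr (-\<nu>)"
        unfolding powr_mult using R u01[OF True] by (simp add: powr_diff powr_minus field_simps)
      finally show ?thesis
        unfolding c(1) using True by (simp only: indicator_simps mult_1_right) (rule ennreal_leI)
    qed simp
  qed
  also have "\<dots> \<le> ennreal (C * R powr (1 - \<nu>) / (1 - \<nu>) * \<bar>(1 - s) powr (1 - \<nu>) - (1 - t) powr (1 - \<nu>)\<bar>)"
  proof -
    define M where "M = C * R powr (1 - \<nu>) / (1 - \<nu>)"
    \<comment> \<open>the segment may be traversed in either direction\<close>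
    define \<epsilon> where "\<epsilon> = (if s \<le> t then 1 else -1 :: real)"
    have M: "M > 0" using C R \<nu> by (simp add: M_def)
    define F where "F = (\<lambda>\<tau>. - M * \<epsilon> * (1 - u \<tau>) powr (1 - \<nu>))"
    have "(\<integral>\<^sup>+\<tau>. ennreal (C * R powr (1 - \<nu>) * \<bar>t - s\<bar> * (1 - u \<tau>) powr (-\<nu>)) * indicator {0..1} \<tau> \<partial>lborel) = F 1 - F 0"
    proof (rule nn_integral_FTC_Icc)
      show "(\<lambda>\<tau>. C * R powr (1 - \<nu>) * \<bar>t - s\<bar> * (1 - u \<tau>) powr (-\<nu>)) \<in> borel_measurable borel"
        unfolding u_def by measurable
      fix \<tau> :: real assume \<tau>: "\<tau> \<in> {0..1}"
      have "((\<lambda>\<tau>. 1 - u \<tau>) has_real_derivative - (t - s)) (at \<tau>)"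
        unfolding u_def by (auto intro!: derivative_eq_intros)
      from DERIV_fun_powr[OF this, of "1 - \<nu>"]
      have "((\<lambda>\<tau>. (1 - u \<tau>) powr (1 - \<nu>)) has_real_derivative (1 - \<nu>) * (1 - u \<tau>) powr (1 - \<nu> - 1) * - (t - s)) (at \<tau>)"
        using u01[OF \<tau>] by simp
      then have "(F has_real_derivative (- M * \<epsilon>) * ((1 - \<nu>) * (1 - u \<tau>) powr (1 - \<nu> - 1) * - (t - s))) (at \<tau>)"
        unfolding F_def by (rule DERIV_cmult)
      moreover have "(- M * \<epsilon>) * ((1 - \<nu>) * (1 - u \<tau>) powr (1 - \<nu> - 1) * - (t - s))
          = C * R powr (1 - \<nu>) * \<bar>t - s\<bar> * (1 - u \<tau>) powr (-\<nu>)"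
      proof -
        have e: "\<bar>t - s\<bar> = \<epsilon> * (t - s)" by (simp add: \<epsilon>_def)
        have m: "C * R powr (1 - \<nu>) = M * (1 - \<nu>)" using \<nu> by (simp add: M_def)
        have p: "1 - \<nu> - 1 = - \<nu>" by simp
        have "(- M * \<epsilon>) * ((1 - \<nu>) * y * - (t - s)) = M * (1 - \<nu>) * (\<epsilon> * (t - s)) * y" for y
          by (simp add: algebra_simps)
        then show ?thesis unfolding e m p .
      qed
      ultimately show "DERIV F \<tau> :> C * R powr (1 - \<nu>) * \<bar>t - s\<bar> * (1 - u \<tau>) powr (-\<nu>)" by simp
      show "0 \<le> C * R powr (1 - \<nu>) * \<bar>t - s\<bar> * (1 - u \<tau>) powr (-\<nu>)" using C by simp
    qed simp
    also have "F 1 - F 0 = M * (\<epsilon> * ((1 - s) powr (1 - \<nu>) - (1 - t) powr (1 - \<nu>)))"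
      by (simp add: F_def u_def algebra_simps)
    also have "\<dots> \<le> M * \<bar>(1 - s) powr (1 - \<nu>) - (1 - t) powr (1 - \<nu>)\<bar>"
      using M by (intro mult_left_mono) (auto simp: \<epsilon>_def)
    finally show ?thesis by (simp add: M_def ennreal_leI)
  qed
  finally show ?thesis .
qed

text \<open>
  An arbitrary sequence in \<open>[0, 1)\<close> with limit \<open>1\<close>, along which the points of a radius are tested for convergence.
\<close>

definition ray_parameter :: "nat \<Rightarrow> real" where
  "ray_parameter j = 1 - 1 / (real j + 2)"

lemma ray_parameter_bounds: "0 \<le> ray_parameter j" "ray_parameter j < 1" "1 - ray_parameter j = 1 / (real j + 2)"
  by (auto simp: ray_parameter_def)

lemma ray_parameter_tendsto: "ray_parameter \<longlonglongrightarrow> 1"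
  unfolding ray_parameter_def by real_asymp

lemma ray_converges:
  assumes \<Phi>: "local_isometry (ball 0 R) \<Phi>" and R: "R > 0" and a: "cmod a = R"
    and \<nu>: "0 \<le> \<nu>" "\<nu> < 1" and C: "C > 0"
    and bound: "\<And>w c. w \<in> ball 0 R \<Longrightarrow> c \<in> \<A> \<Longrightarrow> \<Phi> w \<in> fst c \<Longrightarrow>
      sqrt (ds2 c (\<Phi> w)) * cmod (deriv (snd c \<circ> \<Phi>) w) \<le> C / (R - cmod w) powr \<nu>"
    and ds2: "conformal_metric \<A> ds2" "complete_metric X \<A> ds2"
  obtains x where "x \<in> topspace X" "limitin X (\<Phi> \<circ> (\<lambda>j. of_real (ray_parameter j) * a)) x sequentially"
proof -
  define p where "p = \<Phi> \<circ> (\<lambda>j. of_real (ray_parameter j) * a)"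
  define K where "K = C * R powr (1 - \<nu>) / (1 - \<nu>)"
  have K: "K > 0" using C R \<nu> by (simp add: K_def)
  define h where "h = (\<lambda>j. (1 / (real j + 2)) powr (1 - \<nu>))"
  have h0: "h \<longlonglongrightarrow> 0"
    unfolding h_def using \<nu> by real_asymp
  have dist: "riemannian_dist X \<A> ds2 (p i) (p j) \<le> ennreal (K * \<bar>h i - h j\<bar>)" for i j
    using riemannian_dist_along_ray[OF \<Phi> R a \<nu> C bound ray_parameter_bounds(1,2)[of i] ray_parameter_bounds(1,2)[of j]]
    by (simp add: p_def K_def h_def ray_parameter_bounds(3))
  have top: "p j \<in> topspace X" for j
  proof -
    have "of_real (ray_parameter j) * a \<in> ball 0 R"
      using ray_parameter_bounds(1,2)[of j] a R by (simp add: norm_mult)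
    then show ?thesis using \<Phi> open_S openin_subset by (fastforce simp: local_isometry_def p_def)
  qed
  have "\<exists>N. \<forall>i\<ge>N. \<forall>j\<ge>N. riemannian_dist X \<A> ds2 (p i) (p j) < \<epsilon>" if "\<epsilon> > 0" for \<epsilon>
  proof -
    obtain e' where e': "0 < e'" "e' < \<epsilon>" using dense \<open>\<epsilon> > 0\<close> by blast
    obtain e where e: "e > 0" "ennreal e < \<epsilon>"
      using e' by (cases e') (auto simp: ennreal_less_zero_iff)
    have "\<forall>\<^sub>F j in sequentially. dist (h j) 0 < e / (2 * K)"
      using h0 e K by (intro tendstoD) auto
    then obtain N where N: "\<And>j. j \<ge> N \<Longrightarrow> \<bar>h j\<bar> < e / (2 * K)"
      by (auto simp: eventually_sequentially)
    have "riemannian_dist X \<A> ds2 (p i) (p j) < \<epsilon>" if "i \<ge> N" "j \<ge> N" for i j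
    proof -
      have "e / (2 * K) + e / (2 * K) = e / K" using K by (simp add: field_simps)
      then have "\<bar>h i - h j\<bar> \<le> e / K" using N[OF that(1)] N[OF that(2)] by linarith
      then have "K * \<bar>h i - h j\<bar> \<le> e" using K by (simp add: field_simps)
      then have "riemannian_dist X \<A> ds2 (p i) (p j) \<le> ennreal e"
        using dist[of i j] ennreal_leI order_trans by blast
      then show ?thesis using e(2) by simp
    qed
    then show ?thesis by blast
  qed
  then obtain x where x: "x \<in> topspace X" "(\<lambda>j. riemannian_dist X \<A> ds2 (p j) x) \<longlonglongrightarrow> 0"
    using ds2(2) top unfolding complete_metric_def by (metis image_subsetI)
  have "limitin X p x sequentially"
    unfolding limitin_def
  proof (intro conjI allI impI)
    fix V assume "openin X V \<and> x \<in> V"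
    then obtain \<delta> where \<delta>: "\<delta> > 0" "\<And>y. riemannian_dist X \<A> ds2 y x < ennreal \<delta> \<Longrightarrow> y \<in> V"
      using riemannian_dist_small_imp_in[OF ds2(1)] by metis
    have "\<forall>\<^sub>F j in sequentially. riemannian_dist X \<A> ds2 (p j) x < ennreal \<delta>"
      using x(2) \<delta>(1) by (intro order_tendstoD(2)[OF x(2)]) simp
    then show "\<forall>\<^sub>F j in sequentially. p j \<in> V" by eventually_elim (rule \<delta>(2))
  qed (rule x(1))
  then show thesis using that x(1) by (simp add: p_def)
qed

text \<open>
  Near \<open>x\<close> the flat metric is at least \<open>\<kappa> |dz| / |z|\<close> for a coordinate \<open>z\<close> that vanishes at \<open>x\<close>, and in this metric \<open>x\<close>
  is infinitely far away. Along a curve of flat speed \<open>R\<close> this reads \<open>|z'| \<le> (R / \<kappa>) |z|\<close>, so that \<open>|z|\<close> decays at most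
  exponentially on the parameter interval, which has length \<open>1\<close>, and cannot tend to \<open>0\<close>.
\<close>

lemma ray_avoids_singular_point:
  assumes \<Phi>: "local_isometry (ball 0 R) \<Phi>" and R: "R > 0" and a: "cmod a = R"
    and c: "c \<in> \<A>" "x \<in> fst c" and x: "x \<notin> S" and \<rho>: "\<rho> > 0" and \<kappa>: "\<kappa> > 0"
    and sing: "\<And>y. y \<in> fst c \<Longrightarrow> y \<in> S \<Longrightarrow> cmod (snd c y - snd c x) \<le> \<rho> \<Longrightarrow>
      \<kappa> \<le> \<sigma> c y * cmod (snd c y - snd c x)"
  shows "\<not> limitin X (\<Phi> \<circ> (\<lambda>j. of_real (ray_parameter j) * a)) x sequentially"
proof
  define \<phi> where "\<phi> = (\<lambda>t. \<Phi> (of_real t * a))"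
  assume "limitin X (\<Phi> \<circ> (\<lambda>j. of_real (ray_parameter j) * a)) x sequentially"
  then have lim: "limitin X (\<lambda>j. \<phi> (ray_parameter j)) x sequentially"
    by (simp add: \<phi>_def o_def)
  note ch = riemann_surface.charts[OF riemann_surface_axioms c(1)]
  define z0 where "z0 = snd c x"
  have "openin X (fst c)" using ch by (simp add: is_chart_def)
  then obtain r where r: "r > 0" "ball z0 r \<subseteq> snd c ` fst c"
    using chart_ball[OF ch c(2) _ c(2)] unfolding z0_def by (metis inf.idem)
  have ev: "\<forall>\<^sub>F j in sequentially. \<phi> (ray_parameter j) \<in> fst c \<and> cmod (snd c (\<phi> (ray_parameter j)) - z0) < e"
    if "e > 0" for e
  proof -
    define V where "V = {y \<in> fst c. snd c y \<in> ball z0 e}"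
    have "openin X V" unfolding V_def by (rule chart_open_preimage[OF ch]) simp
    moreover have "x \<in> V" using c that by (simp add: V_def z0_def)
    ultimately have "\<forall>\<^sub>F j in sequentially. \<phi> (ray_parameter j) \<in> V"
      using lim by (simp add: limitin_def)
    then show ?thesis by eventually_elim (simp add: V_def dist_norm norm_minus_commute)
  qed
  have in_ball: "of_real t * a \<in> ball 0 R" if "0 \<le> t" "t < 1" for t
    using that a R by (simp add: norm_mult)
  have in_S: "\<phi> t \<in> S" if "0 \<le> t" "t < 1" for t
    using \<Phi> in_ball[OF that] by (auto simp: local_isometry_def \<phi>_def)
  define C where "C = R / \<kappa>"
  have "min r \<rho> > 0" using r \<rho> by simp
  then obtain i where i: "\<phi> (ray_parameter i) \<in> fst c" "cmod (snd c (\<phi> (ray_parameter i)) - z0) < min r \<rho>"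
    using eventually_happens'[OF sequentially_bot ev] by blast
  define t0 where "t0 = ray_parameter i"
  have t0: "0 \<le> t0" "t0 < 1" unfolding t0_def by (rule ray_parameter_bounds)+
  define \<rho>0 where "\<rho>0 = cmod (snd c (\<phi> t0) - z0)"
  have "\<phi> t0 \<noteq> x" using in_S[OF t0] x by blast
  then have "snd c (\<phi> t0) \<noteq> z0"
    using chart_inj[OF ch] i(1) c(2) unfolding z0_def t0_def by (auto dest: inj_onD)
  then have \<rho>0: "\<rho>0 > 0" "\<rho>0 < r" "\<rho>0 < \<rho>" using i(2) by (auto simp: \<rho>0_def t0_def)
  have "\<rho>0 * exp (- C) > 0" using \<rho>0 by simp
  have "\<forall>\<^sub>F j in sequentially. ray_parameter j > t0"
    using ray_parameter_tendsto t0(2) by (rule order_tendstoD(1))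
  then have "\<forall>\<^sub>F j in sequentially. ray_parameter j > t0 \<and> \<phi> (ray_parameter j) \<in> fst c \<and>
      cmod (snd c (\<phi> (ray_parameter j)) - z0) < \<rho>0 * exp (- C)"
    using ev[OF \<open>\<rho>0 * exp (- C) > 0\<close>] by eventually_elim simp
  then obtain j where j: "ray_parameter j > t0" "\<phi> (ray_parameter j) \<in> fst c"
      "cmod (snd c (\<phi> (ray_parameter j)) - z0) < \<rho>0 * exp (- C)"
    using eventually_happens'[OF sequentially_bot] by blast
  define t1 where "t1 = ray_parameter j"
  have t1: "t0 < t1" "t1 < 1" using j(1) ray_parameter_bounds(2) by (auto simp: t1_def)
  have C: "C > 0" using R \<kappa> by (simp add: C_def)
  have cont: "continuous_map (top_of_set {t0..t1}) X \<phi>"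
  proof -
    have "continuous_map (top_of_set {t0..t1}) (top_of_set (ball 0 R)) (\<lambda>t. of_real t * a)"
      using in_ball t0 t1 by (auto simp: continuous_map_in_subtopology intro!: continuous_intros)
    moreover have "continuous_map (top_of_set (ball 0 R)) X \<Phi>"
      using \<Phi> unfolding local_isometry_def by blast
    ultimately show ?thesis
      unfolding \<phi>_def using continuous_map_compose[unfolded o_def] by blast
  qed
  have "cball z0 \<rho>0 \<subseteq> snd c ` fst c" using r \<rho>0 by (auto simp: subset_iff)
  then obtain t where t: "t0 \<le> t" "t \<le> t1" "cmod (snd c (\<phi> t) - z0) = \<rho>0"
    "\<And>s. t \<le> s \<Longrightarrow> s \<le> t1 \<Longrightarrow> \<phi> s \<in> fst c \<and> cmod (snd c (\<phi> s) - z0) \<le> \<rho>0"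
  proof (rule last_exit_from_chart_disc[OF Hausdorff ch _ cont])
    show "cmod (snd c (\<phi> t1) - z0) < \<rho>0"
    proof -
      have "\<rho>0 * exp (- C) \<le> \<rho>0 * 1" using \<rho>0 C by (intro mult_left_mono) auto
      then show ?thesis using j(3) by (simp add: t1_def)
    qed
    show "\<phi> t1 \<in> fst c" using j(2) by (simp add: t1_def)
  qed (use t1 in \<open>auto simp: \<rho>0_def\<close>)
  \<comment> \<open>the coordinate distance to \<open>x\<close> decays at most at the exponential rate \<open>C\<close>\<close>
  define E where "E = (\<lambda>s. (cmod (snd c (\<phi> s) - z0))\<^sup>2 * exp (2 * C * s))"
  have "E t \<le> E t1"
  proof (rule DERIV_nonneg_imp_nondecreasing[OF t(2)])
    fix s assume s: "t \<le> s" "s \<le> t1"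
    then have s01: "0 \<le> s" "s < 1" using t t0 t1 by auto
    have sc: "\<phi> s \<in> fst c" "cmod (snd c (\<phi> s) - z0) \<le> \<rho>" using t(4)[OF s] \<rho>0 by auto
    define D where "D = a * deriv (snd c \<circ> \<Phi>) (of_real s * a)"
    have "((\<lambda>t. of_real t * a) has_vector_derivative a) (at s)"
      by (auto intro!: derivative_eq_intros simp: has_vector_derivative_def scaleR_conv_of_real)
    from ray_derivative[OF \<Phi> open_ball in_ball[OF s01] this c(1)] sc(1)
    have D: "(snd c \<circ> \<phi> has_vector_derivative D) (at s)" by (simp add: \<phi>_def D_def)
    define w where "w = snd c (\<phi> s) - z0"
    have "cmod (deriv (snd c \<circ> \<Phi>) (of_real s * a)) * \<sigma> c (\<phi> s) = 1"
      using local_isometry_deriv(2)[OF \<Phi> open_ball in_ball[OF s01] c(1)] sc(1) by (simp add: \<phi>_def)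
    then have nD: "cmod D * \<sigma> c (\<phi> s) = R" using a by (simp add: D_def norm_mult)
    have "cmod D * \<kappa> \<le> cmod D * (\<sigma> c (\<phi> s) * cmod w)"
      using sing[OF sc(1) in_S[OF s01]] sc(2) by (intro mult_left_mono) (auto simp: w_def z0_def)
    also have "\<dots> = R * cmod w" using nD by (simp add: mult.assoc)
    finally have Dle: "cmod D \<le> C * cmod w" using \<kappa> by (simp add: C_def field_simps)
    have "((\<lambda>s. snd c (\<phi> s) - z0) has_vector_derivative D - 0) (at s)"
      using D unfolding o_def by (intro has_vector_derivative_diff has_vector_derivative_const)
    then have hd: "((\<lambda>s. snd c (\<phi> s) - z0) has_derivative (\<lambda>h. h *\<^sub>R D)) (at s)"
      by (simp add: has_vector_derivative_def)
    have "((\<lambda>s. (snd c (\<phi> s) - z0) \<bullet> (snd c (\<phi> s) - z0)) has_real_derivative w \<bullet> D + D \<bullet> w) (at s)"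
      unfolding has_field_derivative_def
      by (rule has_derivative_eq_rhs[OF has_derivative_inner[OF hd hd]]) (auto simp: w_def algebra_simps)
    then have "((\<lambda>s. (cmod (snd c (\<phi> s) - z0))\<^sup>2) has_real_derivative 2 * (w \<bullet> D)) (at s)"
      by (simp add: power2_norm_eq_inner inner_commute)
    then have "(E has_real_derivative 2 * (w \<bullet> D) * exp (2 * C * s) + (exp (2 * C * s) * (2 * C)) * (cmod w)\<^sup>2) (at s)"
      unfolding E_def w_def by (rule DERIV_mult) (auto intro!: derivative_eq_intros)
    moreover have "0 \<le> 2 * (w \<bullet> D) * exp (2 * C * s) + (exp (2 * C * s) * (2 * C)) * (cmod w)\<^sup>2"
    proof -
      have "\<bar>w \<bullet> D\<bar> \<le> cmod w * cmod D" by (rule Cauchy_Schwarz_ineq2)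
      also have "\<dots> \<le> cmod w * (C * cmod w)" using Dle by (intro mult_left_mono) auto
      finally have "0 \<le> w \<bullet> D + C * (cmod w)\<^sup>2" by (simp add: power2_eq_square algebra_simps)
      then have "0 \<le> (2 * exp (2 * C * s)) * (w \<bullet> D + C * (cmod w)\<^sup>2)" by simp
      then show ?thesis by (simp add: algebra_simps)
    qed
    ultimately show "\<exists>y. (E has_real_derivative y) (at s) \<and> 0 \<le> y" by blast
  qed
  moreover have "E t1 < E t"
  proof -
    have "(cmod (snd c (\<phi> t1) - z0))\<^sup>2 < (\<rho>0 * exp (- C))\<^sup>2"
      using j(3) by (intro power_strict_mono) (auto simp: t1_def)
    then have "E t1 < (\<rho>0 * exp (- C))\<^sup>2 * exp (2 * C * t1)"
      unfolding E_def by (intro mult_strict_right_mono) auto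
    also have "\<dots> = \<rho>0\<^sup>2 * exp (2 * C * (t1 - 1))"
      by (simp add: power2_eq_square mult_exp_exp algebra_simps)
    also have "\<dots> \<le> \<rho>0\<^sup>2 * exp (2 * C * t)"
    proof -
      have "C * (t1 - 1) \<le> C * t" using C t1 t(1) t0 by (intro mult_left_mono) auto
      then show ?thesis by (intro mult_left_mono) auto
    qed
    also have "\<dots> = E t" using t(3) by (simp add: E_def)
    finally show ?thesis .
  qed
  ultimately show False by simp
qed

end

section \<open>Holomorphic functions on a Riemann surface\<close>

context riemann_surface
begin

definition holomorphic_function :: "('a \<Rightarrow> complex) \<Rightarrow> bool" where
  "holomorphic_function f \<longleftrightarrow> (\<forall>c\<in>\<A>. (f \<circ> chart_inv c) holomorphic_on snd c ` fst c)"

text \<open>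
  The coefficient of the differential of \<open>f\<close>: as a function of the chart it transforms like a 1-form.
\<close>

definition chart_deriv :: "('a \<Rightarrow> complex) \<Rightarrow> 'a chart \<Rightarrow> 'a \<Rightarrow> complex" where
  "chart_deriv f c p = deriv (f \<circ> chart_inv c) (snd c p)"

lemma open_chart_image: "c \<in> \<A> \<Longrightarrow> open (snd c ` fst c)"
  using charts[of c] by (simp add: is_chart_def)

lemma open_chart_domain: "c \<in> \<A> \<Longrightarrow> openin X (fst c)"
  using charts[of c] by (simp add: is_chart_def)

lemma holomorphic_function_has_chart_deriv:
  assumes "holomorphic_function f" "c \<in> \<A>" "p \<in> fst c"
  shows "(f \<circ> chart_inv c has_field_derivative chart_deriv f c p) (at (snd c p))"
  unfolding chart_deriv_def
  using assms holomorphic_derivI[OF _ open_chart_image[OF assms(2)]] by (auto simp: holomorphic_function_def)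

lemma chart_deriv_transform:
  assumes f: "holomorphic_function f" and c: "c \<in> \<A>" "p \<in> fst c" and d: "d \<in> \<A>" "p \<in> fst d"
  shows "chart_deriv f c p = chart_deriv f d p * transition_deriv c d p"
proof -
  note ch = charts[OF c(1)] and dh = charts[OF d(1)]
  have "(f \<circ> chart_inv d has_field_derivative chart_deriv f d p) (at ((snd d \<circ> chart_inv c) (snd c p)))"
    using holomorphic_function_has_chart_deriv[OF f d] chart_inv_chart[OF ch c(2)] by simp
  from DERIV_chain2[OF this transition_has_derivative[OF c(1) d(1) c(2) d(2)]]
  have D: "((\<lambda>z. (f \<circ> chart_inv d) ((snd d \<circ> chart_inv c) z)) has_field_derivative
      chart_deriv f d p * transition_deriv c d p) (at (snd c p))" .
  have "open (snd c ` (fst c \<inter> fst d))"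
    by (intro chart_open_image[OF ch] openin_Int open_chart_domain c(1) d(1)) auto
  then have "(f \<circ> chart_inv c has_field_derivative chart_deriv f d p * transition_deriv c d p) (at (snd c p))"
  proof (rule has_field_derivative_transform_within_open[OF D])
    fix z assume "z \<in> snd c ` (fst c \<inter> fst d)"
    then obtain y where "y \<in> fst c" "y \<in> fst d" "z = snd c y" by blast
    then show "(f \<circ> chart_inv d) ((snd d \<circ> chart_inv c) z) = (f \<circ> chart_inv c) z"
      by (simp add: chart_inv_chart[OF ch] chart_inv_chart[OF dh])
  qed (use c d in auto)
  then show ?thesis unfolding chart_deriv_def[of f c] by (rule DERIV_imp_deriv)
qed

lemma chart_ball_at:
  assumes "c \<in> \<A>" "p \<in> fst c" "openin X V" "p \<in> V"
  obtains r where "0 < r" "ball (snd c p) r \<subseteq> snd c ` (fst c \<inter> V)"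
    "openin X {q \<in> fst c. snd c q \<in> ball (snd c p) r}" "{q \<in> fst c. snd c q \<in> ball (snd c p) r} \<subseteq> V"
proof -
  note ch = charts[OF assms(1)]
  obtain r where r: "0 < r" "ball (snd c p) r \<subseteq> snd c ` (fst c \<inter> V)"
    using chart_ball[OF ch assms(2-4)] by blast
  moreover have "q \<in> V" if q: "q \<in> fst c" "snd c q \<in> ball (snd c p) r" for q
  proof -
    obtain q' where "q' \<in> fst c" "q' \<in> V" "snd c q = snd c q'" using subsetD[OF r(2) q(2)] by blast
    then show ?thesis using chart_inj[OF ch] q(1) by (auto dest: inj_onD)
  qed
  ultimately show thesis
    using chart_open_preimage[OF ch open_ball] by (intro that[of r]) auto
qed

text \<open>
  Identity theorem: the set of points near which \<open>f\<close> is constant is open, and it is closed by analytic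
  continuation in a coordinate disc.
\<close>

lemma holomorphic_function_identity:
  assumes f: "holomorphic_function f" and V: "openin X V" "V \<noteq> {}"
    and zero: "\<And>p c. p \<in> V \<Longrightarrow> c \<in> \<A> \<Longrightarrow> p \<in> fst c \<Longrightarrow> chart_deriv f c p = 0"
  shows "f constant_on topspace X"
proof -
  define Z where "Z = {p \<in> topspace X. \<exists>W. openin X W \<and> p \<in> W \<and> f constant_on W}"
  have openZ: "openin X Z"
  proof (subst openin_subopen, intro ballI)
    fix p assume "p \<in> Z"
    then obtain W where W: "openin X W" "p \<in> W" "f constant_on W" by (auto simp: Z_def)
    then have "W \<subseteq> Z" using openin_subset[OF W(1)] unfolding Z_def by blast
    then show "\<exists>T. openin X T \<and> p \<in> T \<and> T \<subseteq> Z" using W by blast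
  qed
  have in_Z: "p \<in> Z" if c: "c \<in> \<A>" "p \<in> fst c" and r: "0 < r" "ball (snd c p) r \<subseteq> snd c ` fst c"
      and const: "(f \<circ> chart_inv c) constant_on ball (snd c p) r" for p c r
  proof -
    note ch = charts[OF c(1)]
    let ?N = "{q \<in> fst c. snd c q \<in> ball (snd c p) r}"
    obtain k where k: "\<And>z. z \<in> ball (snd c p) r \<Longrightarrow> (f \<circ> chart_inv c) z = k"
      using const unfolding constant_on_def by blast
    have "f q = k" if "q \<in> ?N" for q
      using k[of "snd c q"] that chart_inv_chart[OF ch, of q] by simp
    then have "f constant_on ?N" unfolding constant_on_def by blast
    moreover have "openin X ?N" by (rule chart_open_preimage[OF ch]) simp
    moreover have "p \<in> ?N" using c r by simp
    moreover have "p \<in> topspace X" using open_chart_domain[OF c(1)] c(2) openin_subset by blast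
    ultimately show ?thesis unfolding Z_def by blast
  qed
  have "openin X (topspace X - Z)"
  proof (subst openin_subopen, intro ballI)
    fix p assume p: "p \<in> topspace X - Z"
    then obtain c where c: "c \<in> \<A>" "p \<in> fst c" using cover by blast
    note ch = charts[OF c(1)]
    obtain r where r: "0 < r" "ball (snd c p) r \<subseteq> snd c ` (fst c \<inter> fst c)"
        "openin X {q \<in> fst c. snd c q \<in> ball (snd c p) r}" "{q \<in> fst c. snd c q \<in> ball (snd c p) r} \<subseteq> fst c"
      by (rule chart_ball_at[OF c open_chart_domain[OF c(1)] c(2)])
    let ?N = "{q \<in> fst c. snd c q \<in> ball (snd c p) r}"
    have hol: "(f \<circ> chart_inv c) holomorphic_on ball (snd c p) r"
      using f c(1) r(2) unfolding holomorphic_function_def by (auto intro: holomorphic_on_subset)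
    have "q \<notin> Z" if q: "q \<in> ?N" for q
    proof
      assume "q \<in> Z"
      then obtain W where W: "openin X W" "q \<in> W" "f constant_on W" by (auto simp: Z_def)
      have op: "open (snd c ` (?N \<inter> W))" by (rule chart_open_image[OF ch]) (use r(3) W in auto)
      have "(f \<circ> chart_inv c) constant_on snd c ` (?N \<inter> W)"
        using W(3) chart_inv_chart[OF ch] unfolding constant_on_def by force
      have "(f \<circ> chart_inv c) constant_on ball (snd c p) r"
      proof -
        obtain k where k: "\<And>z. z \<in> snd c ` (?N \<inter> W) \<Longrightarrow> (f \<circ> chart_inv c) z = k"
          using \<open>(f \<circ> chart_inv c) constant_on snd c ` (?N \<inter> W)\<close> unfolding constant_on_def by blast
        have "(f \<circ> chart_inv c) z = k" if z: "z \<in> ball (snd c p) r" for z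
        proof (rule analytic_continuation_open[OF op open_ball _ connected_ball _ hol, of "\<lambda>_. k"])
          show "snd c ` (?N \<inter> W) \<noteq> {}" using q W(2) by blast
        qed (use k z in auto)
        then show ?thesis unfolding constant_on_def by blast
      qed
      then have "p \<in> Z" using in_Z[OF c r(1)] r(2) by simp
      then show False using p by simp
    qed
    moreover have "?N \<subseteq> topspace X" using r(3) by (rule openin_subset)
    moreover have "p \<in> ?N" using c r by simp
    ultimately show "\<exists>T. openin X T \<and> p \<in> T \<and> T \<subseteq> topspace X - Z" using r(3) by blast
  qed
  then have "closedin X Z" by (simp add: closedin_def Z_def)
  then have "Z = {} \<or> Z = topspace X"
    using connected openZ unfolding connected_space_clopen_in by blast
  moreover have "Z \<noteq> {}"
  proof -
    obtain p where p: "p \<in> V" using V by blast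
    then have "p \<in> topspace X" using V openin_subset by blast
    then obtain c where c: "c \<in> \<A>" "p \<in> fst c" using cover by blast
    note ch = charts[OF c(1)]
    obtain r where r: "0 < r" "ball (snd c p) r \<subseteq> snd c ` (fst c \<inter> V)"
      using chart_ball[OF ch c(2) V(1) p] by blast
    have "\<exists>k. \<forall>z\<in>ball (snd c p) r. (f \<circ> chart_inv c) z = k"
    proof (rule has_field_derivative_zero_constant)
      fix z assume "z \<in> ball (snd c p) r"
      then obtain q where q: "q \<in> fst c" "q \<in> V" "z = snd c q" using r(2) by blast
      then show "(f \<circ> chart_inv c has_field_derivative 0) (at z within ball (snd c p) r)"
        using holomorphic_function_has_chart_deriv[OF f c(1) q(1)] zero[OF q(2) c(1) q(1)]
        by (simp add: has_field_derivative_at_within)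
    qed simp
    then have "p \<in> Z" using in_Z[OF c r(1)] r(2) unfolding constant_on_def by blast
    then show ?thesis by blast
  qed
  ultimately have Z: "Z = topspace X" by simp
  obtain p0 where p0: "p0 \<in> topspace X" using \<open>Z \<noteq> {}\<close> Z by blast
  have loc: "\<exists>T. openin X T \<and> p \<in> T \<and> (\<forall>q\<in>T. f q = f p)" if "p \<in> topspace X" for p
  proof -
    have "p \<in> Z" using that Z by simp
    then obtain W where "openin X W" "p \<in> W" "f constant_on W" unfolding Z_def by blast
    moreover obtain k where "\<And>q. q \<in> W \<Longrightarrow> f q = k"
      using \<open>f constant_on W\<close> unfolding constant_on_def by blast
    ultimately show ?thesis by (intro exI[of _ W]) simp
  qed
  have "openin X {p \<in> topspace X. f p = f p0}"
  proof (subst openin_subopen, intro ballI)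
    fix p assume p: "p \<in> {p \<in> topspace X. f p = f p0}"
    then obtain T where T: "openin X T" "p \<in> T" "\<forall>q\<in>T. f q = f p" using loc by blast
    have "q \<in> {p \<in> topspace X. f p = f p0}" if "q \<in> T" for q
      using bspec[OF T(3) that] subsetD[OF openin_subset[OF T(1)] that] p by simp
    then show "\<exists>T. openin X T \<and> p \<in> T \<and> T \<subseteq> {p \<in> topspace X. f p = f p0}"
      using T(1,2) by blast
  qed
  moreover have "openin X (topspace X - {p \<in> topspace X. f p = f p0})"
  proof (subst openin_subopen, intro ballI)
    fix p assume p: "p \<in> topspace X - {p \<in> topspace X. f p = f p0}"
    then obtain T where T: "openin X T" "p \<in> T" "\<forall>q\<in>T. f q = f p" using loc by blast
    have "q \<in> topspace X - {p \<in> topspace X. f p = f p0}" if "q \<in> T" for q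
      using bspec[OF T(3) that] subsetD[OF openin_subset[OF T(1)] that] p by simp
    then show "\<exists>T. openin X T \<and> p \<in> T \<and> T \<subseteq> topspace X - {p \<in> topspace X. f p = f p0}"
      using T(1,2) by blast
  qed
  then have "closedin X {p \<in> topspace X. f p = f p0}" by (simp add: closedin_def)
  ultimately have "{p \<in> topspace X. f p = f p0} = {} \<or> {p \<in> topspace X. f p = f p0} = topspace X"
    using connected unfolding connected_space_clopen_in by blast
  then show ?thesis using p0 unfolding constant_on_def by blast
qed

end

section \<open>The flat metric of a family of functions that omit values\<close>

text \<open>
  The data to which the construction of the flat metric applies: \<open>\<kappa> |dz|\<close> is a flat metric on the whole surface, and
  \<open>\<nu>\<close> and \<open>\<eta>\<close> are the exponents of the construction. The lower bound for \<open>\<nu> i\<close> makes the zeros of the derivative of \<open>h i\<close>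
  points at infinity of the new flat metric.
\<close>

locale omitting_functions = riemann_surface X \<A>
  for X :: "'a topology" and \<A> :: "'a chart set" +
  fixes I :: "nat set" and h :: "nat \<Rightarrow> 'a \<Rightarrow> complex" and B :: "nat \<Rightarrow> complex set"
    and \<kappa> :: "'a chart \<Rightarrow> 'a \<Rightarrow> real" and \<nu> \<eta> :: "nat \<Rightarrow> real"
  assumes finite_I: "finite I" and I_nonempty: "I \<noteq> {}"
    and h_holomorphic: "i \<in> I \<Longrightarrow> holomorphic_function (h i)"
    and h_nonconstant: "i \<in> I \<Longrightarrow> \<not> h i constant_on topspace X"
    and B_card: "i \<in> I \<Longrightarrow> finite (B i)" "i \<in> I \<Longrightarrow> 2 \<le> card (B i)"
    and h_omits: "i \<in> I \<Longrightarrow> h i ` topspace X \<inter> B i = {}"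
    and \<kappa>_transform: "c \<in> \<A> \<Longrightarrow> d \<in> \<A> \<Longrightarrow> p \<in> fst c \<Longrightarrow> p \<in> fst d \<Longrightarrow>
      \<kappa> c p = \<kappa> d p * cmod (transition_deriv c d p)"
    and \<kappa>_flat: "c \<in> \<A> \<Longrightarrow> p \<in> fst c \<Longrightarrow>
      \<exists>r>0. \<exists>u. ball (snd c p) r \<subseteq> snd c ` fst c \<and> u holomorphic_on ball (snd c p) r \<and>
        (\<forall>z\<in>ball (snd c p) r. u z \<noteq> 0 \<and> cmod (u z) = \<kappa> c (chart_inv c z))"
    and \<eta>_bounds: "i \<in> I \<Longrightarrow> 0 < \<eta> i" "i \<in> I \<Longrightarrow> \<eta> i < 1"
    and \<nu>_sum: "sum \<nu> I < 1" and \<nu>_ge: "i \<in> I \<Longrightarrow> 1 - sum \<nu> I \<le> \<nu> i"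
begin

definition regular_set :: "'a set" where
  "regular_set = {p \<in> topspace X. \<forall>i\<in>I. \<forall>c\<in>\<A>. p \<in> fst c \<longrightarrow> chart_deriv (h i) c p \<noteq> 0}"

definition weight :: "nat \<Rightarrow> 'a \<Rightarrow> real" where
  "weight i p = (\<Prod>b\<in>B i. cmod (h i p - b) powr (1 - \<eta> i))"

definition \<epsilon> :: real where
  "\<epsilon> = 1 / (1 - sum \<nu> I)"

definition \<sigma> :: "'a chart \<Rightarrow> 'a \<Rightarrow> real" where
  "\<sigma> c p = \<kappa> c p powr \<epsilon> * (\<Prod>i\<in>I. (weight i p / cmod (chart_deriv (h i) c p)) powr (\<epsilon> * \<nu> i))"

lemma \<nu>_pos: "i \<in> I \<Longrightarrow> 0 < \<nu> i"
  using \<nu>_ge[of i] \<nu>_sum by linarith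

lemma \<epsilon>_pos: "0 < \<epsilon>" and \<epsilon>_\<nu>_ge_1: "i \<in> I \<Longrightarrow> 1 \<le> \<epsilon> * \<nu> i"
  and \<epsilon>_identity: "\<epsilon> - \<epsilon> * sum \<nu> I = 1"
  using \<nu>_sum \<nu>_ge[of i] by (auto simp: \<epsilon>_def field_simps)

lemma in_topspace: "c \<in> \<A> \<Longrightarrow> p \<in> fst c \<Longrightarrow> p \<in> topspace X"
  using open_chart_domain openin_subset by blast

lemma \<kappa>_pos:
  assumes "c \<in> \<A>" "p \<in> fst c"
  shows "0 < \<kappa> c p"
proof -
  obtain r u where "r > 0" "\<forall>z\<in>ball (snd c p) r. u z \<noteq> 0 \<and> cmod (u z) = \<kappa> c (chart_inv c z)"
    using \<kappa>_flat[OF assms] by blast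
  then have "u (snd c p) \<noteq> 0 \<and> cmod (u (snd c p)) = \<kappa> c (chart_inv c (snd c p))" by simp
  then show ?thesis
    using chart_inv_chart[OF charts[OF assms(1)] assms(2)] by (metis zero_less_norm_iff)
qed

lemma weight_pos:
  assumes "i \<in> I" "p \<in> topspace X"
  shows "0 < weight i p"
  unfolding weight_def using h_omits[OF assms(1)] assms(2) by (intro prod_pos) (auto simp: disjoint_iff)

lemma transition_deriv_nonzero:
  assumes "c \<in> \<A>" "d \<in> \<A>" "p \<in> fst c" "p \<in> fst d"
  shows "transition_deriv c d p \<noteq> 0"
  using \<kappa>_transform[OF assms] \<kappa>_pos[OF assms(1,3)] by auto

lemma regular_iff:
  assumes "c \<in> \<A>" "p \<in> fst c"
  shows "p \<in> regular_set \<longleftrightarrow> (\<forall>i\<in>I. chart_deriv (h i) c p \<noteq> 0)"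
proof
  assume nz: "\<forall>i\<in>I. chart_deriv (h i) c p \<noteq> 0"
  have "chart_deriv (h i) d p \<noteq> 0" if i: "i \<in> I" and d: "d \<in> \<A>" "p \<in> fst d" for i d
    using chart_deriv_transform[OF h_holomorphic[OF i] d assms] nz i
      transition_deriv_nonzero[OF d(1) assms(1) d(2) assms(2)] by simp
  then show "p \<in> regular_set" using in_topspace[OF assms] by (simp add: regular_set_def)
qed (use assms in \<open>auto simp: regular_set_def\<close>)

lemma chart_deriv_holomorphic:
  assumes "i \<in> I" "c \<in> \<A>"
  shows "deriv (h i \<circ> chart_inv c) holomorphic_on snd c ` fst c"
  using h_holomorphic[OF assms(1)] assms(2) open_chart_image[OF assms(2)]
  unfolding holomorphic_function_def by (intro holomorphic_deriv) blast+

lemma open_nonvanishing: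
  assumes i: "i \<in> I" and c: "c \<in> \<A>"
  shows "openin X {p \<in> fst c. chart_deriv (h i) c p \<noteq> 0}"
proof -
  have "open (snd c ` fst c \<inter> deriv (h i \<circ> chart_inv c) -` (- {0}))"
    using chart_deriv_holomorphic[OF i c] open_chart_image[OF c]
    by (intro continuous_open_preimage holomorphic_on_imp_continuous_on) auto
  from chart_open_preimage[OF charts[OF c] this] show ?thesis
    by (rule back_subst[of "openin X"]) (auto simp: chart_deriv_def)
qed

lemma openin_regular: "openin X regular_set"
proof (subst openin_subopen, intro ballI)
  fix p assume p: "p \<in> regular_set"
  then have "p \<in> topspace X" by (simp add: regular_set_def)
  then obtain c where c: "c \<in> \<A>" "p \<in> fst c" using cover by blast
  define T where "T = fst c \<inter> (\<Inter>i\<in>I. {p \<in> fst c. chart_deriv (h i) c p \<noteq> 0})"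
  have "openin X T"
    unfolding T_def using finite_I I_nonempty open_nonvanishing[OF _ c(1)] open_chart_domain[OF c(1)]
    by (intro openin_Int openin_INT2) auto
  moreover have "T = fst c \<inter> regular_set"
    using regular_iff[OF c(1)] I_nonempty by (auto simp: T_def)
  ultimately show "\<exists>T. openin X T \<and> p \<in> T \<and> T \<subseteq> regular_set" using p c(2) by blast
qed

text \<open>
  Finitely many open dense sets have a common point; the set where a single derivative does not vanish is dense by the
  identity theorem.
\<close>

lemma regular_nonempty: "regular_set \<noteq> {}"
proof -
  have ex: "\<exists>W. openin X W \<and> W \<noteq> {} \<and> W \<subseteq> fst c \<and> (\<forall>i\<in>J. \<forall>p\<in>W. chart_deriv (h i) c p \<noteq> 0)"
    if "finite J" "J \<subseteq> I" and c: "c \<in> \<A>" "fst c \<noteq> {}" for J c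
    using that(1,2)
  proof (induction rule: finite_induct)
    case empty
    then show ?case using open_chart_domain[OF c(1)] c(2) by blast
  next
    case (insert i J)
    then obtain W where W: "openin X W" "W \<noteq> {}" "W \<subseteq> fst c" "\<forall>i\<in>J. \<forall>p\<in>W. chart_deriv (h i) c p \<noteq> 0" by auto
    have i: "i \<in> I" using insert by simp
    define W' where "W' = W \<inter> {p \<in> fst c. chart_deriv (h i) c p \<noteq> 0}"
    have "openin X W'" unfolding W'_def using W(1) open_nonvanishing[OF i c(1)] by (rule openin_Int)
    moreover have "W' \<noteq> {}"
    proof
      assume "W' = {}"
      then have zero: "chart_deriv (h i) c p = 0" if "p \<in> W" for p using that W(3) by (auto simp: W'_def)
      have "chart_deriv (h i) d p = 0" if "p \<in> W" "d \<in> \<A>" "p \<in> fst d" for p d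
        using chart_deriv_transform[OF h_holomorphic[OF i] that(2,3) c(1)] zero[OF that(1)] W(3) that(1) by auto
      then have "h i constant_on topspace X"
        by (intro holomorphic_function_identity[OF h_holomorphic[OF i] W(1,2)])
      then show False using h_nonconstant[OF i] by simp
    qed
    ultimately show ?case using W by (intro exI[of _ W']) (auto simp: W'_def)
  qed
  have "topspace X \<noteq> {}"
    using I_nonempty h_nonconstant by (auto simp: constant_on_def)
  then obtain c where c: "c \<in> \<A>" "fst c \<noteq> {}" using cover by blast
  obtain W where "openin X W" "W \<noteq> {}" "W \<subseteq> fst c" "\<forall>i\<in>I. \<forall>p\<in>W. chart_deriv (h i) c p \<noteq> 0"
    using ex[OF finite_I order.refl c] by blast
  then show ?thesis using regular_iff[OF c(1)] by blast
qed

text \<open>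
  The exponents are chosen so that \<open>\<sigma>\<close> transforms like a density of weight \<open>1\<close>: the factors contribute
  \<open>\<epsilon> - \<epsilon> * sum \<nu> I = 1\<close> powers of the transition derivative. Flatness holds because all factors are powers of moduli of
  holomorphic functions without zeros, which have logarithms on a disc.
\<close>

sublocale flat: flat_conformal_structure X \<A> regular_set \<sigma>
proof
  show "openin X regular_set" by (rule openin_regular)
next
  fix c d p assume c: "c \<in> \<A>" and d: "d \<in> \<A>" and p: "p \<in> fst c" "p \<in> fst d" "p \<in> regular_set"
  define t where "t = cmod (transition_deriv c d p)"
  have t: "t > 0" using transition_deriv_nonzero[OF c d p(1,2)] by (simp add: t_def)
  have "(weight i p / cmod (chart_deriv (h i) c p)) powr (\<epsilon> * \<nu> i)
      = (weight i p / cmod (chart_deriv (h i) d p)) powr (\<epsilon> * \<nu> i) * t powr (- (\<epsilon> * \<nu> i))" if i: "i \<in> I" for i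
  proof -
    have "chart_deriv (h i) d p \<noteq> 0" using p d i by (simp add: regular_set_def)
    moreover have "weight i p > 0" using weight_pos[OF i in_topspace[OF c p(1)]] .
    ultimately show ?thesis
      using chart_deriv_transform[OF h_holomorphic[OF i] c p(1) d p(2)] t
      by (simp add: norm_mult t_def powr_divide powr_mult powr_minus divide_simps)
  qed
  then have "\<sigma> c p = (\<kappa> d p * t) powr \<epsilon> * (\<Prod>i\<in>I. (weight i p / cmod (chart_deriv (h i) d p)) powr (\<epsilon> * \<nu> i) * t powr (- (\<epsilon> * \<nu> i)))"
    using \<kappa>_transform[OF c d p(1,2)] by (simp add: \<sigma>_def t_def)
  also have "\<dots> = \<sigma> d p * (t powr \<epsilon> * (\<Prod>i\<in>I. t powr (- (\<epsilon> * \<nu> i))))"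
    unfolding powr_mult prod.distrib by (simp add: \<sigma>_def)
  also have "(\<Prod>i\<in>I. t powr (- (\<epsilon> * \<nu> i))) = t powr (- (\<epsilon> * sum \<nu> I))"
    using t by (simp add: sum_distrib_left flip: powr_sum sum_negf)
  also have "t powr \<epsilon> * t powr (- (\<epsilon> * sum \<nu> I)) = t"
    using t \<epsilon>_identity by (simp flip: powr_add)
  finally show "\<sigma> c p = \<sigma> d p * cmod (transition_deriv c d p)" by (simp add: t_def)
next
  fix c p assume c: "c \<in> \<A>" and p: "p \<in> fst c" "p \<in> regular_set"
  note ch = charts[OF c]
  obtain r1 u where r1: "0 < r1" "u holomorphic_on ball (snd c p) r1"
      "\<And>z. z \<in> ball (snd c p) r1 \<Longrightarrow> u z \<noteq> 0 \<and> cmod (u z) = \<kappa> c (chart_inv c z)"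
    using \<kappa>_flat[OF c p(1)] by blast
  obtain r2 where r2: "0 < r2" "ball (snd c p) r2 \<subseteq> snd c ` (fst c \<inter> regular_set)"
    using chart_ball[OF ch p(1) openin_regular p(2)] by blast
  define r where "r = min r1 r2"
  define D where "D = ball (snd c p) r"
  have D: "D \<subseteq> ball (snd c p) r1" "D \<subseteq> snd c ` (fst c \<inter> regular_set)"
    using r2 by (auto simp: D_def r_def)
  have contr: "contractible D" unfolding D_def by (simp add: convex_imp_contractible)
  have log: "\<exists>l. l holomorphic_on D \<and> (\<forall>z\<in>D. f z = exp (l z))"
    if "f holomorphic_on D" "\<And>z. z \<in> D \<Longrightarrow> f z \<noteq> 0" for f :: "complex \<Rightarrow> complex"
    using contractible_imp_holomorphic_log[OF that(1) contr that(2)] by metis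
  have D_chart: "D \<subseteq> snd c ` fst c" using D(2) by blast
  have h_hol: "(h i \<circ> chart_inv c) holomorphic_on D" "deriv (h i \<circ> chart_inv c) holomorphic_on D" if "i \<in> I" for i
  proof -
    have "(h i \<circ> chart_inv c) holomorphic_on snd c ` fst c"
      using h_holomorphic[OF that] c unfolding holomorphic_function_def by blast
    then show "(h i \<circ> chart_inv c) holomorphic_on D" using D_chart by (rule holomorphic_on_subset)
    show "deriv (h i \<circ> chart_inv c) holomorphic_on D"
      using chart_deriv_holomorphic[OF that c] D_chart by (rule holomorphic_on_subset)
  qed
  have rep: "\<exists>q. q \<in> fst c \<and> q \<in> regular_set \<and> z = snd c q \<and> chart_inv c z = q" if "z \<in> D" for z
    using that D(2) chart_inv_chart[OF ch] by blast
  have "u holomorphic_on D" using r1(2) D(1) by (rule holomorphic_on_subset)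
  then obtain lu where lu: "lu holomorphic_on D" "\<And>z. z \<in> D \<Longrightarrow> u z = exp (lu z)"
    using log[of u] r1(3) D(1) by blast
  have "\<forall>i\<in>I. \<exists>l. l holomorphic_on D \<and> (\<forall>z\<in>D. deriv (h i \<circ> chart_inv c) z = exp (l z))"
  proof
    fix i assume i: "i \<in> I"
    have "deriv (h i \<circ> chart_inv c) z \<noteq> 0" if z: "z \<in> D" for z
      using rep[OF z] regular_iff[OF c] i unfolding chart_deriv_def by blast
    then show "\<exists>l. l holomorphic_on D \<and> (\<forall>z\<in>D. deriv (h i \<circ> chart_inv c) z = exp (l z))"
      using log h_hol(2)[OF i] by blast
  qed
  then obtain ld where ld: "\<And>i. i \<in> I \<Longrightarrow> ld i holomorphic_on D"
      "\<And>i z. i \<in> I \<Longrightarrow> z \<in> D \<Longrightarrow> deriv (h i \<circ> chart_inv c) z = exp (ld i z)"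
    by metis
  have "\<forall>i\<in>I. \<forall>b\<in>B i. \<exists>l. l holomorphic_on D \<and> (\<forall>z\<in>D. h i (chart_inv c z) - b = exp (l z))"
  proof (intro ballI)
    fix i b assume i: "i \<in> I" and b: "b \<in> B i"
    have "h i (chart_inv c z) - b \<noteq> 0" if z: "z \<in> D" for z
      using rep[OF z] h_omits[OF i] b in_topspace[OF c] by (auto simp: disjoint_iff)
    moreover have "(\<lambda>z. h i (chart_inv c z) - b) holomorphic_on D"
      using h_hol(1)[OF i] by (auto intro!: holomorphic_intros simp: o_def)
    ultimately show "\<exists>l. l holomorphic_on D \<and> (\<forall>z\<in>D. h i (chart_inv c z) - b = exp (l z))"
      using log by blast
  qed
  then obtain lb where lb: "\<And>i b. i \<in> I \<Longrightarrow> b \<in> B i \<Longrightarrow> lb i b holomorphic_on D"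
      "\<And>i b z. i \<in> I \<Longrightarrow> b \<in> B i \<Longrightarrow> z \<in> D \<Longrightarrow> h i (chart_inv c z) - b = exp (lb i b z)"
    by metis
  \<comment> \<open>the holomorphic function whose modulus is \<open>\<sigma>\<close>, assembled from the logarithms\<close>
  define v where "v = (\<lambda>z. exp (of_real \<epsilon> * lu z +
    (\<Sum>i\<in>I. of_real (\<epsilon> * \<nu> i) * ((\<Sum>b\<in>B i. of_real (1 - \<eta> i) * lb i b z) - ld i z))))"
  have "v holomorphic_on D"
    unfolding v_def using lu(1) ld(1) lb(1) by (intro holomorphic_intros) auto
  moreover have "v z \<noteq> 0" for z by (simp add: v_def)
  moreover have "cmod (v z) = \<sigma> c (chart_inv c z)" if z: "z \<in> D" for z
  proof -
    obtain q where q: "q \<in> fst c" "z = snd c q" "chart_inv c z = q" using rep[OF z] by blast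
    have "\<kappa> c q = exp (Re (lu z))"
      using r1(3)[of z] D(1) z lu(2)[OF z] q(3) by (auto simp: norm_exp_eq_Re)
    then have 1: "\<kappa> c q powr \<epsilon> = exp (\<epsilon> * Re (lu z))"
      by (simp add: powr_def)
    have 2: "(weight i q / cmod (chart_deriv (h i) c q)) powr (\<epsilon> * \<nu> i)
        = exp (\<epsilon> * \<nu> i * ((\<Sum>b\<in>B i. (1 - \<eta> i) * Re (lb i b z)) - Re (ld i z)))" if i: "i \<in> I" for i
    proof -
      have "cmod (h i q - b) powr (1 - \<eta> i) = exp ((1 - \<eta> i) * Re (lb i b z))" if "b \<in> B i" for b
        using lb(2)[OF i that z] q(3) by (simp add: norm_exp_eq_Re powr_def)
      then have "weight i q = exp (\<Sum>b\<in>B i. (1 - \<eta> i) * Re (lb i b z))"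
        using B_card(1)[OF i] by (simp add: weight_def exp_sum)
      moreover have "cmod (chart_deriv (h i) c q) = exp (Re (ld i z))"
        using ld(2)[OF i z] q(2) by (simp add: chart_deriv_def norm_exp_eq_Re)
      ultimately have "weight i q / cmod (chart_deriv (h i) c q)
          = exp ((\<Sum>b\<in>B i. (1 - \<eta> i) * Re (lb i b z)) - Re (ld i z))" by (simp add: exp_diff)
      then show ?thesis by (simp only: powr_def) simp
    qed
    have "\<sigma> c q = exp (\<epsilon> * Re (lu z) + (\<Sum>i\<in>I. \<epsilon> * \<nu> i * ((\<Sum>b\<in>B i. (1 - \<eta> i) * Re (lb i b z)) - Re (ld i z))))"
      unfolding \<sigma>_def 1 exp_add exp_sum[OF finite_I] using 2 by simp
    also have "\<dots> = cmod (v z)" by (simp add: v_def norm_exp_eq_Re Re_sum)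
    finally show ?thesis using q(3) by simp
  qed
  ultimately show "\<exists>r>0. \<exists>u. ball (snd c p) r \<subseteq> snd c ` (fst c \<inter> regular_set) \<and> u holomorphic_on ball (snd c p) r \<and>
        (\<forall>z\<in>ball (snd c p) r. u z \<noteq> 0 \<and> cmod (u z) = \<sigma> c (chart_inv c z))"
    using r1(1) r2(1) D(2) unfolding D_def
    by (intro exI[of _ r] conjI exI[of _ v]) (auto simp: r_def)
qed

lemma compose_has_derivative:
  assumes \<Phi>: "flat.local_isometry U \<Phi>" "open U" and z: "z \<in> U" and c: "c \<in> \<A>" "\<Phi> z \<in> fst c" and i: "i \<in> I"
  shows "(h i \<circ> \<Phi> has_field_derivative chart_deriv (h i) c (\<Phi> z) * deriv (snd c \<circ> \<Phi>) z) (at z)"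
proof -
  have "(h i \<circ> chart_inv c has_field_derivative chart_deriv (h i) c (\<Phi> z)) (at ((snd c \<circ> \<Phi>) z))"
    using holomorphic_function_has_chart_deriv[OF h_holomorphic[OF i] c] by simp
  from DERIV_chain2[OF this flat.local_isometry_deriv(1)[OF \<Phi> z c]]
  have D: "((\<lambda>w. (h i \<circ> chart_inv c) ((snd c \<circ> \<Phi>) w)) has_field_derivative
      chart_deriv (h i) c (\<Phi> z) * deriv (snd c \<circ> \<Phi>) z) (at z)" .
  show ?thesis
  proof (rule has_field_derivative_transform_within_open[OF D flat.local_isometry_holomorphic(1)[OF \<Phi> c(1)]])
    fix w assume "w \<in> {w \<in> U. \<Phi> w \<in> fst c}"
    then show "(h i \<circ> chart_inv c) ((snd c \<circ> \<Phi>) w) = (h i \<circ> \<Phi>) w"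
      using chart_inv_chart[OF charts[OF c(1)]] by simp
  qed (use z c in auto)
qed

lemma isometry_chart:
  assumes "flat.local_isometry U \<Phi>" "z \<in> U"
  obtains c where "c \<in> \<A>" "\<Phi> z \<in> fst c"
proof -
  have "\<Phi> z \<in> regular_set" using assms by (auto simp: flat.local_isometry_def)
  then have "\<Phi> z \<in> topspace X" by (simp add: regular_set_def)
  then show thesis using cover that by blast
qed

lemma compose_holomorphic:
  assumes "flat.local_isometry U \<Phi>" "open U" "i \<in> I"
  shows "(h i \<circ> \<Phi>) holomorphic_on U"
  unfolding holomorphic_on_open[OF assms(2)]
proof
  fix z assume z: "z \<in> U"
  obtain c where c: "c \<in> \<A>" "\<Phi> z \<in> fst c" using isometry_chart[OF assms(1) z] .
  show "\<exists>f'. (h i \<circ> \<Phi> has_field_derivative f') (at z)"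
    using compose_has_derivative[OF assms(1,2) z c assms(3)] by blast
qed

lemma compose_deriv_nonzero:
  assumes \<Phi>: "flat.local_isometry U \<Phi>" "open U" and z: "z \<in> U" and i: "i \<in> I"
  shows "deriv (h i \<circ> \<Phi>) z \<noteq> 0"
proof -
  obtain c where c: "c \<in> \<A>" "\<Phi> z \<in> fst c" using isometry_chart[OF \<Phi>(1) z] .
  have "deriv (h i \<circ> \<Phi>) z = chart_deriv (h i) c (\<Phi> z) * deriv (snd c \<circ> \<Phi>) z"
    by (rule DERIV_imp_deriv[OF compose_has_derivative[OF \<Phi> z c i]])
  moreover have "\<Phi> z \<in> regular_set" using \<Phi> z by (auto simp: flat.local_isometry_def)
  then have "chart_deriv (h i) c (\<Phi> z) \<noteq> 0" using c i by (simp add: regular_set_def)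
  moreover have "deriv (snd c \<circ> \<Phi>) z \<noteq> 0"
    using flat.local_isometry_deriv(2)[OF \<Phi> z c] by auto
  ultimately show ?thesis by simp
qed

text \<open>
  In the flat coordinate \<open>\<sigma>\<close> equals \<open>1\<close>; this is the definition of \<open>\<sigma>\<close> solved for \<open>\<kappa>\<close>.
\<close>

lemma density_in_flat_coordinate:
  assumes \<Phi>: "flat.local_isometry U \<Phi>" "open U" and z: "z \<in> U" and c: "c \<in> \<A>" "\<Phi> z \<in> fst c"
  shows "\<kappa> c (\<Phi> z) * cmod (deriv (snd c \<circ> \<Phi>) z)
    = (\<Prod>i\<in>I. (cmod (deriv (h i \<circ> \<Phi>) z) / weight i (\<Phi> z)) powr \<nu> i)"
proof -
  define \<delta> where "\<delta> = cmod (deriv (snd c \<circ> \<Phi>) z)"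
  define x where "x = (\<lambda>i. weight i (\<Phi> z) / cmod (chart_deriv (h i) c (\<Phi> z)))"
  define Q where "Q = (\<Prod>i\<in>I. x i powr \<nu> i)"
  have reg: "\<Phi> z \<in> regular_set" using \<Phi> z by (auto simp: flat.local_isometry_def)
  have x: "x i > 0" if "i \<in> I" for i
    using weight_pos[OF that in_topspace[OF c]] reg c that by (auto simp: x_def regular_set_def)
  have Q: "Q > 0" unfolding Q_def by (intro prod_pos) (simp add: x order_less_imp_not_eq2)
  have \<kappa>: "\<kappa> c (\<Phi> z) > 0" by (rule \<kappa>_pos[OF c])
  have "\<delta> * \<sigma> c (\<Phi> z) = 1" unfolding \<delta>_def by (rule flat.local_isometry_deriv(2)[OF \<Phi> z c])
  moreover have "\<sigma> c (\<Phi> z) = (\<kappa> c (\<Phi> z) * Q) powr \<epsilon>"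
    unfolding \<sigma>_def powr_mult Q_def prod_powr_distrib
    by (simp add: x_def powr_powr mult.commute)
  ultimately have eq: "\<delta> * (\<kappa> c (\<Phi> z) * Q) powr \<epsilon> = 1" by simp
  then have \<delta>: "\<delta> > 0" by (metis \<delta>_def mult_zero_left norm_ge_zero order_le_less zero_neq_one)
  have "(\<kappa> c (\<Phi> z) * Q) powr \<epsilon> = 1 / \<delta>" using eq \<delta> by (simp add: field_simps)
  then have "((\<kappa> c (\<Phi> z) * Q) powr \<epsilon>) powr (1 / \<epsilon>) = (1 / \<delta>) powr (1 - sum \<nu> I)"
    by (simp add: \<epsilon>_def)
  then have "\<kappa> c (\<Phi> z) * Q = (1 / \<delta>) powr (1 - sum \<nu> I)"
    using \<epsilon>_pos \<kappa> Q by (simp add: powr_powr)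
  then have "\<kappa> c (\<Phi> z) * \<delta> = \<delta> powr sum \<nu> I / Q"
    using \<delta> Q by (simp add: powr_diff powr_divide field_simps)
  also have "\<dots> = (\<Prod>i\<in>I. \<delta> powr \<nu> i / x i powr \<nu> i)"
    using \<delta> by (simp add: Q_def prod_dividef powr_sum)
  also have "\<dots> = (\<Prod>i\<in>I. (cmod (deriv (h i \<circ> \<Phi>) z) / weight i (\<Phi> z)) powr \<nu> i)"
  proof (rule prod.cong)
    fix i assume i: "i \<in> I"
    have "deriv (h i \<circ> \<Phi>) z = chart_deriv (h i) c (\<Phi> z) * deriv (snd c \<circ> \<Phi>) z"
      by (rule DERIV_imp_deriv[OF compose_has_derivative[OF \<Phi> z c i]])
    then have "cmod (deriv (h i \<circ> \<Phi>) z) / weight i (\<Phi> z) = \<delta> / x i"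
      by (simp add: x_def \<delta>_def norm_mult)
    then show "\<delta> powr \<nu> i / x i powr \<nu> i = (cmod (deriv (h i \<circ> \<Phi>) z) / weight i (\<Phi> z)) powr \<nu> i"
      by (simp add: powr_divide)
  qed simp
  finally show ?thesis by (simp add: \<delta>_def)
qed

text \<open>
  The Landau estimate on the disc of radius \<open>R - |w|\<close> around \<open>w\<close>.
\<close>

lemma compose_deriv_bound:
  assumes i: "i \<in> I"
  obtains L where "0 < L"
    "\<And>R \<Phi> w. flat.local_isometry (ball 0 R) \<Phi> \<Longrightarrow> w \<in> ball 0 R \<Longrightarrow>
      (R - cmod w) * cmod (deriv (h i \<circ> \<Phi>) w) *
        (1 + cmod (h i (\<Phi> w))) powr (real (card (B i)) - 1 - (real (card (B i)) + 1) * \<eta> i)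
      \<le> L * weight i (\<Phi> w)"
proof -
  obtain L where L: "0 < L"
    "\<And>f z r. 0 < r \<Longrightarrow> f holomorphic_on ball z r \<Longrightarrow> f ` ball z r \<inter> B i = {} \<Longrightarrow>
       r * cmod (deriv f z) * (1 + cmod (f z)) powr (real (card (B i)) - 1 - (real (card (B i)) + 1) * \<eta> i)
         \<le> L * (\<Prod>b\<in>B i. cmod (f z - b) powr (1 - \<eta> i))"
    by (rule deriv_bound_disc_omitting_finite_set[OF \<eta>_bounds[OF i] B_card[OF i]]) blast
  show thesis
  proof (rule that[OF L(1)])
    fix R and \<Phi> :: "complex \<Rightarrow> 'a" and w :: complex
    assume \<Phi>: "flat.local_isometry (ball 0 R) \<Phi>" and w: "w \<in> ball 0 R"
    have sub: "ball w (R - cmod w) \<subseteq> ball 0 R"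
    proof
      fix y assume "y \<in> ball w (R - cmod w)"
      then show "y \<in> ball 0 R" using norm_triangle_sub[of y w] by (simp add: dist_norm norm_minus_commute)
    qed
    have "\<Phi> ` ball 0 R \<subseteq> topspace X"
    proof -
      have "\<Phi> ` ball 0 R \<subseteq> regular_set" using \<Phi> unfolding flat.local_isometry_def by blast
      then show ?thesis using openin_subset[OF openin_regular] by blast
    qed
    then have om: "(h i \<circ> \<Phi>) ` ball w (R - cmod w) \<inter> B i = {}"
      using h_omits[OF i] sub unfolding image_comp[symmetric] by blast
    have hol: "(h i \<circ> \<Phi>) holomorphic_on ball w (R - cmod w)"
      using compose_holomorphic[OF \<Phi> open_ball i] sub by (rule holomorphic_on_subset)
    have "0 < R - cmod w" using w by simp
    from L(2)[OF this hol om]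
    show "(R - cmod w) * cmod (deriv (h i \<circ> \<Phi>) w) *
        (1 + cmod (h i (\<Phi> w))) powr (real (card (B i)) - 1 - (real (card (B i)) + 1) * \<eta> i)
      \<le> L * weight i (\<Phi> w)" by (simp add: weight_def)
  qed
qed

text \<open>
  Letting the radius tend to infinity in the preceding estimate forces the derivative of \<open>h i \<circ> \<Phi>\<close> to vanish, as in
  Picard's theorem.
\<close>

lemma no_entire_isometry: "\<not> flat.local_isometry UNIV \<Phi>"
proof
  assume \<Phi>: "flat.local_isometry UNIV \<Phi>"
  obtain i where i: "i \<in> I" using I_nonempty by blast
  obtain L where L: "\<And>R \<Phi> w. flat.local_isometry (ball 0 R) \<Phi> \<Longrightarrow> w \<in> ball 0 R \<Longrightarrow>
      (R - cmod w) * cmod (deriv (h i \<circ> \<Phi>) w) *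
        (1 + cmod (h i (\<Phi> w))) powr (real (card (B i)) - 1 - (real (card (B i)) + 1) * \<eta> i)
      \<le> L * weight i (\<Phi> w)"
    by (rule compose_deriv_bound[OF i]) blast
  define K where "K = cmod (deriv (h i \<circ> \<Phi>) 0) *
        (1 + cmod (h i (\<Phi> 0))) powr (real (card (B i)) - 1 - (real (card (B i)) + 1) * \<eta> i)"
  have nz: "1 + cmod (h i (\<Phi> 0)) \<noteq> 0" using norm_ge_zero[of "h i (\<Phi> 0)"] by linarith
  have K: "K > 0"
    unfolding K_def using compose_deriv_nonzero[OF \<Phi> open_UNIV UNIV_I i] nz by (intro mult_pos_pos) auto
  have bd: "R * K \<le> L * weight i (\<Phi> 0)" if "R > 0" for R
    using L[OF flat.local_isometry_subset[OF \<Phi> open_ball subset_UNIV], of 0 R] that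
    by (simp add: K_def mult.assoc)
  define R where "R = \<bar>L * weight i (\<Phi> 0)\<bar> / K + 1"
  have "R > 0" using K by (simp add: R_def add_nonneg_pos)
  moreover have "R * K = \<bar>L * weight i (\<Phi> 0)\<bar> + K" using K by (simp add: R_def field_simps)
  ultimately show False using bd[of R] K by linarith
qed

text \<open>
  Some \<open>h\<^sub>i'\<close> vanishes at \<open>x\<close> and is therefore at most a multiple of the coordinate distance to \<open>x\<close>. Its exponent
  \<open>\<epsilon> \<nu>\<^sub>i\<close> in the denominator of \<open>\<sigma>\<close> is at least \<open>1\<close>, and all other factors are bounded below.
\<close>

lemma density_near_singular_point:
  assumes x: "x \<in> topspace X" "x \<notin> regular_set"
  obtains c \<rho> \<gamma> where "c \<in> \<A>" "x \<in> fst c" "\<rho> > 0" "\<gamma> > 0"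
    "\<And>y. y \<in> fst c \<Longrightarrow> y \<in> regular_set \<Longrightarrow> cmod (snd c y - snd c x) \<le> \<rho> \<Longrightarrow>
      \<gamma> \<le> \<sigma> c y * cmod (snd c y - snd c x)"
proof -
  obtain c where c: "c \<in> \<A>" "x \<in> fst c" using cover x(1) by blast
  note ch = charts[OF c(1)]
  define z0 where "z0 = snd c x"
  obtain i0 where i0: "i0 \<in> I" "chart_deriv (h i0) c x = 0"
    using regular_iff[OF c] x(2) by blast
  obtain r u where r: "r > 0" "ball z0 r \<subseteq> snd c ` fst c" "u holomorphic_on ball z0 r"
      "\<And>z. z \<in> ball z0 r \<Longrightarrow> u z \<noteq> 0 \<and> cmod (u z) = \<kappa> c (chart_inv c z)"
    using \<kappa>_flat[OF c] unfolding z0_def by blast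
  define \<rho> where "\<rho> = min (r / 2) 1"
  have \<rho>: "\<rho> > 0" "\<rho> \<le> 1" "cball z0 \<rho> \<subseteq> ball z0 r"
    using r(1) by (auto simp: \<rho>_def)
  define K where "K = cball z0 \<rho>"
  have K: "compact K" "K \<noteq> {}" "K \<subseteq> ball z0 r" "K \<subseteq> snd c ` fst c" "convex K"
    using \<rho> r(2) by (auto simp: K_def)
  have lower: "\<exists>m>0. \<forall>z\<in>K. m \<le> f z" if f: "continuous_on K f" "\<And>z. z \<in> K \<Longrightarrow> 0 < f z" for f :: "complex \<Rightarrow> real"
  proof -
    obtain z where "z \<in> K" "\<And>w. w \<in> K \<Longrightarrow> f z \<le> f w" using continuous_attains_inf[OF K(1,2) f(1)] by blast
    then show ?thesis using f(2) by blast
  qed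
  have upper: "\<exists>M>0. \<forall>z\<in>K. cmod (f z) \<le> M" if f: "continuous_on K f" for f :: "complex \<Rightarrow> complex"
    using compact_continuous_image[OF f K(1)] compact_imp_bounded bounded_pos by (metis image_eqI)
  have "continuous_on K (\<lambda>z. cmod (u z))"
    using r(3) K(3) by (intro continuous_on_norm holomorphic_on_imp_continuous_on) (auto intro: holomorphic_on_subset)
  moreover have "0 < cmod (u z)" if "z \<in> K" for z
    using r(4)[OF subsetD[OF K(3) that]] by (metis zero_less_norm_iff)
  ultimately obtain k0 where k0: "k0 > 0" "\<And>z. z \<in> K \<Longrightarrow> k0 \<le> cmod (u z)"
    using lower[of "\<lambda>z. cmod (u z)"] by blast
  have "\<forall>i\<in>I. \<exists>w>0. \<forall>z\<in>K. w \<le> weight i (chart_inv c z)"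
  proof
    fix i assume i: "i \<in> I"
    have "continuous_on K (h i \<circ> chart_inv c)"
      using h_holomorphic[OF i] c(1) unfolding holomorphic_function_def
      by (intro holomorphic_on_imp_continuous_on[OF holomorphic_on_subset[OF _ K(4)]]) blast
    then have ch: "continuous_on K (\<lambda>z. h i (chart_inv c z))" by (simp add: o_def)
    have top: "chart_inv c z \<in> topspace X" if "z \<in> K" for z
      using in_topspace[OF c(1) inv_into_into[of z "snd c" "fst c"]] that K(4) by blast
    have "cmod (h i (chart_inv c z) - b) \<noteq> 0" if "z \<in> K" "b \<in> B i" for z b
      using h_omits[OF i] top[OF that(1)] that(2) by (auto simp: disjoint_iff)
    then have "continuous_on K (\<lambda>z. weight i (chart_inv c z))"
      unfolding weight_def using ch
      by (intro continuous_on_prod continuous_on_powr continuous_on_norm continuous_on_diff continuous_on_const) auto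
    then show "\<exists>w>0. \<forall>z\<in>K. w \<le> weight i (chart_inv c z)"
      using weight_pos[OF i top] by (rule lower)
  qed
  then obtain w where w: "\<And>i. i \<in> I \<Longrightarrow> w i > 0" "\<And>i z. i \<in> I \<Longrightarrow> z \<in> K \<Longrightarrow> w i \<le> weight i (chart_inv c z)"
    by metis
  have "\<forall>i\<in>I. \<exists>M>0. \<forall>z\<in>K. cmod (deriv (h i \<circ> chart_inv c) z) \<le> M"
  proof
    fix i assume i: "i \<in> I"
    show "\<exists>M>0. \<forall>z\<in>K. cmod (deriv (h i \<circ> chart_inv c) z) \<le> M"
      using chart_deriv_holomorphic[OF i c(1)] K(4)
      by (intro upper holomorphic_on_imp_continuous_on) (rule holomorphic_on_subset)
  qed
  then obtain M where M: "\<And>i. i \<in> I \<Longrightarrow> M i > 0"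
      "\<And>i z. i \<in> I \<Longrightarrow> z \<in> K \<Longrightarrow> cmod (deriv (h i \<circ> chart_inv c) z) \<le> M i"
    by metis
  obtain M0 where M0: "M0 > 0" "\<And>z. z \<in> K \<Longrightarrow> cmod (deriv (h i0 \<circ> chart_inv c) z) \<le> M0 * cmod (z - z0)"
  proof -
    define f where "f = deriv (h i0 \<circ> chart_inv c)"
    have hol: "f holomorphic_on ball z0 r"
      unfolding f_def using chart_deriv_holomorphic[OF i0(1) c(1)] r(2) by (rule holomorphic_on_subset)
    have "continuous_on K (deriv f)"
      using holomorphic_on_imp_continuous_on[OF holomorphic_deriv[OF hol open_ball]] K(3) by (rule continuous_on_subset)
    then obtain m where m: "m > 0" "\<And>z. z \<in> K \<Longrightarrow> cmod (deriv f z) \<le> m" using upper by blast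
    have "cmod (f z - f z0) \<le> m * cmod (z - z0)" if z: "z \<in> K" for z
    proof (rule field_differentiable_bound[OF K(5)])
      fix y assume "y \<in> K"
      then show "(f has_field_derivative deriv f y) (at y within K)"
        using holomorphic_derivI[OF hol open_ball] K(3) by (blast intro: has_field_derivative_at_within)
    qed (use m z \<rho> in \<open>auto simp: K_def\<close>)
    moreover have "f z0 = 0" using i0(2) by (simp add: f_def chart_deriv_def z0_def)
    ultimately show ?thesis using m(1) that[of m] by (simp add: f_def)
  qed
  define A where "A = (\<lambda>i. if i = i0 then w i / M0 else w i / M i)"
  have A: "A i > 0" if "i \<in> I" for i using w(1)[OF that] M(1)[OF that] M0(1) by (auto simp: A_def)
  define \<gamma> where "\<gamma> = k0 powr \<epsilon> * (\<Prod>i\<in>I. A i powr (\<epsilon> * \<nu> i))"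
  show thesis
  proof (rule that[OF c \<rho>(1)])
    have "(\<Prod>i\<in>I. A i powr (\<epsilon> * \<nu> i)) > 0"
      by (intro prod_pos) (simp add: A order_less_imp_not_eq2)
    then show "\<gamma> > 0" using k0(1) by (simp add: \<gamma>_def)
    fix y assume y: "y \<in> fst c" "y \<in> regular_set" "cmod (snd c y - snd c x) \<le> \<rho>"
    define s where "s = cmod (snd c y - z0)"
    have yK: "snd c y \<in> K" using y(3) by (simp add: K_def z0_def dist_norm norm_minus_commute)
    have inv: "chart_inv c (snd c y) = y" by (rule chart_inv_chart[OF ch y(1)])
    have "y \<noteq> x" using y(2) x(2) by blast
    then have s: "s > 0" using chart_inj[OF ch] y(1) c(2) by (auto simp: s_def z0_def dest: inj_onD)
    have s1: "s \<le> 1" using y(3) \<rho>(2) by (simp add: s_def z0_def)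
    have factor: "A i powr (\<epsilon> * \<nu> i) * (if i = i0 then 1 / s else 1)
        \<le> (weight i y / cmod (chart_deriv (h i) c y)) powr (\<epsilon> * \<nu> i)" if i: "i \<in> I" for i
    proof -
      have e: "\<epsilon> * \<nu> i \<ge> 1" by (rule \<epsilon>_\<nu>_ge_1[OF i])
      have wy: "w i \<le> weight i y" "w i > 0" using w(2)[OF i yK] w(1)[OF i] inv by auto
      have d: "0 < cmod (chart_deriv (h i) c y)" using y c i by (auto simp: regular_set_def)
      show ?thesis
      proof (cases "i = i0")
        case True
        have "cmod (chart_deriv (h i) c y) \<le> M0 * s"
          using M0(2)[OF yK] True by (simp add: chart_deriv_def s_def)
        then have "A i / s \<le> weight i y / cmod (chart_deriv (h i) c y)"
          using wy d True M0 s by (simp add: A_def) (intro frac_le; simp)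
        then have "(A i / s) powr (\<epsilon> * \<nu> i) \<le> (weight i y / cmod (chart_deriv (h i) c y)) powr (\<epsilon> * \<nu> i)"
          using A[OF i] s e by (intro powr_mono2) auto
        moreover have "A i powr (\<epsilon> * \<nu> i) * (1 / s) \<le> (A i / s) powr (\<epsilon> * \<nu> i)"
        proof -
          have "s powr (\<epsilon> * \<nu> i) \<le> s powr 1" using e s s1 by (intro powr_mono') auto
          then have "1 / s \<le> 1 / s powr (\<epsilon> * \<nu> i)" using s by (intro divide_left_mono) auto
          then have "A i powr (\<epsilon> * \<nu> i) * (1 / s) \<le> A i powr (\<epsilon> * \<nu> i) * (1 / s powr (\<epsilon> * \<nu> i))"
            by (intro mult_left_mono) auto
          then show ?thesis by (simp add: powr_divide)
        qed
        ultimately show ?thesis using True by simp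
      next
        case False
        have "cmod (chart_deriv (h i) c y) \<le> M i"
          using M(2)[OF i yK] by (simp add: chart_deriv_def)
        then have "A i \<le> weight i y / cmod (chart_deriv (h i) c y)"
          using wy d False M(1)[OF i] by (simp add: A_def) (intro frac_le; simp)
        then have "A i powr (\<epsilon> * \<nu> i) \<le> (weight i y / cmod (chart_deriv (h i) c y)) powr (\<epsilon> * \<nu> i)"
          using A[OF i] e by (intro powr_mono2) auto
        then show ?thesis using False by simp
      qed
    qed
    have "(\<Prod>i\<in>I. A i powr (\<epsilon> * \<nu> i)) * (1 / s) = (\<Prod>i\<in>I. A i powr (\<epsilon> * \<nu> i) * (if i = i0 then 1 / s else 1))"
      using finite_I i0(1) by (simp add: prod.distrib)
    also have "\<dots> \<le> (\<Prod>i\<in>I. (weight i y / cmod (chart_deriv (h i) c y)) powr (\<epsilon> * \<nu> i))"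
      using factor s by (intro prod_mono) auto
    finally have 1: "(\<Prod>i\<in>I. A i powr (\<epsilon> * \<nu> i)) * (1 / s) \<le> (\<Prod>i\<in>I. (weight i y / cmod (chart_deriv (h i) c y)) powr (\<epsilon> * \<nu> i))" .
    have "k0 \<le> \<kappa> c y" using k0(2)[OF yK] r(4)[of "snd c y"] yK K(3) inv by auto
    then have 2: "k0 powr \<epsilon> \<le> \<kappa> c y powr \<epsilon>" using k0(1) \<epsilon>_pos by (intro powr_mono2) auto
    have "k0 powr \<epsilon> * ((\<Prod>i\<in>I. A i powr (\<epsilon> * \<nu> i)) * (1 / s)) \<le> \<sigma> c y"
      unfolding \<sigma>_def
    proof (rule mult_mono[OF 2 1 powr_ge_zero])
      show "0 \<le> (\<Prod>i\<in>I. A i powr (\<epsilon> * \<nu> i)) * (1 / s)"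
        using s by (intro mult_nonneg_nonneg prod_nonneg) auto
    qed
    then have "\<gamma> / s \<le> \<sigma> c y" by (simp add: \<gamma>_def)
    then show "\<gamma> \<le> \<sigma> c y * cmod (snd c y - snd c x)" using s by (simp add: field_simps s_def z0_def)
  qed
qed

text \<open>
  The heart of the matter: the hypothesis on \<open>m\<close> makes the powers of \<open>1 + |h\<^sub>i|\<close> in the metric exactly those that the
  Landau estimate controls, so that the metric is at most \<open>C |dw| / (R - |w|)\<^bsup>\<nu>\<^esup>\<close> on the maximal disc.
\<close>

theorem not_complete:
  assumes ds2: "conformal_metric \<A> ds2" and C: "C > 0"
    and bound: "\<And>c p. c \<in> \<A> \<Longrightarrow> p \<in> fst c \<Longrightarrow>
      ds2 c p \<le> C * (\<kappa> c p)\<^sup>2 * (\<Prod>i\<in>I. (1 + cmod (h i p)) ^ (2 * m i))"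
    and m: "\<And>i. i \<in> I \<Longrightarrow> real (m i) = \<nu> i * (real (card (B i)) - 1 - (real (card (B i)) + 1) * \<eta> i)"
  shows "\<not> complete_metric X \<A> ds2"
proof
  assume complete: "complete_metric X \<A> ds2"
  define e where "e = (\<lambda>i. real (card (B i)) - 1 - (real (card (B i)) + 1) * \<eta> i)"
  have "\<forall>i\<in>I. \<exists>L>0. \<forall>R \<Phi> w. flat.local_isometry (ball 0 R) \<Phi> \<longrightarrow> w \<in> ball 0 R \<longrightarrow>
      (R - cmod w) * cmod (deriv (h i \<circ> \<Phi>) w) * (1 + cmod (h i (\<Phi> w))) powr e i \<le> L * weight i (\<Phi> w)"
  proof
    fix i assume i: "i \<in> I"
    show "\<exists>L>0. \<forall>R \<Phi> w. flat.local_isometry (ball 0 R) \<Phi> \<longrightarrow> w \<in> ball 0 R \<longrightarrow>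
      (R - cmod w) * cmod (deriv (h i \<circ> \<Phi>) w) * (1 + cmod (h i (\<Phi> w))) powr e i \<le> L * weight i (\<Phi> w)"
      unfolding e_def by (rule compose_deriv_bound[OF i]) blast
  qed
  then obtain L where L: "\<And>i. i \<in> I \<Longrightarrow> L i > 0"
    "\<And>i R \<Phi> w. i \<in> I \<Longrightarrow> flat.local_isometry (ball 0 R) \<Phi> \<Longrightarrow> w \<in> ball 0 R \<Longrightarrow>
      (R - cmod w) * cmod (deriv (h i \<circ> \<Phi>) w) * (1 + cmod (h i (\<Phi> w))) powr e i \<le> L i * weight i (\<Phi> w)"
    by metis
  obtain p where "p \<in> regular_set" using regular_nonempty by blast
  from flat.maximal_disc[OF this] no_entire_isometry
  obtain R \<Phi> a where R: "R > 0" and \<Phi>: "flat.local_isometry (ball 0 R) \<Phi>" and a: "cmod a = R"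
    and bdry: "\<And>z x. range z \<subseteq> ball 0 R \<Longrightarrow> z \<longlonglongrightarrow> a \<Longrightarrow> limitin X (\<Phi> \<circ> z) x sequentially \<Longrightarrow> x \<notin> regular_set"
    by blast
  define C' where "C' = sqrt C * (\<Prod>i\<in>I. L i powr \<nu> i)"
  have prodL: "(\<Prod>i\<in>I. L i powr \<nu> i) > 0" by (intro prod_pos) (simp add: L(1) order_less_imp_not_eq2)
  then have C': "C' > 0" using C by (simp add: C'_def)
  have \<nu>01: "0 \<le> sum \<nu> I" "sum \<nu> I < 1" using \<nu>_pos \<nu>_sum by (auto intro: sum_nonneg less_imp_le)
  have est: "sqrt (ds2 c (\<Phi> w)) * cmod (deriv (snd c \<circ> \<Phi>) w) \<le> C' / (R - cmod w) powr sum \<nu> I"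
    if w: "w \<in> ball 0 R" and c: "c \<in> \<A>" "\<Phi> w \<in> fst c" for w c
  proof -
    define y where "y = (\<lambda>i. 1 + cmod (h i (\<Phi> w)))"
    have y: "y i > 0" for i by (simp add: y_def add_pos_nonneg)
    have Rw: "R - cmod w > 0" using w by simp
    have sq: "(\<Prod>i\<in>I. (1 + cmod (h i (\<Phi> w))) ^ (2 * m i)) = (\<Prod>i\<in>I. y i ^ m i)\<^sup>2"
      unfolding prod_power_distrib y_def by (intro prod.cong refl) (simp add: mult.commute flip: power_mult)
    have "ds2 c (\<Phi> w) \<le> C * (\<kappa> c (\<Phi> w))\<^sup>2 * (\<Prod>i\<in>I. y i ^ m i)\<^sup>2"
      using bound[OF c] unfolding sq .
    then have "sqrt (ds2 c (\<Phi> w)) \<le> sqrt (C * (\<kappa> c (\<Phi> w))\<^sup>2 * (\<Prod>i\<in>I. y i ^ m i)\<^sup>2)" by simp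
    also have "\<dots> = sqrt C * \<kappa> c (\<Phi> w) * (\<Prod>i\<in>I. y i ^ m i)"
      using \<kappa>_pos[OF c] y by (simp add: real_sqrt_mult prod_nonneg less_imp_le)
    finally have "sqrt (ds2 c (\<Phi> w)) * cmod (deriv (snd c \<circ> \<Phi>) w)
        \<le> sqrt C * \<kappa> c (\<Phi> w) * (\<Prod>i\<in>I. y i ^ m i) * cmod (deriv (snd c \<circ> \<Phi>) w)"
      by (rule mult_right_mono) simp
    also have "\<dots> = sqrt C * ((\<kappa> c (\<Phi> w) * cmod (deriv (snd c \<circ> \<Phi>) w)) * (\<Prod>i\<in>I. y i ^ m i))"
      by (simp add: mult_ac)
    also have "\<dots> = sqrt C * (\<Prod>i\<in>I. (cmod (deriv (h i \<circ> \<Phi>) w) / weight i (\<Phi> w)) powr \<nu> i * y i ^ m i)"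
      unfolding density_in_flat_coordinate[OF \<Phi> open_ball w c] by (simp add: prod.distrib)
    also have "\<dots> \<le> sqrt C * (\<Prod>i\<in>I. (L i / (R - cmod w)) powr \<nu> i)"
    proof (intro mult_left_mono prod_mono conjI)
      fix i assume i: "i \<in> I"
      have wt: "weight i (\<Phi> w) > 0" by (rule weight_pos[OF i in_topspace[OF c]])
      have "y i ^ m i = y i powr real (m i)" using y by (simp add: powr_realpow)
      also have "\<dots> = (y i powr e i) powr \<nu> i" using m[OF i] by (simp add: powr_powr e_def mult.commute)
      finally have "(cmod (deriv (h i \<circ> \<Phi>) w) / weight i (\<Phi> w)) powr \<nu> i * y i ^ m i
          = (cmod (deriv (h i \<circ> \<Phi>) w) / weight i (\<Phi> w) * y i powr e i) powr \<nu> i"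
        by (simp only: powr_mult)
      also have "\<dots> \<le> (L i / (R - cmod w)) powr \<nu> i"
      proof (rule powr_mono2)
        show "cmod (deriv (h i \<circ> \<Phi>) w) / weight i (\<Phi> w) * y i powr e i \<le> L i / (R - cmod w)"
          using L(2)[OF i \<Phi> w] wt Rw by (simp add: y_def field_simps)
      qed (use \<nu>_pos[OF i] wt in auto)
      finally show "(cmod (deriv (h i \<circ> \<Phi>) w) / weight i (\<Phi> w)) powr \<nu> i * y i ^ m i \<le> (L i / (R - cmod w)) powr \<nu> i" .
      show "0 \<le> (cmod (deriv (h i \<circ> \<Phi>) w) / weight i (\<Phi> w)) powr \<nu> i * y i ^ m i"
        using y[of i] by simp
    qed (use C in auto)
    also have "(\<Prod>i\<in>I. (L i / (R - cmod w)) powr \<nu> i) = (\<Prod>i\<in>I. L i powr \<nu> i) / (R - cmod w) powr sum \<nu> I"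
      using Rw by (simp add: powr_divide prod_dividef powr_sum)
    finally show ?thesis unfolding C'_def by (simp only: times_divide_eq_right)
  qed
  obtain x where x: "x \<in> topspace X" "limitin X (\<Phi> \<circ> (\<lambda>j. of_real (flat.ray_parameter j) * a)) x sequentially"
    by (rule flat.ray_converges[OF \<Phi> R a \<nu>01 C' est ds2 complete])
  have "x \<notin> regular_set"
  proof (rule bdry[OF _ _ x(2)])
    show "range (\<lambda>j. of_real (flat.ray_parameter j) * a) \<subseteq> ball 0 R"
      using flat.ray_parameter_bounds(1,2) a R by (auto simp: norm_mult)
    have "(\<lambda>j. complex_of_real (flat.ray_parameter j) * a) \<longlonglongrightarrow> of_real 1 * a"
      by (intro tendsto_mult tendsto_of_real tendsto_const flat.ray_parameter_tendsto)
    then show "(\<lambda>j. complex_of_real (flat.ray_parameter j) * a) \<longlonglongrightarrow> a" by simp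
  qed
  then obtain c \<rho> \<gamma> where c: "c \<in> \<A>" "x \<in> fst c" and \<rho>: "\<rho> > 0" and \<gamma>: "\<gamma> > 0"
    and sing: "\<And>y. y \<in> fst c \<Longrightarrow> y \<in> regular_set \<Longrightarrow> cmod (snd c y - snd c x) \<le> \<rho> \<Longrightarrow>
      \<gamma> \<le> \<sigma> c y * cmod (snd c y - snd c x)"
    using density_near_singular_point[OF x(1)] by metis
  show False
    using flat.ray_avoids_singular_point[OF \<Phi> R a c \<open>x \<notin> regular_set\<close> \<rho> \<gamma> sing] x(2) by blast
qed

end

section \<open>Coordinates of the Riemann sphere and normalization of the metric\<close>

text \<open>
  A Moebius transformation that sends \<open>e\<close> to infinity. At \<open>e\<close> itself its value is arbitrary.
\<close>

definition sphere_coord :: "complex option \<Rightarrow> complex option \<Rightarrow> complex" where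
  "sphere_coord e p = (case e of None \<Rightarrow> the p
     | Some a \<Rightarrow> (case p of None \<Rightarrow> 0 | Some z \<Rightarrow> inverse (z - a)))"

text \<open>
  Up to the factor \<open>|pole_factor|\<^sup>2\<close>, this is \<open>1 + |z|\<^sup>2\<close> for the point \<open>z\<close> with transformed coordinate \<open>w\<close>. It is smooth and
  positive even at \<open>w = 0\<close>, which corresponds to infinity when \<open>e\<close> is finite.
\<close>

definition chordal_factor :: "complex option \<Rightarrow> complex \<Rightarrow> real" where
  "chordal_factor e w = (case e of None \<Rightarrow> 1 + (cmod w)\<^sup>2 | Some a \<Rightarrow> (cmod w)\<^sup>2 + (cmod (1 + a * w))\<^sup>2)"

definition pole_factor :: "complex option \<Rightarrow> complex \<Rightarrow> complex" where
  "pole_factor e w = (case e of None \<Rightarrow> 1 | Some a \<Rightarrow> inverse w)"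

lemma one_plus_norm_square_sphere_coord:
  assumes "p \<noteq> None" "p \<noteq> e"
  shows "1 + (cmod (the p))\<^sup>2 = chordal_factor e (sphere_coord e p) * (cmod (pole_factor e (sphere_coord e p)))\<^sup>2"
proof (cases e)
  case None
  then show ?thesis by (simp add: sphere_coord_def chordal_factor_def pole_factor_def)
next
  case (Some a)
  obtain z where z: "p = Some z" using assms by blast
  define d where "d = z - a"
  have d: "d \<noteq> 0" using assms Some z by (simp add: d_def)
  have "1 + a * inverse d = z * inverse d" using d by (simp add: d_def field_simps)
  then have "chordal_factor e (inverse d) = (1 + (cmod z)\<^sup>2) * (inverse (cmod d))\<^sup>2"
    using Some by (simp add: chordal_factor_def norm_mult norm_inverse power_mult_distrib algebra_simps)
  then show ?thesis
    using Some z d by (simp add: sphere_coord_def pole_factor_def d_def[symmetric] power_inverse)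
qed

lemma chordal_factor_pos: "0 < chordal_factor e w"
proof (cases e)
  case None
  then show ?thesis by (simp add: chordal_factor_def add_pos_nonneg)
next
  case (Some a)
  have "w \<noteq> 0 \<or> 1 + a * w \<noteq> 0" by auto
  then have "0 < (cmod w)\<^sup>2 + (cmod (1 + a * w))\<^sup>2"
    using sum_power2_gt_zero_iff[of "cmod w" "cmod (1 + a * w)"] by simp
  then show ?thesis using Some by (simp add: chordal_factor_def)
qed

lemma chordal_factor_bound:
  obtains C where "0 < C" "\<And>w. chordal_factor e w \<le> C * (1 + cmod w)\<^sup>2"
proof (cases e)
  case None
  have "chordal_factor e w \<le> 1 * (1 + cmod w)\<^sup>2" for w
    using None by (simp add: chordal_factor_def power2_sum)
  then show thesis using that[of 1] by simp
next
  case (Some a)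
  have "chordal_factor e w \<le> (1 + (1 + cmod a)\<^sup>2) * (1 + cmod w)\<^sup>2" for w
  proof -
    have "cmod (1 + a * w) \<le> 1 + cmod a * cmod w"
      using norm_triangle_ineq[of 1 "a * w"] by (simp add: norm_mult)
    also have "\<dots> \<le> (1 + cmod a) * (1 + cmod w)" by (simp add: algebra_simps)
    finally have "(cmod (1 + a * w))\<^sup>2 \<le> ((1 + cmod a) * (1 + cmod w))\<^sup>2" by (rule power_mono) simp
    moreover have "(cmod w)\<^sup>2 \<le> (1 + cmod w)\<^sup>2" by (rule power_mono) auto
    ultimately have "chordal_factor e w \<le> (1 + cmod w)\<^sup>2 + ((1 + cmod a) * (1 + cmod w))\<^sup>2"
      unfolding chordal_factor_def Some option.case by (intro add_mono)
    also have "\<dots> = (1 + (1 + cmod a)\<^sup>2) * (1 + cmod w)\<^sup>2"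
      unfolding power_mult_distrib by (simp only: distrib_right mult_1)
    finally show ?thesis .
  qed
  moreover have "0 < 1 + (1 + cmod a)\<^sup>2" by (simp add: add_pos_nonneg)
  ultimately show thesis using that by blast
qed

lemma continuous_chordal_factor: "continuous_on A (chordal_factor e)"
  unfolding chordal_factor_def by (cases e) (auto intro!: continuous_intros)

lemma inj_on_sphere_coord: "inj_on (sphere_coord e) (- {e})"
  by (auto simp: inj_on_def sphere_coord_def split: option.splits)

context riemann_surface
begin

lemma sphere_coord_holomorphic:
  assumes g: "holomorphic_map X \<A> riemann_sphere sphere_atlas g" and e: "\<And>p. p \<in> topspace X \<Longrightarrow> g p \<noteq> e"
  shows "holomorphic_function (\<lambda>p. sphere_coord e (g p))"
  unfolding holomorphic_function_def
proof
  fix c assume c: "c \<in> \<A>"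
  note ch = charts[OF c]
  define F where "F = (\<lambda>p. sphere_coord e (g p)) \<circ> chart_inv c"
  define U where "U = snd c ` {p \<in> fst c. g p \<in> fst finite_chart}"
  define V where "V = snd c ` {p \<in> fst c. g p \<in> fst infinity_chart}"
  have cont: "continuous_map X riemann_sphere g" using g by (simp add: holomorphic_map_def)
  have op: "open (snd c ` {p \<in> fst c. g p \<in> fst d})" if "d \<in> sphere_atlas" for d
  proof (rule chart_open_image[OF ch])
    have "openin riemann_sphere (fst d)"
      using that is_chart_finite is_chart_infinity by (auto simp: sphere_atlas_def is_chart_def)
    then have "openin X {p \<in> topspace X. g p \<in> fst d}"
      using cont openin_continuous_map_preimage by blast
    then have "openin X (fst c \<inter> {p \<in> topspace X. g p \<in> fst d})"
      using open_chart_domain[OF c] by blast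
    moreover have "fst c \<inter> {p \<in> topspace X. g p \<in> fst d} = {p \<in> fst c. g p \<in> fst d}"
      using openin_subset[OF open_chart_domain[OF c]] by blast
    ultimately show "openin X {p \<in> fst c. g p \<in> fst d}" by simp
  qed blast
  have oU: "open U" and oV: "open V"
    unfolding U_def V_def by (rule op, simp add: sphere_atlas_def)+
  have hU: "(snd finite_chart \<circ> g \<circ> chart_inv c) holomorphic_on U"
    and hV: "(snd infinity_chart \<circ> g \<circ> chart_inv c) holomorphic_on V"
    using g c unfolding holomorphic_map_def U_def V_def by (auto simp: sphere_atlas_def)
  have g_ne: "g p \<noteq> e" if "p \<in> fst c" for p
    using e that openin_subset[OF open_chart_domain[OF c]] by blast
  have rep: "\<exists>p. p \<in> fst c \<and> chart_inv c z = p \<and> g p \<in> fst finite_chart" if "z \<in> U" for z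
    using that chart_inv_chart[OF ch] by (auto simp: U_def)
  have rep': "\<exists>p. p \<in> fst c \<and> chart_inv c z = p \<and> g p \<in> fst infinity_chart" if "z \<in> V" for z
    using that chart_inv_chart[OF ch] by (auto simp: V_def)
  have UV: "snd c ` fst c = U \<union> V"
    by (auto simp: U_def V_def finite_chart_def infinity_chart_def)
  have "F holomorphic_on U"
  proof (cases e)
    case None
    show ?thesis
      by (rule holomorphic_transform[OF hU]) (auto simp: F_def sphere_coord_def None finite_chart_def)
  next
    case (Some a)
    have ne: "(snd finite_chart \<circ> g \<circ> chart_inv c) z - a \<noteq> 0" if z: "z \<in> U" for z
    proof -
      obtain p where p: "p \<in> fst c" "chart_inv c z = p" "g p \<in> fst finite_chart" using rep[OF z] by blast
      then show ?thesis using g_ne[OF p(1)] Some by (auto simp: finite_chart_def)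
    qed
    have "(\<lambda>z. inverse ((snd finite_chart \<circ> g \<circ> chart_inv c) z - a)) holomorphic_on U"
      by (intro holomorphic_on_inverse holomorphic_on_diff holomorphic_on_const hU ne)
    then show ?thesis
    proof (rule holomorphic_transform)
      fix z assume z: "z \<in> U"
      obtain p where "p \<in> fst c" "chart_inv c z = p" "g p \<in> fst finite_chart" using rep[OF z] by blast
      then show "inverse ((snd finite_chart \<circ> g \<circ> chart_inv c) z - a) = F z"
        by (auto simp: F_def sphere_coord_def Some finite_chart_def)
    qed
  qed
  moreover have "F holomorphic_on V"
  proof (cases e)
    case None
    have ne: "(snd infinity_chart \<circ> g \<circ> chart_inv c) z \<noteq> 0" if z: "z \<in> V" for z
    proof -
      obtain p where p: "p \<in> fst c" "chart_inv c z = p" "g p \<in> fst infinity_chart" using rep'[OF z] by blast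
      then show ?thesis using g_ne[OF p(1)] None by (auto simp: infinity_chart_def)
    qed
    have "(\<lambda>z. inverse ((snd infinity_chart \<circ> g \<circ> chart_inv c) z)) holomorphic_on V"
      by (intro holomorphic_on_inverse hV ne)
    then show ?thesis
    proof (rule holomorphic_transform)
      fix z assume z: "z \<in> V"
      obtain p where p: "p \<in> fst c" "chart_inv c z = p" "g p \<in> fst infinity_chart" using rep'[OF z] by blast
      then show "inverse ((snd infinity_chart \<circ> g \<circ> chart_inv c) z) = F z"
        using g_ne[OF p(1)] None by (auto simp: F_def sphere_coord_def infinity_chart_def)
    qed
  next
    case (Some a)
    let ?w = "snd infinity_chart \<circ> g \<circ> chart_inv c"
    have eq: "1 - a * ?w z \<noteq> 0 \<and> ?w z / (1 - a * ?w z) = F z" if z: "z \<in> V" for z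
    proof -
      obtain p where p: "p \<in> fst c" "chart_inv c z = p" "g p \<in> fst infinity_chart" using rep'[OF z] by blast
      show ?thesis
      proof (cases "g p")
        case None
        then show ?thesis using p by (simp add: F_def sphere_coord_def Some infinity_chart_def)
      next
        case (Some y)
        have y: "y \<noteq> 0" "y \<noteq> a" using p(3) g_ne[OF p(1)] Some \<open>e = Some a\<close> by (auto simp: infinity_chart_def)
        then have "1 - a * inverse y = (y - a) / y" by (simp add: field_simps)
        then show ?thesis using p(2) y Some \<open>e = Some a\<close>
          by (simp add: F_def sphere_coord_def infinity_chart_def field_simps)
      qed
    qed
    have "(\<lambda>z. ?w z / (1 - a * ?w z)) holomorphic_on V"
      by (intro holomorphic_on_divide holomorphic_on_diff holomorphic_on_mult holomorphic_on_const hV)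
        (use eq in blast)
    then show ?thesis by (rule holomorphic_transform) (use eq in auto)
  qed
  ultimately have "F holomorphic_on snd c ` fst c"
    unfolding UV using oU oV by (rule holomorphic_on_Un)
  then show "((\<lambda>p. sphere_coord e (g p)) \<circ> chart_inv c) holomorphic_on snd c ` fst c" by (simp add: F_def)
qed

lemma conformal_metric_continuous:
  assumes "conformal_metric \<A> ds2" "c \<in> \<A>"
  shows "continuous_on (snd c ` fst c) (\<lambda>z. ds2 c (chart_inv c z))"
proof -
  have "Ck_on 0 (ds2 c \<circ> chart_inv c) (snd c ` fst c)"
    using assms unfolding conformal_metric_def smooth_function_on_def by blast
  then show ?thesis by (simp add: o_def)
qed

lemma dense_set_meets_chart_ball:
  assumes R: "X closure_of R = topspace X" and c: "c \<in> \<A>" "p \<in> fst c" and r: "0 < r" "ball (snd c p) r \<subseteq> snd c ` fst c"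
  obtains z where "z \<in> ball (snd c p) r" "chart_inv c z \<in> R" 
proof -
  define N where "N = {q \<in> fst c. snd c q \<in> ball (snd c p) r}"
  have "openin X N" unfolding N_def by (rule chart_open_preimage[OF charts[OF c(1)]]) simp
  moreover have "p \<in> N" using c r by (simp add: N_def)
  moreover have "p \<in> X closure_of R" using R c openin_subset[OF open_chart_domain[OF c(1)]] by blast
  ultimately obtain q where q: "q \<in> R" "q \<in> N" unfolding in_closure_of by blast
  then show thesis
    using that[of "snd c q"] chart_inv_chart[OF charts[OF c(1)], of q] by (simp add: N_def)
qed

end

text \<open>
  Near \<open>a\<close> the function is bounded because its modulus extends continuously, so that the singularity is removable.
\<close>

lemma removable_modulus:
  fixes f :: "complex \<Rightarrow> complex" and k :: "complex \<Rightarrow> real"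
  assumes r: "0 < r" and f: "f holomorphic_on ball a r - {a}"
    and k: "continuous_on (ball a r) k" and eq: "\<And>z. z \<in> ball a r - {a} \<Longrightarrow> cmod (f z) = k z"
  obtains u where "u holomorphic_on ball a r" "\<And>z. z \<in> ball a r \<Longrightarrow> cmod (u z) = k z"
proof -
  have ev: "\<forall>\<^sub>F z in at a. z \<in> ball a r - {a}"
    using r by (auto simp: eventually_at dist_commute intro!: exI[of _ r])
  have lim: "(k \<longlongrightarrow> k a) (at a)"
    using k r by (simp add: continuous_on_eq_continuous_at isContD)
  then have "\<forall>\<^sub>F z in at a. k z < k a + 1" by (rule order_tendstoD) simp
  then have "\<forall>\<^sub>F z in at a. cmod (f z) \<le> k a + 1"
    using ev by eventually_elim (simp add: eq)
  then obtain u where u: "u holomorphic_on ball a r" "\<And>z. z \<in> ball a r - {a} \<Longrightarrow> u z = f z"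
    using holomorphic_on_extend_bounded[OF f] r by auto
  have "((\<lambda>z. cmod (u z)) \<longlongrightarrow> cmod (u a)) (at a)"
    using holomorphic_on_imp_continuous_on[OF u(1)] r
    by (intro tendsto_norm) (simp add: continuous_on_eq_continuous_at isContD)
  moreover have "\<forall>\<^sub>F z in at a. cmod (u z) = k z" using ev by eventually_elim (simp add: u(2) eq)
  ultimately have "(k \<longlongrightarrow> cmod (u a)) (at a)" by (rule Lim_transform_eventually)
  then have "cmod (u a) = k a" using lim by (intro tendsto_unique[of "at a"]) auto
  then have "cmod (u z) = k z" if "z \<in> ball a r" for z
    using u(2)[of z] eq[of z] that by (cases "z = a") auto
  then show thesis using that[OF u(1)] by blast
qed

context riemann_surface
begin

text \<open>
  If infinity is not the omitted value \<open>e\<close>, poles are zeros of the holomorphic function \<open>sphere_coord e \<circ> g\<close>. It is not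
  identically zero near \<open>p\<close>, as \<open>g\<close> is finite on a dense set.
\<close>

lemma poles_isolated:
  assumes h: "holomorphic_function (\<lambda>p. sphere_coord e (g p))"
    and g_ne: "\<And>p. p \<in> topspace X \<Longrightarrow> g p \<noteq> e"
    and R: "X closure_of R = topspace X" "\<And>p. p \<in> R \<Longrightarrow> g p \<noteq> None"
    and c: "c \<in> \<A>" "p \<in> fst c"
  shows "\<forall>\<^sub>F z in at (snd c p). g (chart_inv c z) \<noteq> None"
proof -
  note ch = charts[OF c(1)]
  define z0 where "z0 = snd c p"
  obtain r1 where "r1 > 0" "ball (snd c p) r1 \<subseteq> snd c ` (fst c \<inter> fst c)"
    by (rule chart_ball[OF ch c(2) open_chart_domain[OF c(1)] c(2)])
  then have r1: "r1 > 0" "ball z0 r1 \<subseteq> snd c ` fst c" by (simp_all add: z0_def)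
  have inv_top: "chart_inv c z \<in> topspace X" if "z \<in> snd c ` fst c" for z
    using inv_into_into[OF that] openin_subset[OF open_chart_domain[OF c(1)]] by blast
  define f where "f = (\<lambda>p. sphere_coord e (g p)) \<circ> chart_inv c"
  have f: "f holomorphic_on ball z0 r1"
    unfolding f_def using h c(1) unfolding holomorphic_function_def
    by (intro holomorphic_on_subset[OF _ r1(2)]) blast
  have pole: "f z = 0 \<and> e \<noteq> None" if "z \<in> ball z0 r1" "g (chart_inv c z) = None" for z
  proof -
    have "e \<noteq> None" using g_ne[OF inv_top[OF subsetD[OF r1(2) that(1)]]] that(2) by metis
    then show ?thesis using that(2) by (auto simp: f_def sphere_coord_def)
  qed
  have "\<forall>\<^sub>F z in at z0. g (chart_inv c z) \<noteq> None"
  proof (cases "e")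
    case None
    have "\<forall>\<^sub>F z in at z0. z \<in> ball z0 r1" using r1(1) by (intro eventually_at_in_open') auto
    then show ?thesis by eventually_elim (use pole None in blast)
  next
    case (Some a)
    obtain w where "w \<in> ball (snd c p) r1" "chart_inv c w \<in> R"
      by (rule dense_set_meets_chart_ball[OF R(1) c r1[unfolded z0_def]])
    then have w: "w \<in> ball z0 r1" "chart_inv c w \<in> R" by (simp_all add: z0_def)
    have "g (chart_inv c w) \<noteq> None" by (rule R(2)[OF w(2)])
    moreover have "g (chart_inv c w) \<noteq> Some a"
      using g_ne[OF inv_top[OF subsetD[OF r1(2) w(1)]]] Some by simp
    ultimately have fw: "f w \<noteq> 0" using Some by (auto simp: f_def sphere_coord_def)
    have "\<forall>\<^sub>F z in at z0. f z \<noteq> 0"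
      using non_zero_neighbour_alt[OF f open_ball connected_ball _ w(1) fw, of z0] r1(1)
      by (auto elim: eventually_mono)
    moreover have "\<forall>\<^sub>F z in at z0. z \<in> ball z0 r1" using r1(1) by (intro eventually_at_in_open') auto
    ultimately show ?thesis by eventually_elim (use pole in blast)
  qed
  then show ?thesis by (simp add: z0_def)
qed

text \<open>
  Away from poles the quotient of the metric by the chordal factors is the squared modulus of \<open>\<omega> \<Prod> h\<^sub>i\<^bsup>-m\<^sub>i\<^esup>\<close>, the product
  over those \<open>i\<close> for which the omitted value is finite, times a constant from the constant components. The quotient is
  continuous and positive at the poles too: there the zeros of \<open>\<omega>\<close> cancel those of the \<open>h\<^sub>i\<close>.
\<close>

lemma normalized_density_locally_modulus:
  assumes ds2: "conformal_metric \<A> ds2" and \<omega>: "holomorphic_1form \<A> \<omega>"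
    and product: "is_product_metric X \<A> n g m \<omega> ds2" and I: "I \<subseteq> {1..n}"
    and h_hol: "\<And>i. i \<in> I \<Longrightarrow> holomorphic_function (\<lambda>p. sphere_coord (e i) (g i p))"
    and g_ne: "\<And>i p. i \<in> I \<Longrightarrow> p \<in> topspace X \<Longrightarrow> g i p \<noteq> e i"
    and const_g: "\<And>i. i \<in> {1..n} - I \<Longrightarrow> g i constant_on topspace X"
    and c: "c \<in> \<A>" "p \<in> fst c"
  shows "\<exists>r>0. \<exists>u. ball (snd c p) r \<subseteq> snd c ` fst c \<and> u holomorphic_on ball (snd c p) r \<and>
    (\<forall>z\<in>ball (snd c p) r. u z \<noteq> 0 \<and> cmod (u z) =
      sqrt (ds2 c (chart_inv c z) / (\<Prod>i\<in>I. chordal_factor (e i) (sphere_coord (e i) (g i (chart_inv c z))) ^ m i)))"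
proof -
  define h where "h = (\<lambda>i p. sphere_coord (e i) (g i p))"
  have finI: "finite I" using I finite_subset by blast
  define Q where "Q = (\<lambda>p. \<Prod>i\<in>I. chordal_factor (e i) (h i p) ^ m i)"
  define \<kappa> where "\<kappa> = (\<lambda>c p. sqrt (ds2 c p / Q p))"
  have Q_pos: "Q p > 0" for p unfolding Q_def by (intro prod_pos) (simp add: chordal_factor_pos)
  have ds2_pos: "ds2 c p > 0" if "c \<in> \<A>" "p \<in> fst c" for c p
    using ds2 that unfolding conformal_metric_def by blast
  have \<kappa>2: "(\<kappa> c p)\<^sup>2 * Q p = ds2 c p" "\<kappa> c p > 0" if "c \<in> \<A>" "p \<in> fst c" for c p
    using ds2_pos[OF that] Q_pos[of p] by (simp_all add: \<kappa>_def)
  define R where "R = {p \<in> topspace X. \<forall>i\<in>{1..n}. g i p \<noteq> None}"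
  have metric: "X closure_of R = topspace X \<and> (\<forall>c\<in>\<A>. \<forall>p\<in>fst c \<inter> R.
      ds2 c p = (\<Prod>i=1..n. (1 + (cmod (the (g i p)))\<^sup>2) ^ m i) * (cmod (\<omega> c p))\<^sup>2)"
    using product unfolding is_product_metric_def Let_def R_def .
  then have R: "X closure_of R = topspace X" by (rule conjunct1)
  have ds2_R: "ds2 c p = (\<Prod>i=1..n. (1 + (cmod (the (g i p)))\<^sup>2) ^ m i) * (cmod (\<omega> c p))\<^sup>2"
    if "c \<in> \<A>" "p \<in> fst c" "p \<in> R" for c p
    using bspec[OF bspec[OF conjunct2[OF metric] that(1)] IntI[OF that(2,3)]] .
  note ch = charts[OF c(1)]
  define z0 where "z0 = snd c p"
  obtain r1 where "r1 > 0" "ball (snd c p) r1 \<subseteq> snd c ` (fst c \<inter> fst c)"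
    by (rule chart_ball[OF ch c(2) open_chart_domain[OF c(1)] c(2)])
  then have r1: "r1 > 0" "ball z0 r1 \<subseteq> snd c ` fst c" by (simp_all add: z0_def)
  have inv_in: "chart_inv c z \<in> fst c" if "z \<in> snd c ` fst c" for z
    using that by (rule inv_into_into)
  have inv_top: "chart_inv c z \<in> topspace X" if "z \<in> snd c ` fst c" for z
    using inv_in[OF that] openin_subset[OF open_chart_domain[OF c(1)]] by blast
  obtain p0 where p0: "p0 \<in> R"
  proof -
    obtain z where "z \<in> ball (snd c p) r1" "chart_inv c z \<in> R"
      using dense_set_meets_chart_ball[OF R c r1[unfolded z0_def]] .
    then show thesis using that by blast
  qed
  have const: "g i p' = g i p0" if "i \<in> {1..n} - I" "p' \<in> topspace X" for i p'
  proof -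
    have "g i constant_on topspace X" using that(1) by (rule const_g)
    moreover have "p0 \<in> topspace X" using p0 by (simp add: R_def)
    ultimately show ?thesis using that(2) unfolding constant_on_def by metis
  qed
  have "\<forall>i\<in>I. \<forall>\<^sub>F z in at z0. g i (chart_inv c z) \<noteq> None"
  proof
    fix i assume i: "i \<in> I"
    have fin: "g i p \<noteq> None" if "p \<in> R" for p using that i I by (auto simp: R_def)
    show "\<forall>\<^sub>F z in at z0. g i (chart_inv c z) \<noteq> None"
      unfolding z0_def by (rule poles_isolated[OF h_hol[OF i] g_ne[OF i] R fin c])
  qed
  then have "\<forall>\<^sub>F z in at z0. \<forall>i\<in>I. g i (chart_inv c z) \<noteq> None"
    using finI by (simp add: eventually_ball_finite)
  then obtain r2 where r2: "r2 > 0" "\<And>z i. z \<noteq> z0 \<Longrightarrow> dist z z0 < r2 \<Longrightarrow> i \<in> I \<Longrightarrow> g i (chart_inv c z) \<noteq> None"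
    unfolding eventually_at by blast
  define r where "r = min r1 r2"
  have r: "r > 0" "ball z0 r \<subseteq> snd c ` fst c" using r1 r2(1) by (auto simp: r_def)
  define k0 where "k0 = sqrt (\<Prod>i\<in>{1..n} - I. (1 + (cmod (the (g i p0)))\<^sup>2) ^ m i)"
  define f where "f = (\<lambda>z. of_real k0 * \<omega> c (chart_inv c z) * (\<Prod>i\<in>I. pole_factor (e i) (h i (chart_inv c z)) ^ m i))"
  have fin: "g i (chart_inv c z) \<noteq> None" "g i (chart_inv c z) \<noteq> e i" if "z \<in> ball z0 r - {z0}" "i \<in> I" for z i
    using r2(2)[of z i] g_ne[OF that(2) inv_top] that r(2) by (auto simp: r_def dist_commute subset_iff)
  have in_R: "chart_inv c z \<in> R" if z: "z \<in> ball z0 r - {z0}" for z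
  proof -
    have top: "chart_inv c z \<in> topspace X" using inv_top z r(2) by blast
    have "g i (chart_inv c z) \<noteq> None" if "i \<in> {1..n}" for i
      using fin(1)[OF z] const[OF _ top, of i] p0 that by (cases "i \<in> I") (auto simp: R_def)
    then show ?thesis using top by (simp add: R_def)
  qed
  have f_eq: "cmod (f z) = \<kappa> c (chart_inv c z)" if z: "z \<in> ball z0 r - {z0}" for z
  proof -
    define y where "y = chart_inv c z"
    have y: "y \<in> fst c" "y \<in> R" "y \<in> topspace X" using inv_in in_R[OF z] inv_top z r(2) by (auto simp: y_def)
    have "ds2 c y = (\<Prod>i=1..n. (1 + (cmod (the (g i y)))\<^sup>2) ^ m i) * (cmod (\<omega> c y))\<^sup>2"
      by (rule ds2_R[OF c(1) y(1,2)])
    also have "(\<Prod>i=1..n. (1 + (cmod (the (g i y)))\<^sup>2) ^ m i) =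
        (\<Prod>i\<in>{1..n} - I. (1 + (cmod (the (g i y)))\<^sup>2) ^ m i) * (\<Prod>i\<in>I. (1 + (cmod (the (g i y)))\<^sup>2) ^ m i)"
      using I by (intro prod.subset_diff) auto
    also have "(\<Prod>i\<in>{1..n} - I. (1 + (cmod (the (g i y)))\<^sup>2) ^ m i) = k0\<^sup>2"
    proof -
      have "(\<Prod>i\<in>{1..n} - I. (1 + (cmod (the (g i y)))\<^sup>2) ^ m i) = (\<Prod>i\<in>{1..n} - I. (1 + (cmod (the (g i p0)))\<^sup>2) ^ m i)"
        using const[OF _ y(3)] by (intro prod.cong) auto
      then show ?thesis unfolding k0_def by (simp add: prod_nonneg)
    qed
    also have "(\<Prod>i\<in>I. (1 + (cmod (the (g i y)))\<^sup>2) ^ m i) = Q y * (\<Prod>i\<in>I. cmod (pole_factor (e i) (h i y)) ^ m i)\<^sup>2"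
    proof -
      have "(1 + (cmod (the (g i y)))\<^sup>2) ^ m i = chordal_factor (e i) (h i y) ^ m i * (cmod (pole_factor (e i) (h i y)) ^ m i)\<^sup>2"
        if i: "i \<in> I" for i
        using one_plus_norm_square_sphere_coord[OF fin[OF z i]]
        by (simp add: h_def y_def power_mult_distrib mult.commute flip: power_mult)
      then show ?thesis by (simp add: Q_def prod.distrib prod_power_distrib)
    qed
    finally have "ds2 c y = Q y * (cmod (f z))\<^sup>2"
      by (simp add: f_def y_def norm_mult power_mult_distrib mult_ac prod_norm[symmetric] norm_power)
    then have "(\<kappa> c y)\<^sup>2 = (cmod (f z))\<^sup>2" using \<kappa>2(1)[OF c(1) y(1)] Q_pos[of y] by simp
    then show ?thesis using \<kappa>2(2)[OF c(1) y(1)] by (simp add: y_def power2_eq_iff_nonneg)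
  qed
  have hc: "(\<lambda>z. h i (chart_inv c z)) holomorphic_on snd c ` fst c" if "i \<in> I" for i
    using h_hol[OF that] c(1) by (simp add: h_def holomorphic_function_def o_def)
  have f_hol: "f holomorphic_on ball z0 r - {z0}"
  proof -
    have "(\<lambda>z. \<omega> c (chart_inv c z)) holomorphic_on snd c ` fst c"
      using \<omega> c(1) by (simp add: holomorphic_1form_def o_def)
    then have 1: "(\<lambda>z. \<omega> c (chart_inv c z)) holomorphic_on ball z0 r - {z0}"
      by (rule holomorphic_on_subset) (use r(2) in auto)
    have 2: "(\<lambda>z. pole_factor (e i) (h i (chart_inv c z))) holomorphic_on ball z0 r - {z0}" if i: "i \<in> I" for i
    proof (cases "e i")
      case (Some a)
      have "h i (chart_inv c z) \<noteq> 0" if "z \<in> ball z0 r - {z0}" for z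
        using fin[OF that i] Some by (auto simp: h_def sphere_coord_def)
      moreover have "(\<lambda>z. h i (chart_inv c z)) holomorphic_on ball z0 r - {z0}"
        using hc[OF i] by (rule holomorphic_on_subset) (use r(2) in auto)
      ultimately have "(\<lambda>z. inverse (h i (chart_inv c z))) holomorphic_on ball z0 r - {z0}"
        by (intro holomorphic_on_inverse)
      then show ?thesis using Some by (simp add: pole_factor_def)
    qed (simp add: pole_factor_def)
    show ?thesis unfolding f_def using 1 2 by (intro holomorphic_intros)
  qed
  have "continuous_on (ball z0 r) (\<lambda>z. \<kappa> c (chart_inv c z))"
  proof -
    have "continuous_on (ball z0 r) (\<lambda>z. ds2 c (chart_inv c z))"
      using conformal_metric_continuous[OF ds2 c(1)] r(2) by (rule continuous_on_subset)
    moreover have "continuous_on (ball z0 r) (\<lambda>z. chordal_factor (e i) (h i (chart_inv c z)))" if "i \<in> I" for i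
      using holomorphic_on_imp_continuous_on[OF holomorphic_on_subset[OF hc[OF that] r(2)]]
      by (intro continuous_on_compose2[OF continuous_chordal_factor[of UNIV]]) auto
    moreover have "(\<Prod>i\<in>I. chordal_factor (e i) (h i (chart_inv c z)) ^ m i) \<noteq> 0" for z
      using Q_pos[of "chart_inv c z"] by (simp add: Q_def)
    ultimately show ?thesis unfolding \<kappa>_def Q_def
      by (intro continuous_on_real_sqrt continuous_on_divide continuous_on_prod continuous_on_power) auto
  qed
  then obtain u where u: "u holomorphic_on ball z0 r" "\<And>z. z \<in> ball z0 r \<Longrightarrow> cmod (u z) = \<kappa> c (chart_inv c z)"
    using removable_modulus[OF r(1) f_hol _ f_eq] by blast
  have "u z \<noteq> 0" if "z \<in> ball z0 r" for z
    using u(2)[OF that] \<kappa>2(2)[OF c(1) inv_in] that r(2) by (metis norm_zero less_irrefl subsetD)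
  then show ?thesis using r u unfolding z0_def \<kappa>_def Q_def h_def by blast
qed

end

section \<open>Omitted values and completeness\<close>

theorem theorem2p1:
  fixes X :: "'a topology" and \<A> :: "'a chart set"
    and n k :: nat
    and g :: "nat \<Rightarrow> 'a \<Rightarrow> complex option"
    and \<omega> :: "'a chart \<Rightarrow> 'a \<Rightarrow> complex"
    and ds2 :: "'a chart \<Rightarrow> 'a \<Rightarrow> real"
    and m q idx :: "nat \<Rightarrow> nat"
  assumes "open_riemann_surface X \<A>"
    and "holomorphic_map_to_spheres X \<A> n g"
    and "holomorphic_1form \<A> \<omega>"
    and "\<And>i. i \<in> {1..n} \<Longrightarrow> 0 < m i"
    and "conformal_metric \<A> ds2"
    and "is_product_metric X \<A> n g m \<omega> ds2"
    and "1 \<le> k"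
    and "strict_mono_on {1..k} idx" and "idx ` {1..k} \<subseteq> {1..n}"
    and "\<And>l. l \<in> {1..k} \<Longrightarrow> \<not> g (idx l) constant_on topspace X"
    and "\<And>i. i \<in> {1..n} - idx ` {1..k} \<Longrightarrow> g i constant_on topspace X"
    and "complete_metric X \<A> ds2"
    and "\<And>l. l \<in> {1..k} \<Longrightarrow> 2 < q (idx l)"
    and "\<And>l. l \<in> {1..k} \<Longrightarrow> omits_values X (g (idx l)) (q (idx l))"
  shows "(\<Sum>l=1..k. real (m (idx l)) / (real (q (idx l)) - 2)) \<ge> 1"
proof (rule ccontr)
  interpret open_riemann_surface X \<A> by (rule assms(1))
  define I where "I = idx ` {1..k}"
  have inj: "inj_on idx {1..k}" using assms(8) by (rule strict_mono_on_imp_inj_on)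
  have I: "finite I" "I \<noteq> {}" "I \<subseteq> {1..n}" "card I = k"
    using assms(7,9) card_image[OF inj] by (auto simp: I_def)
  define \<mu> where "\<mu> = (\<lambda>i. real (m i) / (real (q i) - 2))"
  assume "\<not> ?thesis"
  then have \<mu>_sum: "sum \<mu> I < 1"
    unfolding I_def \<mu>_def sum.reindex[OF inj] by (simp add: o_def)
  have mpos: "m i > 0" and qi: "q i > 2" and gn: "\<not> g i constant_on topspace X"
      and om: "omits_values X (g i) (q i)" if "i \<in> I" for i
    using that assms(4,9,10,13,14) by (auto simp: I_def)
  have ghol: "holomorphic_map X \<A> riemann_sphere sphere_atlas (g i)" if "i \<in> I" for i
    using assms(2) that I(3) unfolding holomorphic_map_to_spheres_def by blast
  \<comment> \<open>Distributing the gap \<open>d\<close> over \<open>k + 1\<close> equal parts leaves \<open>1 - sum \<nu> I = d / (k + 1)\<close>, which is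
    the part added to each \<open>\<mu> i\<close>. Then \<open>\<eta>\<close> solves \<open>m i = \<nu> i * (q i - 2 - q i * \<eta> i)\<close>.\<close>
  define d where "d = 1 - sum \<mu> I"
  define \<nu> where "\<nu> = (\<lambda>i. \<mu> i + d / (real k + 1))"
  define \<eta> where "\<eta> = (\<lambda>i. (real (q i) - 2 - real (m i) / \<nu> i) / real (q i))"
  have d: "d > 0" using \<mu>_sum by (simp add: d_def)
  have \<mu>: "\<mu> i > 0" if "i \<in> I" for i using mpos[OF that] qi[OF that] by (simp add: \<mu>_def)
  have \<nu>_sum: "sum \<nu> I = 1 - d / (real k + 1)"
  proof -
    have "sum \<nu> I = sum \<mu> I + real k * (d / (real k + 1))" by (simp add: \<nu>_def sum.distrib I(4))
    also have "\<dots> = 1 - d + real k * (d / (real k + 1))" by (simp add: d_def)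
    also have "\<dots> = 1 - d / (real k + 1)" by (simp add: field_simps)
    finally show ?thesis .
  qed
  have \<nu>: "\<nu> i > \<mu> i" for i using d by (simp add: \<nu>_def)
  have \<eta>: "0 < \<eta> i" "\<eta> i < 1" "real (m i) = \<nu> i * (real (q i) - 2 - real (q i) * \<eta> i)" if i: "i \<in> I" for i
  proof -
    have "\<nu> i > 0" using \<mu>[OF i] \<nu>[of i] by linarith
    have "real (m i) = \<mu> i * (real (q i) - 2)" using qi[OF i] by (simp add: \<mu>_def)
    also have "\<dots> < \<nu> i * (real (q i) - 2)" using \<nu> qi[OF i] by (intro mult_strict_right_mono) auto
    finally have "real (m i) / \<nu> i < real (q i) - 2" using \<open>\<nu> i > 0\<close> by (simp add: divide_less_eq mult.commute)
    then show "0 < \<eta> i" using qi[OF i] by (simp add: \<eta>_def)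
    have "real (m i) / \<nu> i > 0" using mpos[OF i] \<open>\<nu> i > 0\<close> by simp
    then show "\<eta> i < 1" using qi[OF i] by (simp add: \<eta>_def divide_less_eq)
    have "real (q i) * \<eta> i = real (q i) - 2 - real (m i) / \<nu> i" using qi[OF i] by (simp add: \<eta>_def)
    then show "real (m i) = \<nu> i * (real (q i) - 2 - real (q i) * \<eta> i)" using \<open>\<nu> i > 0\<close> by simp
  qed
  have "\<forall>i\<in>I. \<exists>E. card E = q i \<and> g i ` topspace X \<inter> E = {}"
    using om unfolding omits_values_def by blast
  then obtain E where E: "\<And>i. i \<in> I \<Longrightarrow> card (E i) = q i" "\<And>i. i \<in> I \<Longrightarrow> g i ` topspace X \<inter> E i = {}"
    by metis
  have "\<forall>i\<in>I. \<exists>e. e \<in> E i"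
    using E(1) qi by (metis card.empty ex_in_conv not_less_zero)
  then obtain e where e: "\<And>i. i \<in> I \<Longrightarrow> e i \<in> E i" by metis
  have g_ne: "g i p \<noteq> e i" if "i \<in> I" "p \<in> topspace X" for i p
    using E(2)[OF that(1)] e[OF that(1)] imageI[OF that(2), of "g i"] by (metis IntI empty_iff)
  define h where "h = (\<lambda>i p. sphere_coord (e i) (g i p))"
  define B where "B = (\<lambda>i. sphere_coord (e i) ` (E i - {e i}))"
  have finE: "finite (E i)" if "i \<in> I" for i using E(1)[OF that] qi[OF that] by (metis card.infinite not_less_zero)
  have cardB: "card (B i) = q i - 1" if i: "i \<in> I" for i
  proof -
    have "inj_on (sphere_coord (e i)) (E i - {e i})" by (rule inj_on_subset[OF inj_on_sphere_coord]) auto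
    then show ?thesis using E(1)[OF i] e[OF i] finE[OF i] by (simp add: B_def card_image)
  qed
  have h_hol: "holomorphic_function (h i)" if "i \<in> I" for i
    unfolding h_def by (rule sphere_coord_holomorphic[OF ghol[OF that] g_ne[OF that]])
  have h_const: "\<not> h i constant_on topspace X" if i: "i \<in> I" for i
  proof
    assume "h i constant_on topspace X"
    then obtain y where y: "\<And>p. p \<in> topspace X \<Longrightarrow> sphere_coord (e i) (g i p) = y"
      unfolding constant_on_def h_def by blast
    have "g i p = g i p'" if "p \<in> topspace X" "p' \<in> topspace X" for p p'
      using inj_onD[OF inj_on_sphere_coord, of "e i" "g i p" "g i p'"] y that g_ne[OF i] by simp
    then have "g i constant_on topspace X" unfolding constant_on_def by blast
    then show False using gn[OF i] by simp
  qed
  have h_om: "h i ` topspace X \<inter> B i = {}" if i: "i \<in> I" for i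
  proof (rule ccontr)
    assume "h i ` topspace X \<inter> B i \<noteq> {}"
    then obtain p v where pv: "p \<in> topspace X" "v \<in> E i" "v \<noteq> e i" "sphere_coord (e i) (g i p) = sphere_coord (e i) v"
      by (auto simp: h_def B_def)
    then have "g i p = v" using inj_onD[OF inj_on_sphere_coord pv(4)] g_ne[OF i] by simp
    then show False using E(2)[OF i] pv by blast
  qed
  define Q where "Q = (\<lambda>p. \<Prod>i\<in>I. chordal_factor (e i) (h i p) ^ m i)"
  define \<kappa> where "\<kappa> = (\<lambda>c p. sqrt (ds2 c p / Q p))"
  have Q_pos: "Q p > 0" for p unfolding Q_def by (intro prod_pos) (simp add: chordal_factor_pos)
  have ds2_pos: "ds2 c p > 0" if "c \<in> \<A>" "p \<in> fst c" for c p
    using assms(5) that unfolding conformal_metric_def by blast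
  have \<kappa>2: "(\<kappa> c p)\<^sup>2 * Q p = ds2 c p" "\<kappa> c p > 0" if "c \<in> \<A>" "p \<in> fst c" for c p
    using ds2_pos[OF that] Q_pos[of p] by (simp_all add: \<kappa>_def)
  have \<kappa>_tr: "\<kappa> c p = \<kappa> c' p * cmod (transition_deriv c c' p)"
    if "c \<in> \<A>" "c' \<in> \<A>" "p \<in> fst c" "p \<in> fst c'" for c c' p
  proof -
    have "ds2 c p = ds2 c' p * (cmod (transition_deriv c c' p))\<^sup>2"
      using assms(5) that unfolding conformal_metric_def by blast
    then have "\<kappa> c p = sqrt (ds2 c' p / Q p * (cmod (transition_deriv c c' p))\<^sup>2)"
      by (simp add: \<kappa>_def)
    then show ?thesis by (simp only: real_sqrt_mult) (simp add: \<kappa>_def)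
  qed
  have \<kappa>_flat: "\<exists>r>0. \<exists>u. ball (snd c p) r \<subseteq> snd c ` fst c \<and> u holomorphic_on ball (snd c p) r \<and>
        (\<forall>z\<in>ball (snd c p) r. u z \<noteq> 0 \<and> cmod (u z) = \<kappa> c (chart_inv c z))"
    if c: "c \<in> \<A>" "p \<in> fst c" for c p
    using normalized_density_locally_modulus[OF assms(5,3,6) I(3), of e c p] h_hol g_ne assms(11) c
    unfolding \<kappa>_def Q_def h_def I_def by blast
  interpret omitting_functions X \<A> I h B \<kappa> \<nu> \<eta>
  proof
    show "finite I" "I \<noteq> {}" using I by auto
    show "sum \<nu> I < 1" using \<nu>_sum d by simp
    show "1 - sum \<nu> I \<le> \<nu> i" if "i \<in> I" for i using \<nu>_sum \<mu>[OF that] by (simp add: \<nu>_def)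
    show "finite (B i)" if "i \<in> I" for i using finE[OF that] by (simp add: B_def)
    show "2 \<le> card (B i)" if "i \<in> I" for i using cardB[OF that] qi[OF that] by simp
    show "0 < \<eta> i" "\<eta> i < 1" if "i \<in> I" for i using \<eta>[OF that] by auto
  qed (fact h_hol h_const h_om \<kappa>_tr \<kappa>_flat)+
  have "\<forall>i\<in>I. \<exists>C>0. \<forall>w. chordal_factor (e i) w \<le> C * (1 + cmod w)\<^sup>2"
  proof
    fix i
    show "\<exists>C>0. \<forall>w. chordal_factor (e i) w \<le> C * (1 + cmod w)\<^sup>2"
      by (rule chordal_factor_bound) blast
  qed
  then obtain C where C: "\<And>i. i \<in> I \<Longrightarrow> C i > 0" "\<And>i w. i \<in> I \<Longrightarrow> chordal_factor (e i) w \<le> C i * (1 + cmod w)\<^sup>2"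
    by metis
  have "\<not> complete_metric X \<A> ds2"
  proof (rule not_complete[OF assms(5)])
    show "(\<Prod>i\<in>I. C i ^ m i) > 0" using C(1) by (intro prod_pos) simp
    fix c p assume c: "c \<in> \<A>" "p \<in> fst c"
    have "Q p \<le> (\<Prod>i\<in>I. (C i * (1 + cmod (h i p))\<^sup>2) ^ m i)"
      unfolding Q_def using C(2) chordal_factor_pos
      by (intro prod_mono conjI power_mono) (auto intro: less_imp_le)
    also have "\<dots> = (\<Prod>i\<in>I. C i ^ m i) * (\<Prod>i\<in>I. (1 + cmod (h i p)) ^ (2 * m i))"
      by (simp add: power_mult_distrib prod.distrib power_mult)
    finally have "(\<kappa> c p)\<^sup>2 * Q p \<le> (\<kappa> c p)\<^sup>2 * ((\<Prod>i\<in>I. C i ^ m i) * (\<Prod>i\<in>I. (1 + cmod (h i p)) ^ (2 * m i)))"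
      by (rule mult_left_mono) simp
    then show "ds2 c p \<le> (\<Prod>i\<in>I. C i ^ m i) * (\<kappa> c p)\<^sup>2 * (\<Prod>i\<in>I. (1 + cmod (h i p)) ^ (2 * m i))"
      using \<kappa>2(1)[OF c] by (simp add: mult_ac)
  next
    fix i assume i: "i \<in> I"
    have "real (card (B i)) - 1 = real (q i) - 2" "real (card (B i)) + 1 = real (q i)"
      using cardB[OF i] qi[OF i] by (auto simp: of_nat_diff)
    then show "real (m i) = \<nu> i * (real (card (B i)) - 1 - (real (card (B i)) + 1) * \<eta> i)"
      using \<eta>(3)[OF i] by simp
  qed
  then show False using assms(12) by contradiction
qed

end
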